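(* Let $d\ge2$, let $(f_n)_n$ be a sequence of rational maps of degree $d$, and let $M_1,\dots,M_p$ ($p\ge1$) be equivalence classes of rescalings of $(f_n)_n$. Then, after passing to a subsequence, there exist finite sets $X\subseteq Y\cap Z$, a portrait $\mathbf{F}$ of degree $d$ from $Y$ to $Z$, marked spheres $y_n,z_n$ such that $(f_n,y_n,z_n)$ is a rational map dynamically marked by $(\mathbf{F},X)$ for every $n$, and a dynamical system of (projective, holomorphic, stable) trees of spheres $(\mathcal{F},\mathcal{T}^X)$, $\mathcal{F}:\mathcal{T}^Y\to\mathcal{T}^Z$, such that (1) $(f_n,y_n,z_n)_n$ converges dynamically to $(\mathcal{F},\mathcal{T}^X)$ via some $(\phi^Y_n,\phi^Z_n)$, and (2) for every $i\in\{1,\dots,p\}$ there is a vertex $v_i$ of $T^Y$ such that $(\phi^Y_{n,v_i})_n$ belongs to the class $M_i$.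
   Context: Trees. A tree is a finite connected graph without cycles (vertex set $V$, edges $2$-element subsets of $V$, $E_v$ the edges at $v$); leaves are vertices of valence $1$, the others internal vertices $IV$; stable means every internal vertex has valence $\ge3$. For a vertex $v$ and $e\in E_v$, $B_v(e)$ is the component of $T\setminus\{v\}$ containing $e$. A tree marked by a finite set $X$ ($\mathrm{card}\,X\ge3$) has leaf set $X$. Projective trees of spheres. A tree of spheres $\mathcal{T}^X$ consists of a stable tree $T^X$ marked by $X$ and, for each internal vertex $v$, a sphere $\mathbb{S}_v$ with a projective structure (a class of homeomorphisms $\mathbb{S}_v\to\hat{\mathbb{C}}$ modulo Möbius maps) and an injection $i_v:E_v\to\mathbb{S}_v$; $X_v=i_v(E_v)$, $a_v:X\to\mathbb{S}_v$, $a_v(x)=i_v(e)$ for $x\in B_v(e)$. Covers. A cover $\mathcal{F}:\mathcal{T}^Y\to\mathcal{T}^Z$ is a map $F:T^Y\to T^Z$ sending vertices to vertices, edges $\{v,w\}$ to edges $\{F(v),F(w)\}$, $Y$ into $Z$, $IV^Y$ into $IV^Z$, with holomorphic branched coverings $f_v:\mathbb{S}_v\to\mathbb{S}_{F(v)}$ ($v\in IV^Y$) that are coverings off $Y_v$, satisfy $f_v\circ i_v=i_{F(v)}\circ F$ on $E_v$, and have equal local degrees at the two attaching points of any edge between internal vertices. Dynamical systems. $T^X$ compatible with $T^Y$: $X\subseteq Y$, $IV^X\subseteq IV^Y$, and for vertices $v,v_1,v_2,v_3$ of $T^X$, $v$ separates $v_1,v_2,v_3$ (they lie in distinct components of the complement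 of $v$) in $T^X$ iff in $T^Y$; $\mathcal{T}^X\triangleleft\mathcal{T}^Y$ if moreover internal spheres of $\mathcal{T}^X$ are the same projective spheres in $\mathcal{T}^Y$ and $a^X_v=a^Y_v|_X$. A dynamical system is a pair $(\mathcal{F},\mathcal{T}^X)$ with $X\subseteq Y\cap Z$, $\mathcal{T}^X\triangleleft\mathcal{T}^Y$, $\mathcal{T}^X\triangleleft\mathcal{T}^Z$. Marked rational maps. A portrait of degree $d$ is $\mathbf{F}=(F,\deg)$ with $F:Y\to Z$ a map of finite sets and $\deg:Y\to\mathbb{N}\setminus\{0\}$ with $\sum_{a\in Y}(\deg(a)-1)=2d-2$ and $\sum_{a\in F^{-1}(b)}\deg(a)=d$ for every $b\in Z$. A rational map dynamically marked by $(\mathbf{F},X)$ is $(f,y,z)$ with $f$ rational of degree $d$, $y:Y\to\hat{\mathbb{C}}$, $z:Z\to\hat{\mathbb{C}}$ injective, $f\circ y=z\circ F$, $\deg_{y(a)}f=\deg(a)$, and $y|_X=z|_X$. Dynamical convergence. $(f_n,y_n,z_n)$ converges dynamically to $(\mathcal{F},\mathcal{T}^X)$ via $(\phi^Y_n,\phi^Z_n)$ if the portrait of $\mathcal{F}$ ($F|_Y$ with the local degrees at leaves) is $\mathbf{F}$ and for every $v\in IV^Y$, $w=F(v)$, there are projective isomorphisms $\phi^Y_{n,v}:\hat{\mathbb{C}}\to\mathbb{S}_v$, $\phi^Z_{n,w}:\hat{\mathbb{C}}\to\mathbb{S}_w$ with $\phi^Y_{n,v}\circ y_n\to a^Y_v$,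 $\phi^Z_{n,w}\circ z_n\to a^Z_w$, $\phi^Z_{n,w}\circ f_n\circ(\phi^Y_{n,v})^{-1}\to f_v$ locally uniformly on $\mathbb{S}_v\setminus Y_v$, and $\phi^Y_{n,v}=\phi^Z_{n,v}$ for $v\in IV^X$. Rescalings. A rescaling of $(f_n)$ is a sequence of Möbius transformations $(M_n)$ such that for some $k\in\mathbb{N}$ and some rational map $g$ of degree $\ge2$, $M_n\circ f_n^k\circ M_n^{-1}\to g$ uniformly on compact subsets of $\hat{\mathbb{C}}$ minus finitely many points. Two rescalings $(M_n),(N_n)$ are equivalent if $N_n\circ M_n^{-1}$ converges in the space of Möbius transformations. Sequences $\phi_{n,v}:\hat{\mathbb{C}}\to\mathbb{S}_v$ are regarded as Möbius transformations via a fixed projective chart of $\mathbb{S}_v$. *)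

theory Defs
  imports "HOL-Analysis.Analysis" "HOL-Computational_Algebra.Polynomial_Factorial"
begin

text \<open>The Riemann sphere is modelled as complex option (None is the point at infinity).
  Its topology is transported from the unit sphere in complex x real (= R^3) via the
  inverse stereographic projection.\<close>

type_synonym cs = "complex option"

fun stereo :: "cs \<Rightarrow> complex \<times> real" where
  "stereo (Some z) = (2 * z / complex_of_real (1 + (cmod z)\<^sup>2),
                      ((cmod z)\<^sup>2 - 1) / ((cmod z)\<^sup>2 + 1))"
| "stereo None = (0, 1)"

definition cs_dist :: "cs \<Rightarrow> cs \<Rightarrow> real" where
  "cs_dist z w = dist (stereo z) (stereo w)"

definition cs_tendsto :: "(nat \<Rightarrow> cs) \<Rightarrow> cs \<Rightarrow> bool" where
  "cs_tendsto s l \<longleftrightarrow> (\<lambda>n. stereo (s n)) \<longlonglongrightarrow> stereo l"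

definition locunif_conv :: "(nat \<Rightarrow> cs \<Rightarrow> cs) \<Rightarrow> (cs \<Rightarrow> cs) \<Rightarrow> cs set \<Rightarrow> bool" where
  "locunif_conv g l S \<longleftrightarrow>
     (\<forall>K. compact K \<and> K \<subseteq> stereo ` (UNIV - S) \<longrightarrow>
        (\<forall>\<epsilon>>0. eventually (\<lambda>n. \<forall>z. stereo z \<in> K \<longrightarrow> cs_dist (g n z) (l z) < \<epsilon>) sequentially))"

fun rat_fun :: "complex poly \<Rightarrow> complex poly \<Rightarrow> cs \<Rightarrow> cs" where
  "rat_fun P Q (Some a) = (if poly Q a = 0 then None else Some (poly P a / poly Q a))"
| "rat_fun P Q None =
     (if Q = 0 \<or> degree P > degree Q then None
      else if degree P = degree Q then Some (lead_coeff P / lead_coeff Q) else Some 0)"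

definition rat_map :: "nat \<Rightarrow> (cs \<Rightarrow> cs) \<Rightarrow> bool" where
  "rat_map d g \<longleftrightarrow> (\<exists>P Q. coprime P Q \<and> max (degree P) (degree Q) = d \<and> g = rat_fun P Q)"

text \<open>Local degree at a point, for a reduced representation P/Q (at infinity use the
  chart t = 1/z, in which the map reads P'/Q' with P'(t) = t^d P(1/t)).\<close>
definition pq_ldeg :: "complex poly \<Rightarrow> complex poly \<Rightarrow> cs \<Rightarrow> nat" where
  "pq_ldeg P Q z =
    (let d = max (degree P) (degree Q) in
     case z of
       Some a \<Rightarrow> (case rat_fun P Q (Some a) of
                    Some w \<Rightarrow> order a (P - smult w Q)
                  | None \<Rightarrow> order a Q)
     | None \<Rightarrow>
        (let P' = monom 1 (d - degree P) * reflect_poly P;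
             Q' = monom 1 (d - degree Q) * reflect_poly Q in
         case rat_fun P Q None of
           Some w \<Rightarrow> order 0 (P' - smult w Q')
         | None \<Rightarrow> order 0 Q'))"

definition ldeg :: "(cs \<Rightarrow> cs) \<Rightarrow> cs \<Rightarrow> nat" where
  "ldeg g z = (case SOME PQ. coprime (fst PQ) (snd PQ) \<and> g = rat_fun (fst PQ) (snd PQ) of
                 (P, Q) \<Rightarrow> pq_ldeg P Q z)"

definition mobius :: "(cs \<Rightarrow> cs) \<Rightarrow> bool" where
  "mobius \<phi> \<longleftrightarrow> (\<exists>a b c d. a * d - b * c \<noteq> 0 \<and> \<phi> = rat_fun [:b, a:] [:d, c:])"

text \<open>Convergence of a sequence in the space PGL(2,C) of Moebius transformations:
  some matrix lifts converge to an invertible matrix.\<close>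
definition mob_converges :: "(nat \<Rightarrow> cs \<Rightarrow> cs) \<Rightarrow> bool" where
  "mob_converges \<phi> \<longleftrightarrow>
     (\<exists>a b c d :: nat \<Rightarrow> complex. \<exists>a0 b0 c0 d0.
        (\<forall>n. a n * d n - b n * c n \<noteq> 0 \<and> \<phi> n = rat_fun [:b n, a n:] [:d n, c n:]) \<and>
        a \<longlonglongrightarrow> a0 \<and> b \<longlonglongrightarrow> b0 \<and> c \<longlonglongrightarrow> c0 \<and> d \<longlonglongrightarrow> d0 \<and>
        a0 * d0 - b0 * c0 \<noteq> 0)"

definition rescaling :: "(nat \<Rightarrow> cs \<Rightarrow> cs) \<Rightarrow> (nat \<Rightarrow> cs \<Rightarrow> cs) \<Rightarrow> bool" where
  "rescaling f M \<longleftrightarrow> (\<forall>n. mobius (M n)) \<and>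
     (\<exists>k g S e. e \<ge> 2 \<and> rat_map e g \<and> finite S \<and>
        locunif_conv (\<lambda>n. M n \<circ> (f n ^^ k) \<circ> inv (M n)) g S)"

definition resc_equiv :: "(nat \<Rightarrow> cs \<Rightarrow> cs) \<Rightarrow> (nat \<Rightarrow> cs \<Rightarrow> cs) \<Rightarrow> bool" where
  "resc_equiv M N \<longleftrightarrow> mob_converges (\<lambda>n. N n \<circ> inv (M n))"

definition adj :: "nat set set \<Rightarrow> nat \<Rightarrow> nat \<Rightarrow> bool" where
  "adj E u w \<longleftrightarrow> {u, w} \<in> E"

definition edges_at :: "nat set set \<Rightarrow> nat \<Rightarrow> nat set set" where
  "edges_at E v = {e \<in> E. v \<in> e}"

definition valence :: "nat set set \<Rightarrow> nat \<Rightarrow> nat" where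
  "valence E v = card (edges_at E v)"

definition is_cycle :: "nat set set \<Rightarrow> nat list \<Rightarrow> bool" where
  "is_cycle E vs \<longleftrightarrow> length vs \<ge> 3 \<and> distinct vs \<and>
     (\<forall>i. Suc i < length vs \<longrightarrow> adj E (vs ! i) (vs ! Suc i)) \<and> adj E (last vs) (hd vs)"

definition is_tree :: "nat set \<Rightarrow> nat set set \<Rightarrow> bool" where
  "is_tree V E \<longleftrightarrow> finite V \<and> V \<noteq> {} \<and>
     (\<forall>e\<in>E. \<exists>u w. u \<noteq> w \<and> u \<in> V \<and> w \<in> V \<and> e = {u, w}) \<and>
     (\<forall>u\<in>V. \<forall>w\<in>V. (adj E)\<^sup>*\<^sup>* u w) \<and>
     (\<nexists>vs. is_cycle E vs)"

definition leaves :: "nat set \<Rightarrow> nat set set \<Rightarrow> nat set" where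
  "leaves V E = {v \<in> V. valence E v = 1}"

definition internal :: "nat set \<Rightarrow> nat set set \<Rightarrow> nat set" where
  "internal V E = V - leaves V E"

definition conn_avoid :: "nat set set \<Rightarrow> nat \<Rightarrow> nat \<Rightarrow> nat \<Rightarrow> bool" where
  "conn_avoid E v u w \<longleftrightarrow> (\<lambda>a b. adj E a b \<and> a \<noteq> v \<and> b \<noteq> v)\<^sup>*\<^sup>* u w"

definition branch :: "nat set \<Rightarrow> nat set set \<Rightarrow> nat \<Rightarrow> nat set \<Rightarrow> nat set" where
  "branch V E v e = {u \<in> V. u \<noteq> v \<and> (\<exists>w\<in>e. w \<noteq> v \<and> conn_avoid E v w u)}"

definition separates :: "nat set \<Rightarrow> nat set set \<Rightarrow> nat \<Rightarrow> nat \<Rightarrow> nat \<Rightarrow> nat \<Rightarrow> bool" where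
  "separates V E v v1 v2 v3 \<longleftrightarrow> v1 \<in> V - {v} \<and> v2 \<in> V - {v} \<and> v3 \<in> V - {v} \<and>
     \<not> conn_avoid E v v1 v2 \<and> \<not> conn_avoid E v v1 v3 \<and> \<not> conn_avoid E v v2 v3"

definition marked_stable_tree :: "nat set \<Rightarrow> nat set \<Rightarrow> nat set set \<Rightarrow> bool" where
  "marked_stable_tree X V E \<longleftrightarrow> is_tree V E \<and> finite X \<and> card X \<ge> 3 \<and> leaves V E = X \<and>
     (\<forall>v\<in>internal V E. valence E v \<ge> 3)"

text \<open>Every internal sphere S_v is identified with the Riemann sphere through a fixed
  projective chart; tI T v e is the attaching point i_v(e).\<close>
record tos =
  tV :: "nat set"
  tE :: "nat set set"
  tI :: "nat \<Rightarrow> nat set \<Rightarrow> cs"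

abbreviation IV :: "tos \<Rightarrow> nat set" where
  "IV T \<equiv> internal (tV T) (tE T)"

definition tree_of_spheres :: "nat set \<Rightarrow> tos \<Rightarrow> bool" where
  "tree_of_spheres X T \<longleftrightarrow> marked_stable_tree X (tV T) (tE T) \<and>
     (\<forall>v\<in>IV T. inj_on (tI T v) (edges_at (tE T) v))"

definition attach :: "tos \<Rightarrow> nat \<Rightarrow> cs set" where
  "attach T v = tI T v ` edges_at (tE T) v"

definition amark :: "tos \<Rightarrow> nat \<Rightarrow> nat \<Rightarrow> cs" where
  "amark T v x = tI T v (THE e. e \<in> edges_at (tE T) v \<and> x \<in> branch (tV T) (tE T) v e)"

definition cover :: "nat set \<Rightarrow> tos \<Rightarrow> nat set \<Rightarrow> tos \<Rightarrow> (nat \<Rightarrow> nat) \<Rightarrow> (nat \<Rightarrow> cs \<Rightarrow> cs) \<Rightarrow> bool" where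
  "cover Y TY Z TZ F fv \<longleftrightarrow>
     tree_of_spheres Y TY \<and> tree_of_spheres Z TZ \<and>
     F ` tV TY \<subseteq> tV TZ \<and>
     (\<forall>v w. {v, w} \<in> tE TY \<longrightarrow> {F v, F w} \<in> tE TZ) \<and>
     F ` Y \<subseteq> Z \<and> F ` IV TY \<subseteq> IV TZ \<and>
     (\<forall>v\<in>IV TY. (\<exists>e\<ge>1. rat_map e (fv v)) \<and>
        covering_space (stereo ` (UNIV - attach TY v)) (stereo \<circ> fv v \<circ> inv stereo)
                       (stereo ` (UNIV - attach TZ (F v))) \<and>
        (\<forall>e\<in>edges_at (tE TY) v. fv v (tI TY v e) = tI TZ (F v) (F ` e))) \<and>
     (\<forall>v\<in>IV TY. \<forall>w\<in>IV TY. {v, w} \<in> tE TY \<longrightarrow>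
        ldeg (fv v) (tI TY v {v, w}) = ldeg (fv w) (tI TY w {v, w}))"

definition leaf_deg :: "tos \<Rightarrow> (nat \<Rightarrow> cs \<Rightarrow> cs) \<Rightarrow> nat \<Rightarrow> nat" where
  "leaf_deg T fv a = (let u = (THE u. {a, u} \<in> tE T) in ldeg (fv u) (tI T u {a, u}))"

definition compatible :: "nat set \<Rightarrow> tos \<Rightarrow> nat set \<Rightarrow> tos \<Rightarrow> bool" where
  "compatible X TX Y TY \<longleftrightarrow> X \<subseteq> Y \<and> IV TX \<subseteq> IV TY \<and>
     (\<forall>v\<in>tV TX. \<forall>v1\<in>tV TX. \<forall>v2\<in>tV TX. \<forall>v3\<in>tV TX.
        separates (tV TX) (tE TX) v v1 v2 v3 \<longleftrightarrow> separates (tV TY) (tE TY) v v1 v2 v3)"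

definition sub_tos :: "nat set \<Rightarrow> tos \<Rightarrow> nat set \<Rightarrow> tos \<Rightarrow> bool" where
  "sub_tos X TX Y TY \<longleftrightarrow> compatible X TX Y TY \<and>
     (\<forall>v\<in>IV TX. \<forall>x\<in>X. amark TX v x = amark TY v x)"

definition dyn_system :: "nat set \<Rightarrow> tos \<Rightarrow> nat set \<Rightarrow> tos \<Rightarrow> nat set \<Rightarrow> tos \<Rightarrow>
     (nat \<Rightarrow> nat) \<Rightarrow> (nat \<Rightarrow> cs \<Rightarrow> cs) \<Rightarrow> bool" where
  "dyn_system X TX Y TY Z TZ F fv \<longleftrightarrow>
     cover Y TY Z TZ F fv \<and> tree_of_spheres X TX \<and> X \<subseteq> Y \<inter> Z \<and>
     sub_tos X TX Y TY \<and> sub_tos X TX Z TZ"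

definition portrait :: "nat \<Rightarrow> nat set \<Rightarrow> nat set \<Rightarrow> (nat \<Rightarrow> nat) \<Rightarrow> (nat \<Rightarrow> nat) \<Rightarrow> bool" where
  "portrait d Y Z F deg \<longleftrightarrow> finite Y \<and> finite Z \<and> F ` Y \<subseteq> Z \<and> (\<forall>a\<in>Y. deg a \<ge> 1) \<and>
     (\<Sum>a\<in>Y. deg a - 1) = 2 * d - 2 \<and>
     (\<forall>b\<in>Z. (\<Sum>a\<in>{a\<in>Y. F a = b}. deg a) = d)"

definition dyn_marked :: "nat \<Rightarrow> nat set \<Rightarrow> nat set \<Rightarrow> (nat \<Rightarrow> nat) \<Rightarrow> (nat \<Rightarrow> nat) \<Rightarrow> nat set \<Rightarrow>
     (cs \<Rightarrow> cs) \<Rightarrow> (nat \<Rightarrow> cs) \<Rightarrow> (nat \<Rightarrow> cs) \<Rightarrow> bool" where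
  "dyn_marked d Y Z F deg X f y z \<longleftrightarrow> rat_map d f \<and> inj_on y Y \<and> inj_on z Z \<and>
     (\<forall>a\<in>Y. f (y a) = z (F a) \<and> ldeg f (y a) = deg a) \<and> (\<forall>x\<in>X. y x = z x)"

definition dyn_converges :: "(nat \<Rightarrow> cs \<Rightarrow> cs) \<Rightarrow> (nat \<Rightarrow> nat \<Rightarrow> cs) \<Rightarrow> (nat \<Rightarrow> nat \<Rightarrow> cs) \<Rightarrow>
     (nat \<Rightarrow> nat) \<Rightarrow> (nat \<Rightarrow> nat) \<Rightarrow>
     nat set \<Rightarrow> tos \<Rightarrow> nat set \<Rightarrow> tos \<Rightarrow> nat set \<Rightarrow> tos \<Rightarrow> (nat \<Rightarrow> nat) \<Rightarrow> (nat \<Rightarrow> cs \<Rightarrow> cs) \<Rightarrow>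
     (nat \<Rightarrow> nat \<Rightarrow> cs \<Rightarrow> cs) \<Rightarrow> (nat \<Rightarrow> nat \<Rightarrow> cs \<Rightarrow> cs) \<Rightarrow> bool" where
  "dyn_converges f y z Fp deg X TX Y TY Z TZ F fv \<phi>Y \<phi>Z \<longleftrightarrow>
     (\<forall>a\<in>Y. F a = Fp a \<and> leaf_deg TY fv a = deg a) \<and>
     (\<forall>v\<in>IV TY.
        (\<forall>n. mobius (\<phi>Y n v) \<and> mobius (\<phi>Z n (F v))) \<and>
        (\<forall>a\<in>Y. cs_tendsto (\<lambda>n. \<phi>Y n v (y n a)) (amark TY v a)) \<and>
        (\<forall>b\<in>Z. cs_tendsto (\<lambda>n. \<phi>Z n (F v) (z n b)) (amark TZ (F v) b)) \<and>
        locunif_conv (\<lambda>n. \<phi>Z n (F v) \<circ> f n \<circ> inv (\<phi>Y n v)) (fv v) (attach TY v)) \<and>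
     (\<forall>v\<in>IV TX. \<forall>n. \<phi>Y n v = \<phi>Z n v)"

end

theory Submission
  imports Defs "HOL-Computational_Algebra.Fundamental_Theorem_Algebra"
    "HOL-Computational_Algebra.Field_as_Ring"
begin

text \<open>
  Mark \<open>0, 1, \<infinity>\<close>, the critical points and the points \<open>M\<^sub>i\<^sup>-\<^sup>1(0), M\<^sub>i\<^sup>-\<^sup>1(1), M\<^sub>i\<^sup>-\<^sup>1(-1)\<close>, and pass to the
  full preimage of their images and of \<open>0, 1, \<infinity>\<close>; the tree \<open>T\<^sup>X\<close> is the tripod on \<open>0, 1, \<infinity>\<close>. Along a subsequence the marked
  points converge in the chart normalised by any three of them, and two such charts either differ by a convergent
  Moebius map or collapse all directions but one onto a single direction. The classes of charts are the internal vertices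
  of a stable tree whose edges are the pairs of complementary blocks.

  In the chart of a vertex \<open>v\<close> the maps, suitably postcomposed, converge to a pair of linearly independent
  forms, that is, to a nonconstant map \<open>g\<^sub>v\<close> times a common factor (the holes). Factoring the equations
  \<open>f = z(b)\<close> and the Wronskian over the marked points and passing to the limit counts, in each
  direction at \<open>v\<close>, the preimages of every marked value and the critical points in terms of the local degree
  of \<open>g\<^sub>v\<close> and the order of the hole. Comparing the counts from both ends of an edge shows that the
  image directions are complementary and the local degrees agree, so edges go to edges; a descent along the tree
  together with Riemann-Hurwitz shows that the target chart of \<open>g\<^sub>v\<close> separates three marked values, so
  it belongs to a vertex of the target tree.
\<close>

section \<open>The Riemann sphere in homogeneous coordinates\<close>

text \<open>The obstacle is loss of degree: maps of degree d, read in moving charts, may converge to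
  a pair of forms with a common factor, and what disappears there must be located. Full preimages
  are marked to make the portrait exact: over each marked value the local degrees add up to d, and
  the marked critical points account for all of 2d - 2. Hence the fibre equations and the Wronskian
  are constant multiples of products over marked points, every root stays under control in the
  limit, and everything is counted by orders of polynomials. The source charts come from marked
  triples, but a target chart comes from normalising coefficients and is not known beforehand to see
  three marked values; the count has to prove it. The points 0, 1, \<infinity> are marked alike on
  both sides, so the chart normalised by them is literally the same for source and target, as the
  dynamical condition demands. Three points are marked per class because a Moebius map is determined
  by three values: the chart of the vertex separating them differs from the rescaling by a
  convergent map. One constant Moebius map, applied after all charts, keeps every limit of a marked
  point finite.\<close>

definition proj :: "complex \<Rightarrow> complex \<Rightarrow> cs" where
  "proj s t = (if t = 0 then None else Some (s / t))"

abbreviation sqn :: "complex \<Rightarrow> complex \<Rightarrow> real" where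
  "sqn s t \<equiv> (cmod s)\<^sup>2 + (cmod t)\<^sup>2"

lemma sqn_nonzero: "s \<noteq> 0 \<or> t \<noteq> 0 \<Longrightarrow> sqn s t \<noteq> 0"
  by (simp add: sum_power2_eq_zero_iff)

lemma sqn_pos: "s \<noteq> 0 \<or> t \<noteq> 0 \<Longrightarrow> sqn s t > 0"
  using sqn_nonzero[of s t] by (simp add: order_less_le)

text \<open>In homogeneous coordinates the pole is no exception, so one formula serves finite points
  and infinity in all metric computations.\<close>

lemma stereo_proj:
  assumes "s \<noteq> 0 \<or> t \<noteq> 0"
  shows "stereo (proj s t) = (2 * s * cnj t / of_real (sqn s t),
           ((cmod s)\<^sup>2 - (cmod t)\<^sup>2) / sqn s t)"
proof (cases "t = 0")
  case True
  then show ?thesis using assms by (simp add: proj_def)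
next
  case False
  have n: "sqn s t \<noteq> 0" using sqn_nonzero[OF assms] .
  have t2: "(cmod t)\<^sup>2 \<noteq> 0" using False by simp
  have e: "1 + (cmod (s / t))\<^sup>2 = sqn s t / (cmod t)\<^sup>2"
    using False by (simp add: norm_divide power_divide field_simps)
  have "2 * (s / t) / complex_of_real (1 + (cmod (s / t))\<^sup>2)
      = 2 * s * complex_of_real ((cmod t)\<^sup>2) / t / of_real (sqn s t)"
    unfolding e by (simp add: field_simps)
  also have "complex_of_real ((cmod t)\<^sup>2) = t * cnj t" by (rule complex_norm_square)
  also have "2 * s * (t * cnj t) / t = 2 * s * cnj t" using False by simp
  finally have a: "2 * (s / t) / complex_of_real (1 + (cmod (s / t))\<^sup>2)
      = 2 * s * cnj t / of_real (sqn s t)" .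
  have b: "((cmod (s/t))\<^sup>2 - 1) / ((cmod (s/t))\<^sup>2 + 1) = ((cmod s)\<^sup>2 - (cmod t)\<^sup>2) / sqn s t"
  proof -
    have "(cmod (s/t))\<^sup>2 - 1 = ((cmod s)\<^sup>2 - (cmod t)\<^sup>2) / (cmod t)\<^sup>2"
      using False by (simp add: norm_divide power_divide field_simps)
    moreover have "(cmod (s/t))\<^sup>2 + 1 = sqn s t / (cmod t)\<^sup>2" using e by simp
    ultimately show ?thesis using t2 by simp
  qed
  show ?thesis using False a b by (simp add: proj_def)
qed

text \<open>Unit representatives fill a bounded set; this is the source of compactness in
  \<open>cs_lift_subseq\<close>.\<close>

lemma proj_unit: "\<exists>s t. sqn s t = 1 \<and> x = proj s t"
proof (cases x)
  case None
  then show ?thesis by (intro exI[of _ 1] exI[of _ 0]) (simp add: proj_def)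
next
  case (Some z)
  define r where "r = 1 / sqrt (1 + (cmod z)\<^sup>2)"
  have p: "1 + (cmod z)\<^sup>2 > 0" by (simp add: add_pos_nonneg)
  then have r: "r > 0" by (simp add: r_def)
  have "r\<^sup>2 = 1 / (1 + (cmod z)\<^sup>2)" unfolding r_def power_divide using p by simp
  then have r: "r > 0" "r\<^sup>2 * (1 + (cmod z)\<^sup>2) = 1" using r p by simp_all
  show ?thesis using r Some
    by (intro exI[of _ "of_real r * z"] exI[of _ "of_real r"])
      (auto simp: proj_def norm_mult power_mult_distrib algebra_simps)
qed

lemma proj_ex: obtains s t where "s \<noteq> 0 \<or> t \<noteq> 0" "x = proj s t"
  using proj_unit[of x] by (metis add_0 norm_zero zero_neq_one power_zero_numeral)

lemma proj_eq_iff: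
  assumes "s \<noteq> 0 \<or> t \<noteq> 0" "s' \<noteq> 0 \<or> t' \<noteq> 0"
  shows "proj s t = proj s' t' \<longleftrightarrow> s * t' = s' * t"
  using assms by (auto simp: proj_def field_simps)

lemma proj_scale: "k \<noteq> 0 \<Longrightarrow> proj (k * s) (k * t) = proj s t"
  by (simp add: proj_def)

text \<open>Both sides are squared. The cross terms are multiples of the same real part R of
  \<open>s * t' * cnj (s' * t)\<close>, after which an identity in the four squared moduli remains.
  The bilinear numerator is what makes Moebius maps and orders of vanishing visible in the
  metric.\<close>

lemma cs_dist_proj:
  assumes a: "s \<noteq> 0 \<or> t \<noteq> 0" and b: "s' \<noteq> 0 \<or> t' \<noteq> 0"
  shows "cs_dist (proj s t) (proj s' t')
         = 2 * cmod (s * t' - s' * t) / (sqrt (sqn s t) * sqrt (sqn s' t'))"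
proof -
  define N N' where "N = sqn s t" and "N' = sqn s' t'"
  have N: "N > 0" "N' > 0" unfolding N_def N'_def using sqn_pos a b by blast+
  define u u' where "u = 2 * s * cnj t / of_real N" and "u' = 2 * s' * cnj t' / of_real N'"
  define h h' where "h = ((cmod s)\<^sup>2 - (cmod t)\<^sup>2) / N" and "h' = ((cmod s')\<^sup>2 - (cmod t')\<^sup>2) / N'"
  have "(cs_dist (proj s t) (proj s' t'))\<^sup>2 = (cmod (u - u'))\<^sup>2 + (h - h')\<^sup>2"
    unfolding cs_dist_def stereo_proj[OF a] stereo_proj[OF b] u_def u'_def h_def h'_def N_def N'_def
    by (simp add: dist_prod_def dist_norm power2_abs)
  also have "\<dots> = (2 * cmod (s * t' - s' * t))\<^sup>2 / (N * N')"
  proof -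
    have "u - u' = (2 * s * cnj t * of_real N' - 2 * s' * cnj t' * of_real N) / of_real (N * N')"
      unfolding u_def u'_def using N by (simp add: field_simps)
    then have 1: "cmod (u - u') = cmod (2 * s * cnj t * of_real N' - 2 * s' * cnj t' * of_real N) / (N * N')"
      using N by (simp add: norm_divide norm_mult)
    have 2: "h - h' = (((cmod s)\<^sup>2 - (cmod t)\<^sup>2) * N' - ((cmod s')\<^sup>2 - (cmod t')\<^sup>2) * N) / (N * N')"
      unfolding h_def h'_def using N by (simp add: field_simps)
    have cd: "(cmod (x - y))\<^sup>2 = (cmod x)\<^sup>2 + (cmod y)\<^sup>2 - 2 * Re (x * cnj y)" for x y
      unfolding cmod_power2 by (simp add: power2_eq_square algebra_simps)
    define R where "R = Re (s * t' * cnj (s' * t))"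
    have "2 * s * cnj t * of_real N' * cnj (2 * s' * cnj t' * of_real N)
        = of_real (4 * N * N') * (s * t' * cnj (s' * t))" by simp
    then have R1: "Re (2 * s * cnj t * of_real N' * cnj (2 * s' * cnj t' * of_real N)) = 4 * N * N' * R"
      by (simp only: R_def) simp
    have 3: "(cmod (2 * s * cnj t * of_real N' - 2 * s' * cnj t' * of_real N))\<^sup>2
        + (((cmod s)\<^sup>2 - (cmod t)\<^sup>2) * N' - ((cmod s')\<^sup>2 - (cmod t')\<^sup>2) * N)\<^sup>2
        = (2 * cmod (s * t' - s' * t))\<^sup>2 * (N * N')"
      unfolding power_mult_distrib cd R1 R_def[symmetric] norm_mult complex_mod_cnj
      using N by (simp add: power_mult_distrib) (simp add: N_def N'_def power2_eq_square algebra_simps)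
    show ?thesis unfolding 1 2 power_divide
      using N 3 by (simp add: add_divide_distrib[symmetric] power2_eq_square)
  qed
  also have "\<dots> = (2 * cmod (s * t' - s' * t) / (sqrt N * sqrt N'))\<^sup>2"
    using N by (simp add: power_divide power_mult_distrib)
  finally have "cs_dist (proj s t) (proj s' t') = 2 * cmod (s * t' - s' * t) / (sqrt N * sqrt N')"
    by (rule power2_eq_imp_eq) (use N in \<open>auto simp: cs_dist_def\<close>)
  then show ?thesis by (simp add: N_def N'_def)
qed

lemma inj_stereo: "inj stereo"
proof (rule injI)
  fix x y assume e: "stereo x = stereo y"
  obtain s t where x: "s \<noteq> 0 \<or> t \<noteq> 0" "x = proj s t" by (rule proj_ex)
  obtain s' t' where y: "s' \<noteq> 0 \<or> t' \<noteq> 0" "y = proj s' t'" by (rule proj_ex)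
  have "cs_dist x y = 0" using e by (simp add: cs_dist_def)
  then show "x = y" using cs_dist_proj[OF x(1) y(1)] x y sqn_pos[OF x(1)] sqn_pos[OF y(1)]
    by (auto simp: proj_eq_iff)
qed

lemma inv_stereo [simp]: "inv stereo (stereo x) = x"
  using inj_stereo by simp

lemma cs_dist_eq_0 [simp]: "cs_dist x y = 0 \<longleftrightarrow> x = y"
  by (simp add: cs_dist_def inj_eq[OF inj_stereo])

lemma cs_dist_nonneg [simp]: "cs_dist x y \<ge> 0"
  by (simp add: cs_dist_def)

section \<open>Convergence of points and compactness of the sphere\<close>

lemma cs_tendsto_iff_dist: "cs_tendsto x l \<longleftrightarrow> (\<lambda>n. cs_dist (x n) l) \<longlonglongrightarrow> 0"
  unfolding cs_tendsto_def cs_dist_def by (rule tendsto_dist_iff)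

lemma cs_tendsto_const [simp]: "cs_tendsto (\<lambda>n. x) x"
  by (simp add: cs_tendsto_def)

lemma cs_tendsto_unique: "cs_tendsto x l \<Longrightarrow> cs_tendsto x m \<Longrightarrow> l = m"
  unfolding cs_tendsto_def by (drule (1) LIMSEQ_unique) (rule injD[OF inj_stereo])

lemma cs_tendsto_subseq:
  assumes "cs_tendsto x l" "strict_mono r"
  shows "cs_tendsto (\<lambda>n. x (r n)) l"
  using LIMSEQ_subseq_LIMSEQ[of "\<lambda>n. stereo (x n)"] assms by (simp add: cs_tendsto_def o_def)

lemma cs_tendsto_proj:
  assumes "s \<longlonglongrightarrow> s0" "t \<longlonglongrightarrow> t0" "s0 \<noteq> 0 \<or> t0 \<noteq> 0"
  shows "cs_tendsto (\<lambda>n. proj (s n) (t n)) (proj s0 t0)"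
proof -
  have "sqn s0 t0 \<noteq> 0" using sqn_nonzero[OF assms(3)] .
  then have lim: "(\<lambda>n. (2 * s n * cnj (t n) / of_real (sqn (s n) (t n)),
        ((cmod (s n))\<^sup>2 - (cmod (t n))\<^sup>2) / sqn (s n) (t n)))
     \<longlonglongrightarrow> (2 * s0 * cnj t0 / of_real (sqn s0 t0), ((cmod s0)\<^sup>2 - (cmod t0)\<^sup>2) / sqn s0 t0)"
    by (intro tendsto_intros assms(1,2)) (simp_all del: of_real_add)
  have "eventually (\<lambda>n. s n \<noteq> 0 \<or> t n \<noteq> 0) sequentially"
    using assms(3)
  proof
    assume "s0 \<noteq> 0"
    from tendsto_imp_eventually_ne[OF assms(1) this] show ?thesis by eventually_elim auto
  next
    assume "t0 \<noteq> 0"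
    from tendsto_imp_eventually_ne[OF assms(2) this] show ?thesis by eventually_elim auto
  qed
  then have "eventually (\<lambda>n. (2 * s n * cnj (t n) / of_real (sqn (s n) (t n)),
        ((cmod (s n))\<^sup>2 - (cmod (t n))\<^sup>2) / sqn (s n) (t n)) = stereo (proj (s n) (t n))) sequentially"
    by eventually_elim (use stereo_proj in auto)
  from Lim_transform_eventually[OF lim this] show ?thesis
    unfolding cs_tendsto_def by (simp only: stereo_proj[OF assms(3)])
qed

text \<open>Convergent lifts are supplied, and not only convergent points, because forms are
  evaluated at lifts. Lifts of length one have a limit of length one, hence nonzero.\<close>

lemma cs_lift_subseq:
  fixes x :: "nat \<Rightarrow> cs"
  shows "\<exists>r s t s0 t0. strict_mono r \<and> (\<forall>n. (s n \<noteq> 0 \<or> t n \<noteq> 0) \<and> x (r n) = proj (s n) (t n)) \<and>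
    s \<longlonglongrightarrow> s0 \<and> t \<longlonglongrightarrow> t0 \<and> (s0 \<noteq> 0 \<or> t0 \<noteq> 0)"
proof -
  have "\<forall>n. \<exists>s t. sqn s t = 1 \<and> x n = proj s t" using proj_unit by blast
  then obtain s t where st: "\<And>n. sqn (s n) (t n) = 1" "\<And>n. x n = proj (s n) (t n)" by metis
  have b: "norm (s n) \<le> 1" "norm (t n) \<le> 1" for n
  proof -
    have "(norm (s n))\<^sup>2 \<le> 1" "(norm (t n))\<^sup>2 \<le> 1"
      using st(1)[of n] zero_le_power2[of "norm (s n)"] zero_le_power2[of "norm (t n)"] by linarith+
    then show "norm (s n) \<le> 1" "norm (t n) \<le> 1"
      by (simp_all add: power_le_one_iff abs_square_le_1)
  qed
  have "bounded (range (\<lambda>n. (s n, t n)))"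
  proof (rule boundedI[where B = 2])
    fix v assume "v \<in> range (\<lambda>n. (s n, t n))"
    then obtain n where v: "v = (s n, t n)" by auto
    show "norm v \<le> 2" unfolding v using b[of n] norm_Pair_le[of "s n" "t n"] by linarith
  qed
  then obtain l r where r: "strict_mono r" "((\<lambda>n. (s n, t n)) \<circ> r) \<longlonglongrightarrow> l"
    using bounded_imp_convergent_subsequence by blast
  have l: "(\<lambda>n. s (r n)) \<longlonglongrightarrow> fst l" "(\<lambda>n. t (r n)) \<longlonglongrightarrow> snd l"
    using tendsto_fst[OF r(2)] tendsto_snd[OF r(2)] by (simp_all add: o_def)
  have "(\<lambda>n. sqn (s (r n)) (t (r n))) \<longlonglongrightarrow> sqn (fst l) (snd l)"
    by (intro tendsto_intros l)
  then have "(\<lambda>n. 1) \<longlonglongrightarrow> sqn (fst l) (snd l)" by (simp only: st(1))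
  then have "sqn (fst l) (snd l) = 1" using LIMSEQ_unique tendsto_const by blast
  then have "fst l \<noteq> 0 \<or> snd l \<noteq> 0" by force
  moreover have "s n \<noteq> 0 \<or> t n \<noteq> 0" for n using st(1)[of n] by auto
  ultimately show ?thesis using r(1) l st(2)
    by (intro exI[of _ r] exI[of _ "\<lambda>n. s (r n)"] exI[of _ "\<lambda>n. t (r n)"] exI[of _ "fst l"] exI[of _ "snd l"]) auto
qed

lemma cs_convergent_subseq:
  fixes x :: "nat \<Rightarrow> cs"
  shows "\<exists>l r. strict_mono r \<and> cs_tendsto (\<lambda>n. x (r n)) l"
proof -
  obtain r s t s0 t0 where r: "strict_mono r" "\<And>n. x (r n) = proj (s n) (t n)"
    "s \<longlonglongrightarrow> s0" "t \<longlonglongrightarrow> t0" "s0 \<noteq> 0 \<or> t0 \<noteq> 0"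
    using cs_lift_subseq[of x] by blast
  have "cs_tendsto (\<lambda>n. x (r n)) (proj s0 t0)" unfolding r(2) by (rule cs_tendsto_proj[OF r(3-5)])
  then show ?thesis using r(1) by blast
qed

lemma snd_stereo_Some: "snd (stereo (Some w)) = 1 - 2 / (1 + (cmod w)\<^sup>2)"
proof -
  have p: "1 + (cmod w)\<^sup>2 > 0" by (simp add: add_pos_nonneg)
  have "1 - 2 / (1 + (cmod w)\<^sup>2) = ((1 + (cmod w)\<^sup>2) - 2) / (1 + (cmod w)\<^sup>2)"
    using p by (subst diff_divide_distrib) simp
  then show ?thesis by (simp add: add.commute)
qed

lemma snd_stereo_Some_ne_1: "snd (stereo (Some w)) \<noteq> 1"
proof -
  have p: "1 + (cmod w)\<^sup>2 > 0" by (simp add: add_pos_nonneg)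
  then have "2 / (1 + (cmod w)\<^sup>2) > 0" by simp
  then show ?thesis unfolding snd_stereo_Some by linarith
qed

lemma cs_tendsto_Some_iff: "cs_tendsto (\<lambda>n. Some (z n)) (Some l) \<longleftrightarrow> z \<longlonglongrightarrow> l"
proof
  assume "z \<longlonglongrightarrow> l"
  from cs_tendsto_proj[OF this tendsto_const[of 1]]
  show "cs_tendsto (\<lambda>n. Some (z n)) (Some l)" by (simp add: proj_def)
next
  assume "cs_tendsto (\<lambda>n. Some (z n)) (Some l)"
  then have c: "(\<lambda>n. stereo (Some (z n))) \<longlonglongrightarrow> stereo (Some l)" by (simp add: cs_tendsto_def)
  \<comment> \<open>The inverse of stereographic projection: the horizontal coordinate divided by
    one minus the height, which is continuous off the pole.\<close>
  have inv: "fst (stereo (Some w)) / of_real (1 - snd (stereo (Some w))) = w" for w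
  proof -
    have p: "1 + (cmod w)\<^sup>2 > 0" by (simp add: add_pos_nonneg)
    have "1 - snd (stereo (Some w)) = 2 / (1 + (cmod w)\<^sup>2)" unfolding snd_stereo_Some by simp
    moreover have "complex_of_real (1 + (cmod w)\<^sup>2) \<noteq> 0"
      using p by (simp del: of_real_add)
    ultimately show ?thesis by (simp del: of_real_add)
  qed
  have "snd (stereo (Some l)) \<noteq> 1" by (rule snd_stereo_Some_ne_1)
  then have "(\<lambda>n. fst (stereo (Some (z n))) / of_real (1 - snd (stereo (Some (z n)))))
      \<longlonglongrightarrow> fst (stereo (Some l)) / of_real (1 - snd (stereo (Some l)))"
    by (intro tendsto_intros c) (simp del: stereo.simps)
  then show "z \<longlonglongrightarrow> l" by (simp only: inv)
qed

lemma cs_tendsto_eventually_finite: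
  assumes "cs_tendsto x (Some l)"
  shows "eventually (\<lambda>n. x n \<noteq> None) sequentially"
proof -
  have "snd (stereo (Some l)) \<noteq> 1" by (rule snd_stereo_Some_ne_1)
  moreover have "(\<lambda>n. snd (stereo (x n))) \<longlonglongrightarrow> snd (stereo (Some l))"
    using assms by (intro tendsto_intros) (simp add: cs_tendsto_def)
  ultimately have "eventually (\<lambda>n. snd (stereo (x n)) \<noteq> 1) sequentially"
    using tendsto_imp_eventually_ne by blast
  then show ?thesis by (rule eventually_mono) (metis stereo.simps(2) snd_conv)
qed

section \<open>Rational maps as pairs of binary forms\<close>

text \<open>A polynomial of degree at most \<open>N\<close> stands for a binary form of degree \<open>N\<close>, so that the point at
  infinity \<open>(1, 0)\<close> is treated like any other point.\<close>
definition hom :: "nat \<Rightarrow> complex poly \<Rightarrow> complex \<Rightarrow> complex \<Rightarrow> complex" where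
  "hom N P s t = (\<Sum>i\<le>N. coeff P i * s ^ i * t ^ (N - i))"

lemma hom_0_right: "hom N P s 0 = coeff P N * s ^ N"
proof -
  have "hom N P s 0 = (\<Sum>i\<le>N. if i = N then coeff P N * s ^ N else 0)"
    unfolding hom_def by (rule sum.cong) (auto simp: power_0_left)
  then show ?thesis by simp
qed

lemma poly_eq_sum_le:
  fixes P :: "complex poly"
  assumes "degree P \<le> N" shows "poly P x = (\<Sum>i\<le>N. coeff P i * x ^ i)"
  unfolding poly_altdef
  by (rule sum.mono_neutral_left) (use assms in \<open>auto simp: coeff_eq_0\<close>)

lemma hom_eq_poly:
  assumes "degree P \<le> N" "t \<noteq> 0"
  shows "hom N P s t = t ^ N * poly P (s / t)"
  unfolding poly_eq_sum_le[OF assms(1)] hom_def sum_distrib_left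
proof (rule sum.cong)
  fix i assume "i \<in> {..N}"
  then have "t ^ N = t ^ i * t ^ (N - i)" by (simp flip: power_add)
  then show "coeff P i * s ^ i * t ^ (N - i) = t ^ N * (coeff P i * (s / t) ^ i)"
    using assms(2) by (simp add: power_divide)
qed simp

lemma hom_add: "hom N (P + Q) s t = hom N P s t + hom N Q s t"
  by (simp add: hom_def sum.distrib algebra_simps)

lemma hom_smult: "hom N (smult c P) s t = c * hom N P s t"
  by (simp add: hom_def sum_distrib_left mult.assoc)

lemma hom_diff: "hom N (P - Q) s t = hom N P s t - hom N Q s t"
  by (simp add: hom_def sum_subtractf algebra_simps)

lemma hom_zero [simp]: "hom N 0 s t = 0"
  by (simp add: hom_def)

lemma hom_sum: "hom N (\<Sum>i\<in>A. f i) s t = (\<Sum>i\<in>A. hom N (f i) s t)"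
  by (induction A rule: infinite_finite_induct) (auto simp: hom_add)

text \<open>The coefficient at the formal degree is the value of the form at infinity. It is
  multiplicative even where the actual degrees are smaller, which settles the case
  \<open>t = 0\<close> of \<open>hom_mult\<close>.\<close>

lemma coeff_mult_le_degree:
  assumes "degree P \<le> m" "degree Q \<le> n"
  shows "coeff (P * Q :: complex poly) (m + n) = coeff P m * coeff Q n"
proof (cases "degree P = m \<and> degree Q = n")
  case True
  then show ?thesis using coeff_mult_degree_sum[of P Q] by auto
next
  case False
  then have "degree P < m \<or> degree Q < n" using assms by linarith
  then have z: "coeff P m * coeff Q n = 0" by (auto simp: coeff_eq_0)
  have "degree (P * Q) < m + n"
    using False assms degree_mult_le[of P Q] by linarith
  then show ?thesis using z by (simp add: coeff_eq_0)
qed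

lemma hom_mult:
  assumes "degree P \<le> m" "degree Q \<le> n"
  shows "hom (m + n) (P * Q) s t = hom m P s t * hom n Q s t"
proof (cases "t = 0")
  case True
  then show ?thesis using coeff_mult_le_degree[OF assms]
    by (simp add: hom_0_right power_add)
next
  case False
  have "degree (P * Q) \<le> m + n" using degree_mult_le[of P Q] assms by linarith
  then show ?thesis using False assms by (simp add: hom_eq_poly power_add)
qed

lemma degree_power_le': "degree (P :: complex poly) \<le> 1 \<Longrightarrow> degree (P ^ k) \<le> k"
  using degree_power_le[of P k] mult_le_mono1[of "degree P" 1 k] by linarith

lemma hom_power:
  assumes "degree P \<le> 1" shows "hom k (P ^ k) s t = hom 1 P s t ^ k"
proof (induction k)
  case 0
  then show ?case by (simp add: hom_def)
next
  case (Suc k)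
  have "hom (1 + k) (P * P ^ k) s t = hom 1 P s t * hom k (P ^ k) s t"
    by (rule hom_mult[OF assms degree_power_le'[OF assms]])
  then show ?case using Suc by simp
qed

lemma hom_linear: "hom 1 [:b, a:] s t = a * s + b * t"
  by (simp add: hom_def)

lemma tendsto_hom:
  assumes "\<And>i. i \<le> N \<Longrightarrow> (\<lambda>n. coeff (P n) i) \<longlonglongrightarrow> coeff P0 i" "s \<longlonglongrightarrow> s0" "t \<longlonglongrightarrow> t0"
  shows "(\<lambda>n. hom N (P n) (s n) (t n)) \<longlonglongrightarrow> hom N P0 s0 t0"
  unfolding hom_def by (intro tendsto_intros assms) auto

text \<open>No common zero on the projective line, infinity included. This single condition replaces
  coprimality together with the larger degree being exactly N, and it is visibly stable under linear
  changes of coordinates on either side.\<close>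

definition reduced :: "nat \<Rightarrow> complex poly \<Rightarrow> complex poly \<Rightarrow> bool" where
  "reduced N P Q \<longleftrightarrow> degree P \<le> N \<and> degree Q \<le> N \<and>
     (\<forall>s t. s \<noteq> 0 \<or> t \<noteq> 0 \<longrightarrow> hom N P s t \<noteq> 0 \<or> hom N Q s t \<noteq> 0)"

lemma reducedD:
  assumes "reduced N P Q"
  shows "degree P \<le> N" "degree Q \<le> N" "s \<noteq> 0 \<or> t \<noteq> 0 \<Longrightarrow> hom N P s t \<noteq> 0 \<or> hom N Q s t \<noteq> 0"
  using assms by (auto simp: reduced_def)

lemma reduced_roots: 
  assumes "reduced N P Q" shows "poly P a \<noteq> 0 \<or> poly Q a \<noteq> 0"
  using reducedD(3)[OF assms, of a 1] hom_eq_poly[OF reducedD(1)[OF assms], of 1 a]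
    hom_eq_poly[OF reducedD(2)[OF assms], of 1 a] by auto

lemma reduced_coeffs: 
  assumes "reduced N P Q" shows "coeff P N \<noteq> 0 \<or> coeff Q N \<noteq> 0"
  using reducedD(3)[OF assms, of 1 0] by (auto simp: hom_0_right)

text \<open>A common zero at a finite point is a common root, hence a common linear factor; a common
  zero at infinity means that both coefficients at N vanish.\<close>

lemma reduced_iff: "reduced N P Q \<longleftrightarrow> coprime P Q \<and> max (degree P) (degree Q) = N"
proof
  assume r: "reduced N P Q"
  have "coprime P Q"
  proof (rule coprimeI)
    fix c assume c: "c dvd P" "c dvd Q"
    show "is_unit c"
    proof (rule ccontr)
      assume nu: "\<not> is_unit c"
      have "c \<noteq> 0" using c reduced_roots[OF r] by auto
      then have "degree c \<noteq> 0" using nu is_unit_iff_degree by blast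
      then have "\<not> constant (poly c)" by (simp add: constant_degree)
      then obtain a where "poly c a = 0" using fundamental_theorem_of_algebra by blast
      then have "poly P a = 0" "poly Q a = 0" using c by (auto elim!: dvdE)
      then show False using reduced_roots[OF r] by blast
    qed
  qed
  moreover have "max (degree P) (degree Q) = N"
    using reduced_coeffs[OF r] le_degree[of P N] le_degree[of Q N] reducedD(1,2)[OF r] by linarith
  ultimately show "coprime P Q \<and> max (degree P) (degree Q) = N" by blast
next
  assume a: "coprime P Q \<and> max (degree P) (degree Q) = N"
  then have d: "degree P \<le> N" "degree Q \<le> N" by auto
  have nz: "P \<noteq> 0 \<or> Q \<noteq> 0" using a by auto
  have c: "coeff P N \<noteq> 0 \<or> coeff Q N \<noteq> 0"
  proof (rule ccontr)
    assume "\<not> ?thesis"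
    then have "P = 0 \<or> degree P < N" "Q = 0 \<or> degree Q < N"
      using d leading_coeff_0_iff[of P] leading_coeff_0_iff[of Q] by (metis le_neq_implies_less)+
    moreover have "degree P = N \<or> degree Q = N" using a by linarith
    ultimately show False using nz by auto
  qed
  have "hom N P s t \<noteq> 0 \<or> hom N Q s t \<noteq> 0" if st: "s \<noteq> 0 \<or> t \<noteq> 0" for s t
  proof (cases "t = 0")
    case True
    then show ?thesis using c st by (auto simp: hom_0_right)
  next
    case False
    have "poly P (s / t) \<noteq> 0 \<or> poly Q (s / t) \<noteq> 0"
      using a coprime_poly_0 by blast
    then show ?thesis using False hom_eq_poly[OF d(1) False] hom_eq_poly[OF d(2) False] by auto
  qed
  then show "reduced N P Q" using d by (auto simp: reduced_def)
qed

lemma rat_map_iff: "rat_map N g \<longleftrightarrow> (\<exists>P Q. reduced N P Q \<and> g = rat_fun P Q)"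
  by (auto simp: rat_map_def reduced_iff)

lemma rat_fun_proj:
  assumes "degree P \<le> N" "degree Q \<le> N" "hom N P s t \<noteq> 0 \<or> hom N Q s t \<noteq> 0" "s \<noteq> 0 \<or> t \<noteq> 0"
  shows "rat_fun P Q (proj s t) = proj (hom N P s t) (hom N Q s t)"
proof (cases "t = 0")
  case True
  then have s: "s \<noteq> 0" using assms by auto
  have c: "coeff P N \<noteq> 0 \<or> coeff Q N \<noteq> 0" using assms(3) True by (auto simp: hom_0_right)
  show ?thesis
  proof (cases "coeff Q N = 0")
    case t: True
    then have "coeff P N \<noteq> 0" using c by auto
    then have "degree P = N" using assms(1) le_degree by force
    moreover have "Q = 0 \<or> degree Q < N"
      using t assms(2) leading_coeff_0_iff nat_less_le by metis
    ultimately show ?thesis using True t by (auto simp: proj_def hom_0_right)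
  next
    case False
    then have dq: "degree Q = N" using assms(2) le_degree by force
    show ?thesis
    proof (cases "degree P = N")
      case t: True
      then show ?thesis using True dq s False by (auto simp: proj_def hom_0_right)
    next
      case f: False
      then have "degree P < N" using assms(1) by simp
      then show ?thesis using True dq s False f by (auto simp: proj_def hom_0_right coeff_eq_0)
    qed
  qed
next
  case False
  then show ?thesis using assms by (auto simp: proj_def hom_eq_poly)
qed

lemma reduced_proj:
  assumes "reduced N P Q" "s \<noteq> 0 \<or> t \<noteq> 0"
  shows "rat_fun P Q (proj s t) = proj (hom N P s t) (hom N Q s t)"
  using rat_fun_proj reducedD[OF assms(1)] assms(2) by blast

section \<open>Moebius transformations as invertible matrices\<close>

abbreviation lft :: "complex \<Rightarrow> complex \<Rightarrow> complex \<Rightarrow> complex \<Rightarrow> cs \<Rightarrow> cs" where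
  "lft a b c d \<equiv> rat_fun [:b, a:] [:d, c:]"

text \<open>Multiplying the image vector by the adjugate returns the determinant times (s,
  t).\<close>

lemma matrix_kernel:
  fixes a b c d s t :: complex
  assumes "a * d - b * c \<noteq> 0" "s \<noteq> 0 \<or> t \<noteq> 0"
  shows "a * s + b * t \<noteq> 0 \<or> c * s + d * t \<noteq> 0"
proof (rule ccontr)
  assume "\<not> ?thesis"
  then have e: "a * s + b * t = 0" "c * s + d * t = 0" by auto
  have "(a * d - b * c) * s = d * (a * s + b * t) - b * (c * s + d * t)"
    "(a * d - b * c) * t = a * (c * s + d * t) - c * (a * s + b * t)" by algebra+
  then show False using e assms by auto
qed

lemma reduced_mat: "a * d - b * c \<noteq> 0 \<Longrightarrow> reduced 1 [:b, a:] [:d, c:]"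
  using matrix_kernel[of a d b c] by (simp add: reduced_def hom_linear[unfolded One_nat_def])

lemma mat_proj:
  assumes "a * d - b * c \<noteq> 0" "s \<noteq> 0 \<or> t \<noteq> 0"
  shows "lft a b c d (proj s t) = proj (a * s + b * t) (c * s + d * t)"
  using reduced_proj[OF reduced_mat[OF assms(1)] assms(2)] by (simp add: hom_linear[unfolded One_nat_def])

lemma mat_comp:
  assumes "a * d - b * c \<noteq> 0" "a' * d' - b' * c' \<noteq> 0"
  shows "lft a b c d \<circ> lft a' b' c' d' = lft (a * a' + b * c') (a * b' + b * d') (c * a' + d * c') (c * b' + d * d')"
    and "(a * a' + b * c') * (c * b' + d * d') - (a * b' + b * d') * (c * a' + d * c') \<noteq> 0"
proof -
  have "(a * a' + b * c') * (c * b' + d * d') - (a * b' + b * d') * (c * a' + d * c')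
      = (a * d - b * c) * (a' * d' - b' * c')" by algebra
  then show det: "(a * a' + b * c') * (c * b' + d * d') - (a * b' + b * d') * (c * a' + d * c') \<noteq> 0"
    using assms by simp
  show "lft a b c d \<circ> lft a' b' c' d' = lft (a * a' + b * c') (a * b' + b * d') (c * a' + d * c') (c * b' + d * d')"
  proof
    fix x
    obtain s t where st: "s \<noteq> 0 \<or> t \<noteq> 0" "x = proj s t" by (rule proj_ex)
    show "(lft a b c d \<circ> lft a' b' c' d') x = lft (a * a' + b * c') (a * b' + b * d') (c * a' + d * c') (c * b' + d * d') x"
      unfolding st(2) o_apply
      by (simp only: mat_proj[OF assms(2) st(1)] mat_proj[OF assms(1) matrix_kernel[OF assms(2) st(1)]]
          mat_proj[OF det st(1)]) (simp add: algebra_simps)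
  qed
qed

lemma mat_id: "k \<noteq> 0 \<Longrightarrow> lft k 0 0 k = id"
proof
  fix x assume k: "k \<noteq> 0"
  obtain s t where st: "s \<noteq> 0 \<or> t \<noteq> 0" "x = proj s t" by (rule proj_ex)
  show "lft k 0 0 k x = id x"
    unfolding st(2) using mat_proj[of k k 0 0 s t] st(1) k by (simp add: proj_scale)
qed

lemma mat_inverse:
  assumes "a * d - b * c \<noteq> 0"
  shows "lft d (-b) (-c) a \<circ> lft a b c d = id" "lft a b c d \<circ> lft d (-b) (-c) a = id"
proof -
  have d': "d * a - (-b) * (-c) \<noteq> 0" using assms by (simp add: algebra_simps)
  show "lft d (-b) (-c) a \<circ> lft a b c d = id"
    using mat_comp(1)[OF d' assms] mat_id[OF assms] by (simp add: algebra_simps)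
  show "lft a b c d \<circ> lft d (-b) (-c) a = id"
    using mat_comp(1)[OF assms d'] mat_id[OF assms] by (simp add: algebra_simps)
qed

lemma bij_mat: "a * d - b * c \<noteq> 0 \<Longrightarrow> bij (lft a b c d)"
  using mat_inverse o_bij by blast

lemma inv_mat:
  assumes "a * d - b * c \<noteq> 0" shows "inv (lft a b c d) = lft d (-b) (-c) a"
  using inv_unique_comp[OF mat_inverse(2)[OF assms] mat_inverse(1)[OF assms]] .

lemma mobius_bij: "mobius \<phi> \<Longrightarrow> bij \<phi>"
  using bij_mat by (auto simp: mobius_def)

lemma mobius_inv: 
  assumes "mobius \<phi>" shows "mobius (inv \<phi>)"
proof -
  obtain a b c d where d: "a * d - b * c \<noteq> 0" "\<phi> = lft a b c d" using assms by (auto simp: mobius_def)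
  show ?thesis unfolding mobius_def d(2) inv_mat[OF d(1)]
    by (intro exI[of _ d] exI[of _ "-b"] exI[of _ "-c"] exI[of _ a]) (use d(1) in \<open>simp add: algebra_simps\<close>)
qed

lemma mobius_comp:
  assumes "mobius \<phi>" "mobius \<psi>" shows "mobius (\<phi> \<circ> \<psi>)"
proof -
  obtain a b c d where d: "a * d - b * c \<noteq> 0" "\<phi> = lft a b c d" using assms by (auto simp: mobius_def)
  obtain a' b' c' d' where d': "a' * d' - b' * c' \<noteq> 0" "\<psi> = lft a' b' c' d'" using assms by (auto simp: mobius_def)
  show ?thesis unfolding mobius_def d d' using mat_comp[OF d(1) d'(1)] by metis
qed

text \<open>The form P pulled back by a matrix and written in the affine coordinate again; the
  powers of the second linear form keep the formal degree N.\<close>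

definition lin_sub :: "nat \<Rightarrow> complex poly \<Rightarrow> complex \<Rightarrow> complex \<Rightarrow> complex \<Rightarrow> complex \<Rightarrow> complex poly" where
  "lin_sub N P a b c d = (\<Sum>i\<le>N. smult (coeff P i) ([:b, a:] ^ i * [:d, c:] ^ (N - i)))"

lemma degree_lin: "degree [:b, a :: complex:] \<le> 1"
  by simp

lemma degree_lin_sub: "degree (lin_sub N P a b c d) \<le> N"
  unfolding lin_sub_def
proof (rule degree_sum_le)
  fix i assume "i \<in> {..N}"
  have "degree ([:b, a:] ^ i * [:d, c:] ^ (N - i)) \<le> i + (N - i)"
    using degree_mult_le[of "[:b, a:] ^ i" "[:d, c:] ^ (N - i)"]
      degree_power_le'[OF degree_lin[of b a], of i] degree_power_le'[OF degree_lin[of d c], of "N - i"]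
    by linarith
  then show "degree (smult (coeff P i) ([:b, a:] ^ i * [:d, c:] ^ (N - i))) \<le> N"
    using \<open>i \<in> {..N}\<close> by (intro order.trans[OF degree_smult_le]) auto
qed simp

lemma hom_lin_sub: "hom N (lin_sub N P a b c d) s t = hom N P (a * s + b * t) (c * s + d * t)"
proof -
  have "hom N ([:b, a:] ^ i * [:d, c:] ^ (N - i)) s t = (a * s + b * t) ^ i * (c * s + d * t) ^ (N - i)"
    if "i \<le> N" for i
    using hom_mult[OF degree_power_le'[OF degree_lin[of b a], of i] degree_power_le'[OF degree_lin[of d c], of "N - i"], of s t]
      hom_power[OF degree_lin[of b a]] hom_power[OF degree_lin[of d c]] hom_linear that by simp
  then show ?thesis
    unfolding lin_sub_def hom_sum hom_smult by (simp add: hom_def[of N P] mult.assoc)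
qed

lemma reduced_lin_sub:
  assumes "reduced N P Q" "a * d - b * c \<noteq> 0"
  shows "reduced N (lin_sub N P a b c d) (lin_sub N Q a b c d)"
  using reducedD(3)[OF assms(1) matrix_kernel[OF assms(2)]]
  by (auto simp: reduced_def hom_lin_sub degree_lin_sub)

lemma rat_fun_comp_mat:
  assumes "reduced N P Q" "a * d - b * c \<noteq> 0"
  shows "rat_fun P Q \<circ> lft a b c d = rat_fun (lin_sub N P a b c d) (lin_sub N Q a b c d)"
proof
  fix x
  obtain s t where st: "s \<noteq> 0 \<or> t \<noteq> 0" "x = proj s t" by (rule proj_ex)
  show "(rat_fun P Q \<circ> lft a b c d) x = rat_fun (lin_sub N P a b c d) (lin_sub N Q a b c d) x"
    unfolding st(2) o_apply mat_proj[OF assms(2) st(1)] reduced_proj[OF reduced_lin_sub[OF assms] st(1)]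
      reduced_proj[OF assms(1) matrix_kernel[OF assms(2) st(1)]] hom_lin_sub ..
qed

lemma reduced_post:
  assumes "reduced N P Q" "a * d - b * c \<noteq> 0"
  shows "reduced N (smult a P + smult b Q) (smult c P + smult d Q)"
  using reducedD(3)[OF assms(1)] matrix_kernel[OF assms(2)] reducedD(1,2)[OF assms(1)]
  by (auto simp: reduced_def hom_add hom_smult degree_add_le order.trans[OF degree_smult_le])

lemma mat_comp_rat_fun:
  assumes "reduced N P Q" "a * d - b * c \<noteq> 0"
  shows "lft a b c d \<circ> rat_fun P Q = rat_fun (smult a P + smult b Q) (smult c P + smult d Q)"
proof
  fix x
  obtain s t where st: "s \<noteq> 0 \<or> t \<noteq> 0" "x = proj s t" by (rule proj_ex)
  show "(lft a b c d \<circ> rat_fun P Q) x = rat_fun (smult a P + smult b Q) (smult c P + smult d Q) x"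
    unfolding st(2) o_apply reduced_proj[OF reduced_post[OF assms] st(1)] reduced_proj[OF assms(1) st(1)]
      mat_proj[OF assms(2) reducedD(3)[OF assms(1) st(1)]] hom_add hom_smult ..
qed

lemma rat_map_comp_mobius:
  assumes "rat_map N g" "mobius \<phi>"
  shows "rat_map N (g \<circ> \<phi>)" "rat_map N (\<phi> \<circ> g)"
proof -
  obtain P Q where g: "reduced N P Q" "g = rat_fun P Q" using assms rat_map_iff by auto
  obtain a b c d where d: "a * d - b * c \<noteq> 0" "\<phi> = lft a b c d" using assms by (auto simp: mobius_def)
  show "rat_map N (g \<circ> \<phi>)" "rat_map N (\<phi> \<circ> g)" unfolding rat_map_iff
    using reduced_lin_sub[OF g(1) d(1)] rat_fun_comp_mat[OF g(1) d(1)]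
      reduced_post[OF g(1) d(1)] mat_comp_rat_fun[OF g(1) d(1)] g(2) d(2) by metis+
qed

section \<open>Local degree\<close>

lemma cs_dist_self [simp]: "cs_dist x x = 0"
  by simp

text \<open>Reading the local degree off the chordal metric makes it visibly invariant under Moebius maps,
  which are bi-Lipschitz.\<close>
definition has_ldeg :: "(cs \<Rightarrow> cs) \<Rightarrow> cs \<Rightarrow> nat \<Rightarrow> bool" where
  "has_ldeg g z m \<longleftrightarrow> (\<exists>c C \<delta>. c > 0 \<and> C > 0 \<and> \<delta> > 0 \<and> (\<forall>x. cs_dist x z < \<delta> \<longrightarrow>
     c * cs_dist x z ^ m \<le> cs_dist (g x) (g z) \<and> cs_dist (g x) (g z) \<le> C * cs_dist x z ^ m))"

text \<open>Test sequences: the sphere has no isolated points, so bounds valid on small balls can be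
  compared off the centre.\<close>

lemma cs_perfect: "\<exists>x. (\<forall>n. x n \<noteq> z) \<and> cs_tendsto x z"
proof (cases z)
  case None
  have "cs_tendsto (\<lambda>n. proj 1 (of_real (inverse (real (Suc n))))) (proj 1 0)"
    using tendsto_of_real[OF LIMSEQ_inverse_real_of_nat, where 'a=complex]
    by (intro cs_tendsto_proj) simp_all
  then show ?thesis unfolding None
    by (intro exI[of _ "\<lambda>n. proj 1 (of_real (inverse (real (Suc n))))"])
      (auto simp: proj_def simp flip: of_nat_Suc)
next
  case (Some a)
  have "(\<lambda>n. a + of_real (inverse (real (Suc n)))) \<longlonglongrightarrow> a + of_real 0"
    by (intro tendsto_intros LIMSEQ_inverse_real_of_nat)
  then show ?thesis unfolding Some
    by (intro exI[of _ "\<lambda>n. Some (a + of_real (inverse (real (Suc n))))"])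
      (auto simp: cs_tendsto_Some_iff simp flip: of_nat_Suc)
qed

text \<open>If m exceeded k, the lower bound with exponent k and the upper bound with exponent m
  would give \<open>c \<le> C * r ^ (m - k)\<close> at points whose distance r to z tends to
  0.\<close>

lemma has_ldeg_le:
  assumes "has_ldeg g z m" "has_ldeg g z k" shows "m \<le> k"
proof (rule ccontr)
  assume lt: "\<not> m \<le> k"
  from assms(1) obtain C \<delta> where 1: "C > 0" "\<delta> > 0"
    "\<And>x. cs_dist x z < \<delta> \<Longrightarrow> cs_dist (g x) (g z) \<le> C * cs_dist x z ^ m"
    unfolding has_ldeg_def by blast
  from assms(2) obtain c \<delta>' where 2: "c > 0" "\<delta>' > 0"
    "\<And>x. cs_dist x z < \<delta>' \<Longrightarrow> c * cs_dist x z ^ k \<le> cs_dist (g x) (g z)"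
    unfolding has_ldeg_def by blast
  obtain x where x: "\<And>n. x n \<noteq> z" "cs_tendsto x z" using cs_perfect by blast
  have l: "(\<lambda>n. cs_dist (x n) z) \<longlonglongrightarrow> 0" using x(2) by (simp add: cs_tendsto_iff_dist)
  have "eventually (\<lambda>n. cs_dist (x n) z < \<delta>) sequentially" "eventually (\<lambda>n. cs_dist (x n) z < \<delta>') sequentially"
    using order_tendstoD(2)[OF l] 1 2 by auto
  then have "eventually (\<lambda>n. c \<le> C * cs_dist (x n) z ^ (m - k)) sequentially"
  proof eventually_elim
    case (elim n)
    have p: "cs_dist (x n) z > 0" using x(1)[of n] by (simp add: order_less_le)
    have "c * cs_dist (x n) z ^ k \<le> C * cs_dist (x n) z ^ m" using 1(3)[OF elim(1)] 2(3)[OF elim(2)] by linarith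
    also have "\<dots> = C * cs_dist (x n) z ^ (m - k) * cs_dist (x n) z ^ k" using lt by (simp flip: power_add)
    finally show ?case using p by simp
  qed
  moreover have "(\<lambda>n. C * cs_dist (x n) z ^ (m - k)) \<longlonglongrightarrow> C * 0 ^ (m - k)"
    by (intro tendsto_intros l)
  ultimately have "c \<le> C * 0 ^ (m - k)"
    by (intro tendsto_lowerbound[OF _ _ sequentially_bot])
  then show False using 2(1) lt by (simp add: power_0_left)
qed

lemma has_ldeg_unique: "has_ldeg g z m \<Longrightarrow> has_ldeg g z k \<Longrightarrow> m = k"
  using has_ldeg_le by (simp add: order_antisym)

text \<open>A matrix multiplies the numerator of the chordal distance by the modulus of its
  determinant and shrinks vectors by a bounded factor only.\<close>

lemma mobius_lipschitz:
  assumes "mobius \<phi>" shows "\<exists>L>0. \<forall>x y. cs_dist (\<phi> x) (\<phi> y) \<le> L * cs_dist x y"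
proof -
  obtain a b c d where d: "a * d - b * c \<noteq> 0" "\<phi> = lft a b c d" using assms by (auto simp: mobius_def)
  define D where "D = cmod (a * d - b * c)"
  define K where "K = (cmod a + cmod b + cmod c + cmod d) / D"
  have D: "D > 0" using d by (simp add: D_def)
  have nz: "a \<noteq> 0 \<or> b \<noteq> 0" using d(1) by auto
  have "cmod a + cmod b > 0" using nz by (auto simp: add_pos_nonneg add_nonneg_pos)
  then have K: "K > 0" using D unfolding K_def by (intro divide_pos_pos) (auto simp: add_pos_nonneg)
  \<comment> \<open>The adjugate bounds a vector by its image; K is a crude bound for the norm of
    the inverse matrix.\<close>
  have low: "sqrt (sqn s t) \<le> K * sqrt (sqn (a * s + b * t) (c * s + d * t))" for s t
  proof -
    define M where "M = sqrt (sqn (a * s + b * t) (c * s + d * t))"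
    have m: "cmod (a * s + b * t) \<le> M" "cmod (c * s + d * t) \<le> M"
      unfolding M_def by (rule real_le_rsqrt, simp)+
    have e: "(a * d - b * c) * s = d * (a * s + b * t) - b * (c * s + d * t)"
      "(a * d - b * c) * t = a * (c * s + d * t) - c * (a * s + b * t)" by algebra+
    have "D * cmod s \<le> cmod d * cmod (a * s + b * t) + cmod b * cmod (c * s + d * t)"
      unfolding D_def norm_mult[symmetric] e by (rule norm_triangle_ineq4)
    also have "\<dots> \<le> cmod d * M + cmod b * M" using m by (intro add_mono mult_left_mono) auto
    finally have 1: "D * cmod s \<le> cmod d * M + cmod b * M" .
    have "D * cmod t \<le> cmod a * cmod (c * s + d * t) + cmod c * cmod (a * s + b * t)"
      unfolding D_def norm_mult[symmetric] e by (rule norm_triangle_ineq4)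
    also have "\<dots> \<le> cmod a * M + cmod c * M" using m by (intro add_mono mult_left_mono) auto
    finally have 2: "D * cmod t \<le> cmod a * M + cmod c * M" .
    have "sqrt (sqn s t) \<le> cmod s + cmod t" by (rule sqrt_sum_squares_le_sum) auto
    also have "\<dots> \<le> K * M" using 1 2 D unfolding K_def by (simp add: field_simps)
    finally show ?thesis by (simp add: M_def)
  qed
  show ?thesis
  proof (intro exI[of _ "D * K * K"] conjI allI)
    show "D * K * K > 0" using D K by simp
    fix x y
    obtain s t where x: "s \<noteq> 0 \<or> t \<noteq> 0" "x = proj s t" by (rule proj_ex)
    obtain s' t' where y: "s' \<noteq> 0 \<or> t' \<noteq> 0" "y = proj s' t'" by (rule proj_ex)
    define M where "M = sqrt (sqn (a * s + b * t) (c * s + d * t))"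
    define M' where "M' = sqrt (sqn (a * s' + b * t') (c * s' + d * t'))"
    define m m' where "m = sqrt (sqn s t)" and "m' = sqrt (sqn s' t')"
    have pos: "M > 0" "M' > 0" "m > 0" "m' > 0" unfolding M_def M'_def m_def m'_def
      using sqn_pos[OF matrix_kernel[OF d(1) x(1)]] sqn_pos[OF matrix_kernel[OF d(1) y(1)]]
        sqn_pos[OF x(1)] sqn_pos[OF y(1)] by simp_all
    have "(a * s + b * t) * (c * s' + d * t') - (a * s' + b * t') * (c * s + d * t)
        = (a * d - b * c) * (s * t' - s' * t)" by algebra
    then have "cs_dist (\<phi> x) (\<phi> y) = 2 * (D * cmod (s * t' - s' * t)) / (M * M')"
      unfolding x(2) y(2) d(2) mat_proj[OF d(1) x(1)] mat_proj[OF d(1) y(1)]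
        cs_dist_proj[OF matrix_kernel[OF d(1) x(1)] matrix_kernel[OF d(1) y(1)]] M_def M'_def
      by (simp add: norm_mult D_def)
    also have "\<dots> \<le> 2 * (D * cmod (s * t' - s' * t)) / ((m / K) * (m' / K))"
    proof (rule divide_left_mono)
      have "m / K \<le> M" "m' / K \<le> M'" using low[of s t] low[of s' t'] K
        unfolding m_def m'_def M_def M'_def by (simp_all add: field_simps)
      then show "m / K * (m' / K) \<le> M * M'" using pos K by (intro mult_mono) auto
    qed (use pos K D in auto)
    also have "\<dots> = D * K * K * cs_dist x y"
      unfolding x(2) y(2) cs_dist_proj[OF x(1) y(1)] m_def m'_def by simp
    finally show "cs_dist (\<phi> x) (\<phi> y) \<le> D * K * K * cs_dist x y" .
  qed
qed

lemma mobius_bilipschitz: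
  assumes "mobius \<phi>"
  shows "\<exists>L>0. (\<forall>x y. cs_dist (\<phi> x) (\<phi> y) \<le> L * cs_dist x y) \<and>
    (\<forall>x y. cs_dist x y \<le> L * cs_dist (\<phi> x) (\<phi> y))"
proof -
  obtain L where L: "L > 0" "\<And>x y. cs_dist (\<phi> x) (\<phi> y) \<le> L * cs_dist x y"
    using mobius_lipschitz[OF assms] by blast
  obtain K where K: "K > 0" "\<And>x y. cs_dist (inv \<phi> x) (inv \<phi> y) \<le> K * cs_dist x y"
    using mobius_lipschitz[OF mobius_inv[OF assms]] by blast
  have inj: "inj \<phi>" using mobius_bij[OF assms] bij_is_inj by blast
  show ?thesis
  proof (intro exI[of _ "max L K"] conjI allI)
    fix x y
    show "cs_dist (\<phi> x) (\<phi> y) \<le> max L K * cs_dist x y"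
      by (rule order.trans[OF L(2)], rule mult_right_mono) auto
    show "cs_dist x y \<le> max L K * cs_dist (\<phi> x) (\<phi> y)"
      using K(2)[of "\<phi> x" "\<phi> y"] inj
      by (simp add: inv_f_f) (rule order.trans, assumption, rule mult_right_mono, auto)
  qed (use L in auto)
qed

lemma mobius_tendsto:
  assumes "mobius \<phi>" "cs_tendsto x l" shows "cs_tendsto (\<lambda>n. \<phi> (x n)) (\<phi> l)"
proof -
  obtain L where L: "L > 0" "\<And>x y. cs_dist (\<phi> x) (\<phi> y) \<le> L * cs_dist x y"
    using mobius_lipschitz[OF assms(1)] by blast
  have lim: "(\<lambda>n. L * cs_dist (x n) l) \<longlonglongrightarrow> 0"
    using tendsto_mult_left[of _ 0 sequentially L] assms(2) unfolding cs_tendsto_iff_dist by simp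
  show ?thesis unfolding cs_tendsto_iff_dist
    by (rule tendsto_sandwich[OF _ _ tendsto_const lim]) (use L(2) in auto)
qed

lemma has_ldeg_post:
  assumes "has_ldeg g z m" "mobius \<phi>" shows "has_ldeg (\<phi> \<circ> g) z m"
proof -
  obtain c C \<delta> where 1: "c > 0" "C > 0" "\<delta> > 0" 
    "\<And>x. cs_dist x z < \<delta> \<Longrightarrow> c * cs_dist x z ^ m \<le> cs_dist (g x) (g z)"
    "\<And>x. cs_dist x z < \<delta> \<Longrightarrow> cs_dist (g x) (g z) \<le> C * cs_dist x z ^ m"
    using assms(1) unfolding has_ldeg_def by blast
  obtain L where L: "L > 0" "\<And>x y. cs_dist (\<phi> x) (\<phi> y) \<le> L * cs_dist x y"
    "\<And>x y. cs_dist x y \<le> L * cs_dist (\<phi> x) (\<phi> y)" using mobius_bilipschitz[OF assms(2)] by blast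
  have "c / L * cs_dist x z ^ m \<le> cs_dist (\<phi> (g x)) (\<phi> (g z)) \<and>
        cs_dist (\<phi> (g x)) (\<phi> (g z)) \<le> L * C * cs_dist x z ^ m" if x: "cs_dist x z < \<delta>" for x
  proof
    have "c * cs_dist x z ^ m \<le> L * cs_dist (\<phi> (g x)) (\<phi> (g z))"
      using 1(4)[OF x] L(3)[of "g x" "g z"] by linarith
    then show "c / L * cs_dist x z ^ m \<le> cs_dist (\<phi> (g x)) (\<phi> (g z))" using L(1) by (simp add: field_simps)
    have "L * cs_dist (g x) (g z) \<le> L * (C * cs_dist x z ^ m)"
      using 1(5)[OF x] L(1) by (intro mult_left_mono) auto
    then show "cs_dist (\<phi> (g x)) (\<phi> (g z)) \<le> L * C * cs_dist x z ^ m"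
      using L(2)[of "g x" "g z"] by (simp add: mult.assoc)
  qed
  moreover have "c / L > 0" "L * C > 0" using 1 L by simp_all
  ultimately show ?thesis unfolding has_ldeg_def o_apply using 1(3) by blast
qed

lemma has_ldeg_pre:
  assumes "has_ldeg g (\<phi> z) m" "mobius \<phi>" shows "has_ldeg (g \<circ> \<phi>) z m"
proof -
  obtain c C \<delta> where 1: "c > 0" "C > 0" "\<delta> > 0" 
    "\<And>x. cs_dist x (\<phi> z) < \<delta> \<Longrightarrow> c * cs_dist x (\<phi> z) ^ m \<le> cs_dist (g x) (g (\<phi> z))"
    "\<And>x. cs_dist x (\<phi> z) < \<delta> \<Longrightarrow> cs_dist (g x) (g (\<phi> z)) \<le> C * cs_dist x (\<phi> z) ^ m"
    using assms(1) unfolding has_ldeg_def by blast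
  obtain L where L: "L > 0" "\<And>x y. cs_dist (\<phi> x) (\<phi> y) \<le> L * cs_dist x y"
    "\<And>x y. cs_dist x y \<le> L * cs_dist (\<phi> x) (\<phi> y)" using mobius_bilipschitz[OF assms(2)] by blast
  have "c / L ^ m * cs_dist x z ^ m \<le> cs_dist (g (\<phi> x)) (g (\<phi> z)) \<and>
        cs_dist (g (\<phi> x)) (g (\<phi> z)) \<le> C * L ^ m * cs_dist x z ^ m" if x: "cs_dist x z < \<delta> / L" for x
  proof
    have "L * cs_dist x z < \<delta>" using x L(1) by (simp add: field_simps)
    then have near: "cs_dist (\<phi> x) (\<phi> z) < \<delta>" using L(2)[of x z] by linarith
    have "cs_dist x z ^ m \<le> (L * cs_dist (\<phi> x) (\<phi> z)) ^ m" using L(3) by (intro power_mono) auto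
    then have "c * cs_dist x z ^ m \<le> L ^ m * (c * cs_dist (\<phi> x) (\<phi> z) ^ m)"
      using 1(1) by (simp add: power_mult_distrib mult.left_commute)
    also have "\<dots> \<le> L ^ m * cs_dist (g (\<phi> x)) (g (\<phi> z))"
      using 1(4)[OF near] L(1) by (intro mult_left_mono) auto
    finally show "c / L ^ m * cs_dist x z ^ m \<le> cs_dist (g (\<phi> x)) (g (\<phi> z))"
      using L(1) by (simp add: field_simps)
    have "cs_dist (\<phi> x) (\<phi> z) ^ m \<le> (L * cs_dist x z) ^ m" using L(2) by (intro power_mono) auto
    then have "C * cs_dist (\<phi> x) (\<phi> z) ^ m \<le> C * (L * cs_dist x z) ^ m"
      using 1(2) by (intro mult_left_mono) auto
    then show "cs_dist (g (\<phi> x)) (g (\<phi> z)) \<le> C * L ^ m * cs_dist x z ^ m"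
      using 1(5)[OF near] by (simp add: power_mult_distrib mult.assoc)
  qed
  moreover have "c / L ^ m > 0" "C * L ^ m > 0" "\<delta> / L > 0" using 1 L by simp_all
  ultimately show ?thesis unfolding has_ldeg_def o_apply by blast
qed

section \<open>Coordinate discs, and the local degree as an order of vanishing\<close>

lemma finite_chart_nbhd:
  assumes "e > 0" shows "\<exists>\<delta>>0. \<forall>x. cs_dist x (Some a) < \<delta> \<longrightarrow> (\<exists>u. x = Some u \<and> cmod (u - a) < e)"
proof (rule ccontr)
  assume "\<not> ?thesis"
  then have "\<forall>n::nat. \<exists>x. cs_dist x (Some a) < inverse (real (Suc n)) \<and> \<not> (\<exists>u. x = Some u \<and> cmod (u - a) < e)"
    by (metis inverse_positive_iff_positive of_nat_0_less_iff zero_less_Suc)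
  then obtain x where x: "\<And>n. cs_dist (x n) (Some a) < inverse (real (Suc n))"
    "\<And>n. \<not> (\<exists>u. x n = Some u \<and> cmod (u - a) < e)" by metis
  have t: "cs_tendsto x (Some a)" unfolding cs_tendsto_iff_dist
    by (rule tendsto_sandwich[OF _ _ tendsto_const LIMSEQ_inverse_real_of_nat])
      (use x(1) in \<open>auto intro!: always_eventually less_imp_le\<close>)
  obtain N where N: "\<And>n. n \<ge> N \<Longrightarrow> x n \<noteq> None"
    using cs_tendsto_eventually_finite[OF t] by (auto simp: eventually_sequentially)
  have "cs_tendsto (\<lambda>n. x (n + N)) (Some a)"
    using cs_tendsto_subseq[OF t, of "\<lambda>n. n + N"] by (simp add: strict_mono_def)
  moreover have "x (n + N) = Some (the (x (n + N)))" for n using N[of "n + N"] by auto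
  ultimately have "(\<lambda>n. the (x (n + N))) \<longlonglongrightarrow> a"
    using cs_tendsto_Some_iff by (metis (no_types, lifting) ext)
  then obtain n where "dist (the (x (n + N))) a < e"
    using assms unfolding lim_sequentially by blast
  then show False using x(2)[of "n + N"] N[of "n + N"] by (auto simp: dist_norm)
qed

lemma cs_dist_swap:
  assumes "s \<noteq> 0 \<or> t \<noteq> 0" "s' \<noteq> 0 \<or> t' \<noteq> 0"
  shows "cs_dist (proj t s) (proj t' s') = cs_dist (proj s t) (proj s' t')"
proof -
  have "t * s' - t' * s = - (s * t' - s' * t)" by (simp add: algebra_simps)
  then have "cmod (t * s' - t' * s) = cmod (s * t' - s' * t)" by (simp only: norm_minus_cancel)
  then show ?thesis using cs_dist_proj[of t s t' s'] cs_dist_proj[OF assms] assms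
    by (auto simp: add.commute)
qed

lemma infinite_chart_nbhd:
  assumes "e > 0" shows "\<exists>\<delta>>0. \<forall>x. cs_dist x (proj 1 0) < \<delta> \<longrightarrow> (\<exists>u. x = proj 1 u \<and> cmod u < e)"
proof -
  obtain \<delta> where \<delta>: "\<delta> > 0" "\<And>x. cs_dist x (Some 0) < \<delta> \<Longrightarrow> \<exists>u. x = Some u \<and> cmod (u - 0) < e"
    using finite_chart_nbhd[OF assms] by blast
  have "\<exists>u. x = proj 1 u \<and> cmod u < e" if x: "cs_dist x (proj 1 0) < \<delta>" for x
  proof -
    obtain s t where st: "s \<noteq> 0 \<or> t \<noteq> 0" "x = proj s t" by (rule proj_ex)
    have "cs_dist (proj t s) (proj 0 1) < \<delta>" using x cs_dist_swap[of s t 1 0] st by simp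
    then obtain u where u: "proj t s = Some u" "cmod u < e" using \<delta>(2)[of "proj t s"] by (auto simp: proj_def)
    then have "s \<noteq> 0" "u = t / s" by (auto simp: proj_def split: if_splits)
    then have "x = proj 1 u" using st by (simp add: proj_def)
    then show ?thesis using u by blast
  qed
  then show ?thesis using \<delta>(1) by blast
qed

text \<open>Up to positive continuous factors the chordal distance from the image of u to that of a
  is the modulus of S, a polynomial vanishing at a to order m. The chart \<open>proj 1 u\<close> is
  needed around u = 0 only, that is, around infinity.\<close>

lemma has_ldeg_chart:
  fixes A B :: "complex poly" and ch :: "complex \<Rightarrow> cs" and a :: complex
  defines "S \<equiv> smult (poly B a) A - smult (poly A a) B"
  assumes chi: "ch = (\<lambda>u. proj u 1) \<or> (ch = (\<lambda>u. proj 1 u) \<and> a = 0)"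
    and g: "\<And>u. g (ch u) = proj (poly A u) (poly B u)"
    and AB: "\<And>u. poly A u \<noteq> 0 \<or> poly B u \<noteq> 0" and S: "S \<noteq> 0"
  shows "has_ldeg g (ch a) (order a S)"
proof -
  define m where "m = order a S"
  obtain T where T: "S = [:- a, 1:] ^ m * T" "\<not> [:- a, 1:] dvd T"
    using order_decomp[OF S] unfolding m_def by blast
  have Ta: "poly T a \<noteq> 0" using T(2) by (simp add: poly_eq_0_iff_dvd)
  define n where "n u = sqrt (sqn (poly A u) (poly B u))" for u
  define r where "r u = sqrt (1 + (cmod u)\<^sup>2)" for u
  have n: "n u > 0" for u using sqn_pos[OF AB] by (simp add: n_def)
  have r: "r u > 0" for u by (simp add: r_def add_pos_nonneg)
  \<comment> \<open>The quotient of the target distance by the m-th power of the source distance,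
    with the zero of S already divided out, so that it is defined and positive at a itself.\<close>
  define \<rho> where "\<rho> u = 2 * cmod (poly T u) / (n u * n a) * (r u * r a / 2) ^ m" for u
  have dx: "cs_dist (ch u) (ch a) = 2 * cmod (u - a) / (r u * r a)" for u
    using chi
  proof
    assume "ch = (\<lambda>u. proj u 1)"
    then show ?thesis using cs_dist_proj[of u 1 a 1] by (simp add: r_def add.commute)
  next
    assume "ch = (\<lambda>u. proj 1 u) \<and> a = 0"
    then show ?thesis using cs_dist_proj[of 1 u 1 a] by (simp add: r_def)
  qed
  have dg: "cs_dist (g (ch u)) (g (ch a)) = 2 * cmod (poly S u) / (n u * n a)" for u
    unfolding g cs_dist_proj[OF AB AB] n_def S_def by (simp add: mult.commute)
  have key: "cs_dist (g (ch u)) (g (ch a)) = \<rho> u * cs_dist (ch u) (ch a) ^ m" for u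
  proof -
    have "(r u * r a / 2) ^ m * (2 * cmod (u - a) / (r u * r a)) ^ m = cmod (u - a) ^ m"
      unfolding power_mult_distrib[symmetric] using r[of u] r[of a] by simp
    then have "\<rho> u * cs_dist (ch u) (ch a) ^ m = 2 * cmod (poly T u) / (n u * n a) * cmod (u - a) ^ m"
      unfolding \<rho>_def dx by (simp add: mult.assoc)
    then show ?thesis unfolding dg T(1) by (simp add: norm_mult norm_power)
  qed
  have "isCont \<rho> a" unfolding \<rho>_def n_def r_def
    by (intro continuous_intros) (use n[of a] in \<open>auto simp: n_def\<close>)
  then have lim: "\<rho> \<midarrow>a\<rightarrow> \<rho> a" by (simp add: isCont_def)
  have pos: "\<rho> a > 0" unfolding \<rho>_def using Ta n[of a] r[of a] by simp
  have "eventually (\<lambda>u. \<rho> u > \<rho> a / 2) (at a)" "eventually (\<lambda>u. \<rho> u < 2 * \<rho> a) (at a)"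
    using order_tendstoD(1)[OF lim, of "\<rho> a / 2"] order_tendstoD(2)[OF lim, of "2 * \<rho> a"] pos by linarith+
  then have "eventually (\<lambda>u. \<rho> a / 2 \<le> \<rho> u \<and> \<rho> u \<le> 2 * \<rho> a) (at a)" by eventually_elim auto
  then obtain e where e: "e > 0" "\<And>u. u \<noteq> a \<Longrightarrow> dist u a < e \<Longrightarrow> \<rho> a / 2 \<le> \<rho> u \<and> \<rho> u \<le> 2 * \<rho> a"
    unfolding eventually_at by blast
  have e': "\<rho> a / 2 \<le> \<rho> u \<and> \<rho> u \<le> 2 * \<rho> a" if "cmod (u - a) < e" for u
    using e(2)[of u] pos that by (cases "u = a") (auto simp: dist_norm)
  obtain \<delta> where \<delta>: "\<delta> > 0" "\<And>x. cs_dist x (ch a) < \<delta> \<Longrightarrow> \<exists>u. x = ch u \<and> cmod (u - a) < e"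
    using chi finite_chart_nbhd[OF e(1), of a] infinite_chart_nbhd[OF e(1)] by (auto simp: proj_def)
  have "\<rho> a / 2 * cs_dist x (ch a) ^ m \<le> cs_dist (g x) (g (ch a)) \<and>
        cs_dist (g x) (g (ch a)) \<le> 2 * \<rho> a * cs_dist x (ch a) ^ m" if x: "cs_dist x (ch a) < \<delta>" for x
  proof -
    obtain u where u: "x = ch u" "cmod (u - a) < e" using \<delta>(2)[OF x] by blast
    show ?thesis unfolding u(1) key using e'[OF u(2)] by (intro conjI mult_right_mono) simp_all
  qed
  then show ?thesis unfolding has_ldeg_def m_def using pos \<delta>(1)
    by (intro exI[of _ "\<rho> a / 2"] exI[of _ "2 * \<rho> a"] exI[of _ \<delta>]) auto
qed

text \<open>Proportional forms of positive degree would share a zero, which exists over the complex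
  numbers. Degree 0 has to be excluded, since constants are always proportional.\<close>

lemma reduced_indep:
  assumes "reduced N P Q" "N \<ge> 1" "\<alpha> \<noteq> 0 \<or> \<beta> \<noteq> 0"
  shows "smult \<beta> P - smult \<alpha> Q \<noteq> 0"
proof
  assume z: "smult \<beta> P - smult \<alpha> Q = 0"
  have m: "max (degree P) (degree Q) = N" using assms(1) by (simp add: reduced_iff)
  have root: "\<exists>a. poly R a = 0" if "degree R \<noteq> 0" for R :: "complex poly"
    using that fundamental_theorem_of_algebra[of R] by (simp add: constant_degree)
  show False
  proof (cases "\<beta> = 0")
    case True
    then have "Q = 0" using z assms(3) by auto
    then have "degree P \<noteq> 0" using m assms(2) by auto
    then show False using root[of P] reduced_roots[OF assms(1)] \<open>Q = 0\<close> by auto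
  next
    case False
    have "P = smult (\<alpha> / \<beta>) Q" using z False
      by (metis (no_types, lifting) divide_inverse eq_iff_diff_eq_0 left_inverse mult.commute smult_1_left smult_smult)
    then have "degree Q \<noteq> 0" using m assms(2) by auto
    then obtain a where "poly Q a = 0" using root by blast
    then show False using reduced_roots[OF assms(1), of a] \<open>P = smult (\<alpha> / \<beta>) Q\<close> by auto
  qed
qed

text \<open>Passes from the symmetric expression, which treats all target values alike, to the two
  cases in the definition of \<open>pq_ldeg\<close>; they differ by nonzero constants only.\<close>

lemma order_chart:
  fixes A B :: "complex poly"
  assumes "poly A a \<noteq> 0 \<or> poly B a \<noteq> 0"
  shows "order a (smult (poly B a) A - smult (poly A a) B) =
    (case if poly B a = 0 then None else Some (poly A a / poly B a) of
       Some w \<Rightarrow> order a (A - smult w B) | None \<Rightarrow> order a B)"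
proof (cases "poly B a = 0")
  case True
  then show ?thesis using assms by (simp add: order_smult)
next
  case False
  have "smult (poly B a) A - smult (poly A a) B = smult (poly B a) (A - smult (poly A a / poly B a) B)"
    using False by (simp add: smult_diff_right)
  then show ?thesis using False by (simp add: order_smult)
qed

text \<open>Identifies the reversed polynomials of \<open>pq_ldeg\<close> with the forms along
  [1 : u]; the extra power of u makes up for a degree below N.\<close>

lemma hom_reverse:
  assumes "degree P \<le> N"
  shows "poly (monom 1 (N - degree P) * reflect_poly P) u = hom N P 1 u"
proof (cases "u = 0")
  case True
  show ?thesis
  proof (cases "degree P = N")
    case t: True
    then show ?thesis using True by (simp add: poly_monom hom_def power_0_left poly_0_coeff_0
        sum.delta[of "{..N}" N] if_distrib[of "\<lambda>x. _ * x"] cong: if_cong) 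
  next
    case False
    then have "N - degree P \<noteq> 0" "coeff P N = 0" using assms by (auto simp: coeff_eq_0)
    moreover have "hom N P 1 0 = coeff P N" using hom_0_right[of N P 1] by simp
    ultimately show ?thesis using True by (simp add: poly_monom)
  qed
next
  case False
  have "u ^ N = u ^ (N - degree P) * u ^ degree P" using assms by (simp flip: power_add)
  then show ?thesis using False assms
    by (simp add: poly_monom poly_reflect_poly_nz hom_eq_poly inverse_eq_divide)
qed

lemma has_ldeg_pq_ldeg:
  assumes r: "reduced N P Q" and N: "N \<ge> 1"
  shows "has_ldeg (rat_fun P Q) z (pq_ldeg P Q z)"
proof (cases z)
  case (Some a)
  have AB: "poly P u \<noteq> 0 \<or> poly Q u \<noteq> 0" for u using reduced_roots[OF r] .
  have g: "rat_fun P Q (proj u 1) = proj (poly P u) (poly Q u)" for u by (simp add: proj_def)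
  have S: "smult (poly Q a) P - smult (poly P a) Q \<noteq> 0"
    using reduced_indep[OF r N] AB by blast
  have "has_ldeg (rat_fun P Q) (proj a 1) (order a (smult (poly Q a) P - smult (poly P a) Q))"
    by (rule has_ldeg_chart[where ch = "\<lambda>u. proj u 1"]) (use g AB S in auto)
  then show ?thesis unfolding order_chart[OF AB] Some pq_ldeg_def by (simp add: proj_def Let_def split: if_splits)
next
  case None
  define P' where "P' = monom 1 (N - degree P) * reflect_poly P"
  define Q' where "Q' = monom 1 (N - degree Q) * reflect_poly Q"
  have p: "poly P' u = hom N P 1 u" "poly Q' u = hom N Q 1 u" for u
    unfolding P'_def Q'_def using hom_reverse reducedD(1,2)[OF r] by auto
  have AB: "poly P' u \<noteq> 0 \<or> poly Q' u \<noteq> 0" for u using reducedD(3)[OF r, of 1 u] p by auto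
  have g: "rat_fun P Q (proj 1 u) = proj (poly P' u) (poly Q' u)" for u
    using reduced_proj[OF r, of 1 u] p by simp
  \<comment> \<open>If this vanished identically in the chart at infinity, the same combination R of
    P and Q would vanish at all nonzero points, against \<open>reduced_indep\<close>.\<close>
  have S: "smult (poly Q' 0) P' - smult (poly P' 0) Q' \<noteq> 0"
  proof
    assume "smult (poly Q' 0) P' - smult (poly P' 0) Q' = 0"
    then have "poly (smult (poly Q' 0) P' - smult (poly P' 0) Q') u = 0" for u by simp
    then have h: "hom N (smult (poly Q' 0) P - smult (poly P' 0) Q) 1 u = 0" for u
      by (simp add: hom_diff hom_smult p)
    define R where "R = smult (poly Q' 0) P - smult (poly P' 0) Q"
    have R: "R \<noteq> 0" unfolding R_def using reduced_indep[OF r N] AB by blast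
    have dR: "degree R \<le> N" unfolding R_def using reducedD(1,2)[OF r]
      by (intro degree_diff_le order.trans[OF degree_smult_le])
    have "poly R x = 0" if "x \<noteq> 0" for x
      using h[of "1 / x"] hom_eq_poly[OF dR, of "1 / x" 1] that by (simp add: R_def)
    then have "UNIV - {0} \<subseteq> {x. poly R x = 0}" by auto
    then show False using poly_roots_finite[OF R] finite_subset infinite_UNIV_char_0 by (metis finite_Diff2 finite.emptyI finite.insertI)
  qed
  have "has_ldeg (rat_fun P Q) (proj 1 0) (order 0 (smult (poly Q' 0) P' - smult (poly P' 0) Q'))"
    by (rule has_ldeg_chart[where ch = "\<lambda>u. proj 1 u"]) (use g AB S in auto)
  moreover have "rat_fun P Q None = (if poly Q' 0 = 0 then None else Some (poly P' 0 / poly Q' 0))"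
    using g[of 0] by (simp add: proj_def)
  moreover have "max (degree P) (degree Q) = N" using r by (simp add: reduced_iff)
  moreover have "proj 1 0 = None" by (simp add: proj_def)
  ultimately show ?thesis unfolding order_chart[OF AB] None pq_ldeg_def Let_def
    by (simp only: P'_def[symmetric] Q'_def[symmetric] option.case)
qed

lemma pq_ldeg_pos:
  assumes r: "reduced N P Q" and N: "N \<ge> 1"
  shows "pq_ldeg P Q z \<ge> 1"
proof (rule ccontr)
  assume "\<not> ?thesis"
  then have "pq_ldeg P Q z = 0" by simp
  then have "has_ldeg (rat_fun P Q) z 0" using has_ldeg_pq_ldeg[OF r N, of z] by simp
  then obtain c where "c > 0" "c * cs_dist z z ^ 0 \<le> cs_dist (rat_fun P Q z) (rat_fun P Q z)"
    unfolding has_ldeg_def by (metis cs_dist_eq_0)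
  then show False by simp
qed

lemma has_ldeg_nonconst:
  assumes "has_ldeg g z m" shows "\<exists>x. g x \<noteq> g z"
proof (rule ccontr)
  assume "\<not> ?thesis"
  then have const: "g x = g z" for x by blast
  obtain c \<delta> where c: "c > 0" "\<delta> > 0" "\<And>x. cs_dist x z < \<delta> \<Longrightarrow> c * cs_dist x z ^ m \<le> cs_dist (g x) (g z)"
    using assms unfolding has_ldeg_def by blast
  obtain x where x: "\<And>n. x n \<noteq> z" "cs_tendsto x z" using cs_perfect by blast
  have "eventually (\<lambda>n. cs_dist (x n) z < \<delta>) sequentially"
    using x(2) c(2) order_tendstoD(2) unfolding cs_tendsto_iff_dist by blast
  then obtain n where "cs_dist (x n) z < \<delta>" using eventually_happens'[OF sequentially_bot] by blast
  then have "c * cs_dist (x n) z ^ m \<le> 0" using c(3)[of "x n"] const[of "x n"] by simp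
  moreover have "cs_dist (x n) z > 0" using x(1)[of n] by (simp add: order_less_le)
  then have "0 < c * cs_dist (x n) z ^ m" using c(1) by simp
  ultimately show False by linarith
qed

text \<open>\<open>ldeg\<close> reads a number off a representation picked by \<open>SOME\<close>.
  By the metric characterisation every coprime representation of positive degree yields the same
  number.\<close>

lemma has_ldeg_ldeg:
  assumes "rat_map N g" "N \<ge> 1" shows "has_ldeg g z (ldeg g z)"
proof -
  obtain P0 Q0 where g: "reduced N P0 Q0" "g = rat_fun P0 Q0" using assms rat_map_iff by auto
  define PQ where "PQ = (SOME PQ. coprime (fst PQ) (snd PQ) \<and> g = rat_fun (fst PQ) (snd PQ))"
  have "\<exists>PQ. coprime (fst PQ) (snd PQ) \<and> g = rat_fun (fst PQ) (snd PQ)"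
    using g by (intro exI[of _ "(P0, Q0)"]) (simp add: reduced_iff)
  from someI_ex[OF this] have PQ: "coprime (fst PQ) (snd PQ)" "g = rat_fun (fst PQ) (snd PQ)"
    by (simp_all add: PQ_def)
  define K where "K = max (degree (fst PQ)) (degree (snd PQ))"
  have r: "reduced K (fst PQ) (snd PQ)" using PQ(1) by (simp add: reduced_iff K_def)
  \<comment> \<open>Degree 0 would make g constant, but the given representation provides a metric
    local degree, which constant maps do not have.\<close>
  have "K \<noteq> 0"
  proof
    assume K: "K = 0"
    have const: "g (proj s t) = g (proj 1 0)" if "s \<noteq> 0 \<or> t \<noteq> 0" for s t
      using reduced_proj[OF r that] reduced_proj[OF r, of 1 0] K by (simp add: PQ(2) hom_def)
    have const: "g x = g z" for x
      using const by (metis proj_ex)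
    then show False using has_ldeg_nonconst[OF has_ldeg_pq_ldeg[OF g(1) assms(2), of z]] g(2) by metis
  qed
  moreover have "ldeg g z = pq_ldeg (fst PQ) (snd PQ) z"
    unfolding ldeg_def PQ_def[symmetric] by (simp add: case_prod_beta)
  ultimately show ?thesis using has_ldeg_pq_ldeg[OF r, of z] PQ(2) by simp
qed

lemma ldeg_eq_pq_ldeg:
  assumes "reduced N P Q" "N \<ge> 1" shows "ldeg (rat_fun P Q) z = pq_ldeg P Q z"
  using has_ldeg_unique[OF has_ldeg_ldeg has_ldeg_pq_ldeg[OF assms]] assms rat_map_iff by blast

lemma ldeg_pos: "rat_map N g \<Longrightarrow> N \<ge> 1 \<Longrightarrow> ldeg g z \<ge> 1"
  using rat_map_iff ldeg_eq_pq_ldeg pq_ldeg_pos by metis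

lemma ldeg_mobius:
  assumes "rat_map N g" "N \<ge> 1" "mobius \<phi>"
  shows "ldeg (g \<circ> \<phi>) z = ldeg g (\<phi> z)" "ldeg (\<phi> \<circ> g) z = ldeg g z"
  using has_ldeg_unique[OF has_ldeg_ldeg[OF rat_map_comp_mobius(1)[OF assms(1,3)] assms(2)]
      has_ldeg_pre[OF has_ldeg_ldeg[OF assms(1,2)] assms(3)]]
    has_ldeg_unique[OF has_ldeg_ldeg[OF rat_map_comp_mobius(2)[OF assms(1,3)] assms(2)]
      has_ldeg_post[OF has_ldeg_ldeg[OF assms(1,2)] assms(3)]] by auto

section \<open>The Riemann--Hurwitz formula\<close>

lemma mobius_id: "mobius id"
  unfolding mobius_def using mat_id[of 1]
  by (intro exI[of _ 1] exI[of _ 0]) simp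

lemma mobius_to_infinity: "\<exists>A. mobius A \<and> A b = None"
proof (cases b)
  case None
  then show ?thesis using mobius_id by (intro exI[of _ id]) simp
next
  case (Some c)
  have "mobius (lft 0 1 1 (-c))" unfolding mobius_def
    by (intro exI[of _ 0] exI[of _ 1] exI[of _ "-c"]) simp
  moreover have "lft 0 1 1 (-c) b = None" by (simp add: Some)
  ultimately show ?thesis by blast
qed

lemma mobius_transitive: "\<exists>A. mobius A \<and> A x = y"
proof -
  obtain B where B: "mobius B" "B x = None" using mobius_to_infinity by blast
  obtain C where C: "mobius C" "C y = None" using mobius_to_infinity by blast
  have "inv C None = y" using C mobius_bij[OF C(1)] by (metis bij_inv_eq_iff)
  then show ?thesis using B C mobius_comp[OF mobius_inv[OF C(1)] B(1)]
    by (intro exI[of _ "inv C \<circ> B"]) simp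
qed

lemma sum_order_roots:
  fixes P :: "complex poly" assumes "P \<noteq> 0"
  shows "(\<Sum>a | poly P a = 0. order a P) = degree P"
proof -
  have "degree P = sum (count (proots P)) (set_mset (proots P))"
    using size_proots_complex[of P] by (simp add: size_multiset_overloaded_eq)
  then show ?thesis using assms by simp
qed

lemma ldeg_Some:
  assumes "reduced N P Q" "N \<ge> 1"
  shows "poly Q a \<noteq> 0 \<Longrightarrow> ldeg (rat_fun P Q) (Some a) = order a (P - smult (poly P a / poly Q a) Q)"
    and "poly Q a = 0 \<Longrightarrow> ldeg (rat_fun P Q) (Some a) = order a Q"
  by (simp_all add: ldeg_eq_pq_ldeg[OF assms] pq_ldeg_def Let_def)

lemma ldeg_mobius_conj:
  assumes "rat_map N g" "N \<ge> 1" "mobius A" "mobius B"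
  shows "rat_map N (B \<circ> g \<circ> A)" "ldeg (B \<circ> g \<circ> A) x = ldeg g (A x)"
proof -
  have "rat_map N (B \<circ> g)" using rat_map_comp_mobius assms by blast
  then show "rat_map N (B \<circ> g \<circ> A)" "ldeg (B \<circ> g \<circ> A) x = ldeg g (A x)"
    using rat_map_comp_mobius ldeg_mobius assms by metis+
qed

lemma rat_map_nonconst:
  assumes "rat_map N g" "N \<ge> 1" shows "\<exists>x. g x \<noteq> b"
proof -
  obtain x where "g x \<noteq> g None" using has_ldeg_nonconst[OF has_ldeg_ldeg[OF assms]] by blast
  then show ?thesis by metis
qed

text \<open>Normalise b to 0 in the target and a point outside the fibre to infinity in the source:
  the fibre becomes the root set of a numerator of degree exactly N, and local degrees become orders
  of roots.\<close>

lemma sum_ldeg_fibre: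
  assumes g: "rat_map N g" and N: "N \<ge> 1"
  shows "finite {x. g x = b}" "(\<Sum>x | g x = b. ldeg g x) = N"
proof -
  obtain u where u: "g u \<noteq> b" using rat_map_nonconst[OF assms] by blast
  obtain A where A: "mobius A" "A None = u" using mobius_transitive by blast
  obtain B where B: "mobius B" "B b = Some 0" using mobius_transitive by blast
  define h where "h = B \<circ> g \<circ> A"
  have h: "rat_map N h" "\<And>x. ldeg h x = ldeg g (A x)"
    unfolding h_def using ldeg_mobius_conj[OF g N A(1) B(1)] by auto
  have injB: "inj B" and bijA: "bij A" using mobius_bij A B bij_is_inj by auto
  have hz: "h x = Some 0 \<longleftrightarrow> g (A x) = b" for x
    using inj_eq[OF injB, of "g (A x)" b] B(2) by (simp add: h_def)
  obtain P Q where PQ: "reduced N P Q" "h = rat_fun P Q" using h(1) rat_map_iff by auto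
  have "coeff P N \<noteq> 0"
  proof
    assume c: "coeff P N = 0"
    have "h (proj 1 0) = proj (coeff P N) (coeff Q N)"
      using reduced_proj[OF PQ(1), of 1 0] PQ(2) by (simp add: hom_0_right)
    then have "h None = Some 0" using c reduced_coeffs[OF PQ(1)] by (simp add: proj_def)
    then show False using hz A(2) u by simp
  qed
  then have P: "P \<noteq> 0" "degree P = N" using reducedD(1)[OF PQ(1)] le_degree[of P N] by auto
  have none: "h None \<noteq> Some 0" using hz A(2) u by simp
  have some: "h (Some a) = Some 0 \<longleftrightarrow> poly P a = 0" for a
    using reduced_roots[OF PQ(1), of a] by (auto simp: PQ(2))
  have Z: "{x. h x = Some 0} = Some ` {a. poly P a = 0}"
  proof (rule set_eqI)
    fix x show "x \<in> {x. h x = Some 0} \<longleftrightarrow> x \<in> Some ` {a. poly P a = 0}"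
      using none some by (cases x) (auto simp del: rat_fun.simps)
  qed
  have im: "{x. g x = b} = A ` {x. h x = Some 0}"
    unfolding hz using surj_image_vimage_eq[OF bij_is_surj[OF bijA], of "{x. g x = b}"] by (simp add: vimage_def)
  have fin: "finite {a. poly P a = 0}" using poly_roots_finite[OF P(1)] .
  then show "finite {x. g x = b}" unfolding im Z by simp
  have "(\<Sum>x | g x = b. ldeg g x) = (\<Sum>x\<in>{x. h x = Some 0}. ldeg h x)"
    unfolding im using bijA by (subst sum.reindex) (auto simp: h(2) intro: inj_on_subset[OF bij_is_inj])
  also have "\<dots> = (\<Sum>a | poly P a = 0. ldeg h (Some a))"
    unfolding Z by (subst sum.reindex) auto
  also have "\<dots> = (\<Sum>a | poly P a = 0. order a P)"
  proof (rule sum.cong)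
    fix a assume "a \<in> {a. poly P a = 0}"
    then have a: "poly P a = 0" "poly Q a \<noteq> 0" using reduced_roots[OF PQ(1), of a] by auto
    then show "ldeg h (Some a) = order a P" using ldeg_Some(1)[OF PQ(1) N a(2)] PQ(2) by simp
  qed simp
  finally show "(\<Sum>x | g x = b. ldeg g x) = N" using sum_order_roots[OF P(1)] P(2) by simp
qed

section \<open>The Wronskian, whose zeros are the critical points\<close>

definition wronskian :: "complex poly \<Rightarrow> complex poly \<Rightarrow> complex poly" where
  "wronskian P Q = pderiv P * Q - P * pderiv Q"

lemma order_wronskian_aux:
  assumes "A \<noteq> 0" "poly A a = 0" "poly B a \<noteq> 0"
  shows "wronskian A B \<noteq> 0" "order a (wronskian A B) + 1 = order a A"
proof -
  define m where "m = order a A"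
  obtain T where T: "A = [:- a, 1:] ^ m * T" "\<not> [:- a, 1:] dvd T"
    using order_decomp[OF assms(1)] unfolding m_def by blast
  have Ta: "poly T a \<noteq> 0" using T(2) by (simp add: poly_eq_0_iff_dvd)
  have m: "m \<ge> 1" using assms(1,2) unfolding m_def by (simp add: order_root Suc_le_eq)
  define l where "l = [:- a, 1:]"
  have lm: "l ^ m = l ^ (m - 1) * l" using m by (metis Suc_diff_1 Suc_le_eq One_nat_def power_Suc2)
  have dl: "pderiv l = 1" by (simp add: l_def pderiv_pCons)
  \<comment> \<open>What remains of the Wronskian after the power m - 1 of the linear factor is
    removed; its value at a is m T(a) B(a), which is not 0.\<close>
  define U where "U = smult (of_nat m) (T * B) + l * (pderiv T * B - T * pderiv B)"
  have "pderiv A = smult (of_nat m) (l ^ (m - 1) * T) + l ^ m * pderiv T"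
    unfolding T(1) l_def[symmetric] pderiv_mult pderiv_power dl by (simp add: mult.commute)
  then have "wronskian A B = l ^ (m - 1) * U"
    unfolding wronskian_def T(1) l_def[symmetric] U_def lm by (simp add: algebra_simps)
  moreover have Ua: "poly U a \<noteq> 0" unfolding U_def l_def using Ta assms(3) m by simp
  moreover have "U \<noteq> 0" using Ua by auto
  ultimately have W: "wronskian A B = l ^ (m - 1) * U" "U \<noteq> 0" "order a U = 0" by (auto simp: order_0I)
  have l: "l ^ (m - 1) \<noteq> 0" by (simp add: l_def)
  show "wronskian A B \<noteq> 0" using W l by simp
  have "order a (wronskian A B) = m - 1"
    unfolding W(1) using order_mult[of "l ^ (m - 1)" U a] W l order_power_n_n[of a "m - 1"] by (simp add: l_def)
  then show "order a (wronskian A B) + 1 = order a A" using m by (simp add: m_def)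
qed

lemma wronskian_diff_smult: "wronskian (P - smult w Q) Q = wronskian P Q"
  unfolding wronskian_def pderiv_diff pderiv_smult
  by (simp only: left_diff_distrib mult_smult_left mult_smult_right mult.commute[of Q "pderiv Q"]) simp

lemma wronskian_swap: "wronskian Q P = - wronskian P Q"
  unfolding wronskian_def by (simp add: mult.commute)

text \<open>The Wronskian changes at most by a sign when P and Q are swapped or a multiple of Q is
  subtracted from P, so the value at a may be assumed to be 0, where
  \<open>order_wronskian_aux\<close> applies.\<close>

lemma order_wronskian:
  assumes r: "reduced N P Q" and N: "N \<ge> 1"
  shows "wronskian P Q \<noteq> 0" "order a (wronskian P Q) + 1 = ldeg (rat_fun P Q) (Some a)"
proof -
  have "wronskian P Q \<noteq> 0 \<and> order a (wronskian P Q) + 1 = ldeg (rat_fun P Q) (Some a)"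
  proof (cases "poly Q a = 0")
    case True
    then have P: "poly P a \<noteq> 0" using reduced_roots[OF r, of a] by auto
    have "Q \<noteq> 0" using reduced_indep[OF r N, of 1 0] by auto
    from order_wronskian_aux[OF this True P] show ?thesis
      using ldeg_Some(2)[OF r N True] unfolding wronskian_swap[of Q P] by simp
  next
    case False
    define w where "w = poly P a / poly Q a"
    have nz: "P - smult w Q \<noteq> 0" using reduced_indep[OF r N, of w 1] by simp
    have z: "poly (P - smult w Q) a = 0" using False by (simp add: w_def)
    from order_wronskian_aux[OF nz z False] show ?thesis
      using ldeg_Some(1)[OF r N False] unfolding wronskian_diff_smult by (simp add: w_def)
  qed
  then show "wronskian P Q \<noteq> 0" "order a (wronskian P Q) + 1 = ldeg (rat_fun P Q) (Some a)" by auto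
qed

lemma degree_pderiv_le: "degree P \<le> N \<Longrightarrow> degree (pderiv (P :: complex poly)) \<le> N - 1"
  by (simp add: degree_pderiv)

text \<open>A priori the degree is at most 2N - 1; the two contributions to that coefficient are
  both N times the product of the top coefficients and cancel.\<close>

lemma wronskian_coeff_top:
  assumes "degree P \<le> N" "degree Q \<le> N" "N \<ge> 1"
  shows "degree (wronskian P Q) \<le> 2 * N - 2"
proof -
  obtain M where M: "N = Suc M" using assms(3) by (cases N) auto
  have "degree (wronskian P Q) \<le> 2 * M + 1"
  proof -
    have "degree (pderiv P * Q) \<le> 2 * M + 1" "degree (P * pderiv Q) \<le> 2 * M + 1"
      using degree_mult_le[of "pderiv P" Q] degree_mult_le[of P "pderiv Q"]
        degree_pderiv_le[OF assms(1)] degree_pderiv_le[OF assms(2)] assms M by linarith+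
    then show ?thesis unfolding wronskian_def by (intro degree_diff_le)
  qed
  moreover have "coeff (wronskian P Q) (2 * M + 1) = 0"
  proof -
    have "coeff (pderiv P * Q) (M + N) = coeff (pderiv P) M * coeff Q N"
      using degree_pderiv_le[OF assms(1)] assms(2) M by (intro coeff_mult_le_degree) auto
    moreover have "coeff (P * pderiv Q) (N + M) = coeff P N * coeff (pderiv Q) M"
      using degree_pderiv_le[OF assms(2)] assms(1) M by (intro coeff_mult_le_degree) auto
    ultimately show ?thesis unfolding wronskian_def coeff_diff
      by (simp add: coeff_pderiv M mult_2)
  qed
  ultimately have "degree (wronskian P Q) < 2 * M + 1 \<or> wronskian P Q = 0"
    using leading_coeff_0_iff le_neq_implies_less by metis
  then show ?thesis using M by auto
qed

text \<open>The two contributions are N and N - 1 times the product on the right. This detects a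
  Wronskian of full degree once infinity is a simple preimage of infinity.\<close>

lemma wronskian_coeff_sub_top:
  assumes "degree P \<le> N" "degree Q \<le> N - 1" "N \<ge> 1"
  shows "coeff (wronskian P Q) (2 * N - 2) = coeff P N * coeff Q (N - 1)"
proof -
  obtain M where M: "N = Suc M" using assms(3) by (cases N) auto
  have 1: "coeff (pderiv P * Q) (M + M) = coeff (pderiv P) M * coeff Q M"
    using degree_pderiv_le[OF assms(1)] assms(2) M by (intro coeff_mult_le_degree) auto
  have 2: "coeff (P * pderiv Q) (M + M) = of_nat M * coeff P N * coeff Q M"
  proof (cases M)
    case 0
    then have "degree Q = 0" using assms(2) M by simp
    then have "pderiv Q = 0" by (simp add: pderiv_eq_0_iff)
    then show ?thesis using 0 by simp
  next
    case (Suc L)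
    have "coeff (P * pderiv Q) (N + L) = coeff P N * coeff (pderiv Q) L"
      using degree_pderiv_le[OF assms(2)] assms(1) M Suc by (intro coeff_mult_le_degree) auto
    moreover have "N + L = M + M" using M Suc by simp
    ultimately show ?thesis by (simp add: coeff_pderiv Suc)
  qed
  have "2 * N - 2 = M + M" using M by simp
  then show ?thesis unfolding wronskian_def coeff_diff
    by (simp only: 1 2 coeff_pderiv) (simp add: M algebra_simps)
qed

text \<open>Riemann-Hurwitz. A noncritical point and its value are both moved to infinity. Then the
  denominator has degree exactly N - 1 and the Wronskian degree exactly 2N - 2, so no critical point
  is hidden at infinity and the orders of the roots give the sum.\<close>

lemma sum_ldeg_critical:
  assumes g: "rat_map N g" and N: "N \<ge> 1"
  shows "finite {x. ldeg g x \<ge> 2}" "(\<Sum>x | ldeg g x \<ge> 2. ldeg g x - 1) = 2 * N - 2"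
proof -
  obtain P0 Q0 where PQ0: "reduced N P0 Q0" "g = rat_fun P0 Q0" using g rat_map_iff by auto
  have "finite {a. poly (wronskian P0 Q0) a = 0}"
    using order_wronskian(1)[OF PQ0(1) N] by (rule poly_roots_finite)
  then obtain u where u: "poly (wronskian P0 Q0) u \<noteq> 0"
    using ex_new_if_finite[OF infinite_UNIV_char_0] by blast
  have u1: "ldeg g (Some u) = 1" using order_wronskian(2)[OF PQ0(1) N, of u] PQ0(2) order_0I[OF u] by simp
  obtain A where A: "mobius A" "A None = Some u" using mobius_transitive by blast
  obtain B where B: "mobius B" "B (g (Some u)) = None" using mobius_transitive by blast
  define h where "h = B \<circ> g \<circ> A"
  have h: "rat_map N h" "\<And>x. ldeg h x = ldeg g (A x)"
    unfolding h_def using ldeg_mobius_conj[OF g N A(1) B(1)] by auto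
  have bijA: "bij A" using mobius_bij A by auto
  have hN: "h None = None" "ldeg h None = 1" using h(2) A(2) B(2) u1 by (auto simp: h_def)
  obtain P Q where PQ: "reduced N P Q" "h = rat_fun P Q" using h(1) rat_map_iff by auto
  have "h (proj 1 0) = proj (coeff P N) (coeff Q N)"
    using reduced_proj[OF PQ(1), of 1 0] PQ(2) by (simp add: hom_0_right)
  then have cQ: "coeff Q N = 0" using hN(1) by (auto simp: proj_def split: if_splits)
  then have cP: "coeff P N \<noteq> 0" using reduced_coeffs[OF PQ(1)] by simp
  have Q0: "Q \<noteq> 0" using reduced_indep[OF PQ(1) N, of 1 0] by auto
  have mx: "max (degree P) (degree Q) = N" using PQ(1) by (simp add: reduced_iff)
  have "ldeg h None = order 0 (monom 1 (N - degree Q) * reflect_poly Q)"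
    using hN(1) unfolding PQ(2) ldeg_eq_pq_ldeg[OF PQ(1) N] pq_ldeg_def Let_def mx by simp
  also have "\<dots> = N - degree Q"
  proof -
    have "order 0 (reflect_poly Q) = 0" using Q0 by (intro order_0I) (simp add: poly_0_coeff_0)
    then show ?thesis using Q0 by (subst order_mult) (auto simp: monom_eq_0_iff)
  qed
  finally have dQ: "degree Q = N - 1" using hN(2) N by linarith
  define W where "W = wronskian P Q"
  have "coeff W (2 * N - 2) \<noteq> 0" unfolding W_def
    using wronskian_coeff_sub_top[of P N Q] reducedD(1)[OF PQ(1)] dQ N cP Q0 by (metis leading_coeff_0_iff le_refl mult_eq_0_iff)
  then have dW: "degree W = 2 * N - 2"
    using wronskian_coeff_top[OF reducedD(1,2)[OF PQ(1)] N] le_degree unfolding W_def by (meson order_antisym)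
  have W: "W \<noteq> 0" "\<And>a. order a W + 1 = ldeg h (Some a)"
    unfolding W_def using order_wronskian[OF PQ(1) N] PQ(2) by auto
  have some: "ldeg h (Some a) \<ge> 2 \<longleftrightarrow> poly W a = 0" for a
    using W(2)[of a] W(1) order_root[of W a] by linarith
  have Z: "{x. ldeg h x \<ge> 2} = Some ` {a. poly W a = 0}"
  proof (rule set_eqI)
    fix x show "x \<in> {x. ldeg h x \<ge> 2} \<longleftrightarrow> x \<in> Some ` {a. poly W a = 0}"
      using hN(2) some by (cases x) auto
  qed
  have im: "{x. ldeg g x \<ge> 2} = A ` {x. ldeg h x \<ge> 2}"
    unfolding h(2) using surj_image_vimage_eq[OF bij_is_surj[OF bijA], of "{x. ldeg g x \<ge> 2}"] by (simp add: vimage_def)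
  have fin: "finite {a. poly W a = 0}" using poly_roots_finite[OF W(1)] .
  then show "finite {x. ldeg g x \<ge> 2}" unfolding im Z by simp
  have "(\<Sum>x | ldeg g x \<ge> 2. ldeg g x - 1) = (\<Sum>x\<in>{x. ldeg h x \<ge> 2}. ldeg h x - 1)"
    unfolding im using bijA by (subst sum.reindex) (auto simp: h(2) intro: inj_on_subset[OF bij_is_inj])
  also have "\<dots> = (\<Sum>a | poly W a = 0. ldeg h (Some a) - 1)"
    unfolding Z by (subst sum.reindex) auto
  also have "\<dots> = (\<Sum>a | poly W a = 0. order a W)"
    using W(2) by (intro sum.cong) (auto simp flip: W(2))
  finally show "(\<Sum>x | ldeg g x \<ge> 2. ldeg g x - 1) = 2 * N - 2" using sum_order_roots[OF W(1)] dW by simp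
qed

section \<open>Limits of rational maps at a vertex\<close>

lemma tendsto_coeff_mult:
  fixes A B :: "nat \<Rightarrow> complex poly"
  assumes "\<And>i. (\<lambda>n. coeff (A n) i) \<longlonglongrightarrow> coeff A0 i" "\<And>i. (\<lambda>n. coeff (B n) i) \<longlonglongrightarrow> coeff B0 i"
  shows "(\<lambda>n. coeff (A n * B n) i) \<longlonglongrightarrow> coeff (A0 * B0) i"
  unfolding coeff_mult by (intro tendsto_intros assms)

lemma tendsto_coeff_power:
  fixes A :: "nat \<Rightarrow> complex poly"
  assumes "\<And>i. (\<lambda>n. coeff (A n) i) \<longlonglongrightarrow> coeff A0 i"
  shows "(\<lambda>n. coeff (A n ^ k) i) \<longlonglongrightarrow> coeff (A0 ^ k) i"
proof (induction k arbitrary: i)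
  case (Suc k)
  then show ?case unfolding power_Suc by (intro tendsto_coeff_mult assms)
qed simp

lemma tendsto_coeff_prod:
  fixes A :: "nat \<Rightarrow> 'b \<Rightarrow> complex poly"
  assumes "\<And>a i. a \<in> S \<Longrightarrow> (\<lambda>n. coeff (A n a) i) \<longlonglongrightarrow> coeff (A0 a) i"
  shows "(\<lambda>n. coeff (\<Prod>a\<in>S. A n a) i) \<longlonglongrightarrow> coeff (\<Prod>a\<in>S. A0 a) i"
  using assms
proof (induction S arbitrary: i rule: infinite_finite_induct)
  case (insert x S)
  have "(\<lambda>n. coeff (A n x * (\<Prod>a\<in>S. A n a)) i) \<longlonglongrightarrow> coeff (A0 x * (\<Prod>a\<in>S. A0 a)) i"
    by (rule tendsto_coeff_mult) (use insert in auto)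
  then show ?case using insert by simp
qed auto

lemma tendsto_coeff_linear:
  assumes "r \<longlonglongrightarrow> (r0 :: complex)"
  shows "(\<lambda>n. coeff [:- r n, 1:] i) \<longlonglongrightarrow> coeff [:- r0, 1:] i"
  using assms by (cases i) (auto intro!: tendsto_intros)

section \<open>Polynomials with prescribed roots, and their limits\<close>

abbreviation lprod :: "('b \<Rightarrow> complex) \<Rightarrow> ('b \<Rightarrow> nat) \<Rightarrow> 'b set \<Rightarrow> complex poly" where
  "lprod r k S \<equiv> (\<Prod>a\<in>S. [:- r a, 1:] ^ k a)"

lemma lprod_monic: "lead_coeff (lprod r k S) = 1" "degree (lprod r k S) = (\<Sum>a\<in>S. k a)"
proof -
  show "lead_coeff (lprod r k S) = 1" by (simp add: lead_coeff_prod lead_coeff_power)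
  show "degree (lprod r k S) = (\<Sum>a\<in>S. k a)"
    by (subst degree_prod_sum_eq) (auto simp: degree_linear_power)
qed

lemma order_lprod:
  assumes "finite S" shows "order h (lprod r k S) = (\<Sum>a\<in>{a\<in>S. r a = h}. k a)"
  using assms
proof (induction S rule: finite_induct)
  case (insert x S)
  have "order h ([:- r x, 1:] ^ k x) = (if r x = h then k x else 0)"
    using order_power_n_n[of h "k x"] by (auto intro!: order_0I)
  moreover have "order h (lprod r k (insert x S)) = order h ([:- r x, 1:] ^ k x) + order h (lprod r k S)"
    using insert by (simp add: order_mult)
  moreover have "{a \<in> insert x S. r a = h} = (if r x = h then insert x {a\<in>S. r a = h} else {a\<in>S. r a = h})" by auto
  ultimately show ?case using insert by auto
qed simp

lemma coprime_linear:
  assumes "r \<noteq> (s::complex)" shows "coprime [:- r, 1:] [:- s, 1:]"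
proof (rule coprimeI)
  fix c assume "c dvd [:- r, 1:]" "c dvd [:- s, 1:]"
  then have "c dvd [:- r, 1:] - [:- s, 1:]" by (rule dvd_diff)
  then have "c dvd [:s - r:]" by simp
  moreover have "is_unit [:s - r:]" using assms by (simp add: is_unit_pCons_iff)
  ultimately show "is_unit c" using dvd_trans by blast
qed

lemma lprod_dvd:
  assumes "finite S" "inj_on r S" "\<And>a. a \<in> S \<Longrightarrow> [:- r a, 1:] ^ k a dvd R"
  shows "lprod r k S dvd R"
  using assms
proof (induction S rule: finite_induct)
  case (insert x S)
  have "coprime ([:- r x, 1:] ^ k x) (lprod r k S)"
  proof (rule prod_coprime_right)
    fix a assume "a \<in> S"
    then have "r x \<noteq> r a" using insert by (auto simp: inj_on_def)
    then show "coprime ([:- r x, 1:] ^ k x) ([:- r a, 1:] ^ k a)" by (intro coprime_power_left_iff[THEN iffD2] coprime_power_right_iff[THEN iffD2] disjI1 coprime_linear)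
  qed
  then show ?case using insert by (simp add: divides_mult)
qed simp

lemma monic_dvd_eq:
  fixes R D :: "complex poly"
  assumes "lead_coeff D = 1" "D dvd R" "degree R \<le> degree D"
  shows "R = smult (coeff R (degree D)) D"
proof -
  obtain S where S: "R = D * S" using assms(2) by blast
  have D: "D \<noteq> 0" using assms(1) by auto
  have "degree S = 0"
  proof (cases "S = 0")
    case False
    then have "degree R = degree D + degree S" using S D by (simp add: degree_mult_eq)
    then show ?thesis using assms(3) by simp
  qed simp
  then obtain c where c: "S = [:c:]" by (rule degree_eq_zeroE)
  then have "R = smult c D" using S by simp
  then show ?thesis using assms(1) by simp
qed

text \<open>Roots and coefficients converge separately, so a factorisation over marked points
  survives in the limit even when roots merge.\<close>

lemma lprod_limit:
  assumes R: "\<And>n. R n = smult (coeff (R n) D) (lprod (r n) k S)"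
    and r: "\<And>a. a \<in> S \<Longrightarrow> (\<lambda>n. r n a) \<longlonglongrightarrow> r0 a"
    and c: "\<And>i. (\<lambda>n. coeff (R n) i) \<longlonglongrightarrow> coeff R0 i"
  shows "R0 = smult (coeff R0 D) (lprod r0 k S)"
proof (rule poly_eqI)
  fix i
  have "(\<lambda>n. coeff (R n) D * coeff (lprod (r n) k S) i) \<longlonglongrightarrow> coeff R0 D * coeff (lprod r0 k S) i"
    by (intro tendsto_mult c tendsto_coeff_prod tendsto_coeff_power tendsto_coeff_linear r)
  moreover have "coeff (R n) D * coeff (lprod (r n) k S) i = coeff (R n) i" for n
    using arg_cong[OF R[of n], of "\<lambda>x. coeff x i"] by simp
  ultimately have "(\<lambda>n. coeff (R n) i) \<longlonglongrightarrow> coeff R0 D * coeff (lprod r0 k S) i" by simp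
  from LIMSEQ_unique[OF c this] show "coeff R0 i = coeff (smult (coeff R0 D) (lprod r0 k S)) i" by simp
qed

text \<open>A common factor enters squared: a hole of order k absorbs 2k critical points.\<close>

lemma wronskian_mult: "wronskian (H * P) (H * Q) = H\<^sup>2 * wronskian P Q"
  unfolding wronskian_def pderiv_mult by algebra

lemma tendsto_coeff_wronskian:
  assumes "\<And>i. (\<lambda>n. coeff (A n) i) \<longlonglongrightarrow> coeff A0 i" "\<And>i. (\<lambda>n. coeff (B n) i) \<longlonglongrightarrow> coeff B0 i"
  shows "(\<lambda>n. coeff (wronskian (A n) (B n)) i) \<longlonglongrightarrow> coeff (wronskian A0 B0) i"
proof -
  have "(\<lambda>n. coeff (pderiv (A n)) i) \<longlonglongrightarrow> coeff (pderiv A0) i" "(\<lambda>n. coeff (pderiv (B n)) i) \<longlonglongrightarrow> coeff (pderiv B0) i" for i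
    unfolding coeff_pderiv by (rule tendsto_mult_left[OF assms(1)], rule tendsto_mult_left[OF assms(2)])
  then show ?thesis unfolding wronskian_def coeff_diff
    by (intro tendsto_diff tendsto_coeff_mult[OF _ assms(2)] tendsto_coeff_mult[OF assms(1)])
qed

text \<open>One vertex of the source tree. The pair \<open>p n\<close>, \<open>q n\<close> is the
  n-th map read in a source and a target chart; \<open>eta\<close> and \<open>zeta\<close> are the
  marked points in these charts, all finite. Independence of P and Q makes the limit nonconstant,
  but they may have common zeros, the holes.\<close>

locale vertex_limit =
  fixes d :: nat and Y Z :: "nat set" and F deg :: "nat \<Rightarrow> nat"
    and p q :: "nat \<Rightarrow> complex poly" and eta zeta :: "nat \<Rightarrow> nat \<Rightarrow> complex"
    and P Q :: "complex poly" and eta0 zeta0 :: "nat \<Rightarrow> complex"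
  assumes d: "d \<ge> 1" and portrait: "portrait d Y Z F deg" and Zne: "Z \<noteq> {}"
    and red: "\<And>n. reduced d (p n) (q n)"
    and val: "\<And>n a. a \<in> Y \<Longrightarrow> rat_fun (p n) (q n) (Some (eta n a)) = Some (zeta n (F a))"
    and ldg: "\<And>n a. a \<in> Y \<Longrightarrow> ldeg (rat_fun (p n) (q n)) (Some (eta n a)) = deg a"
    and inj: "\<And>n. inj_on (eta n) Y"
    and lim_p: "\<And>i. (\<lambda>n. coeff (p n) i) \<longlonglongrightarrow> coeff P i"
    and lim_q: "\<And>i. (\<lambda>n. coeff (q n) i) \<longlonglongrightarrow> coeff Q i"
    and indep: "\<And>\<alpha> \<beta>. \<alpha> \<noteq> 0 \<or> \<beta> \<noteq> 0 \<Longrightarrow> smult \<beta> P - smult \<alpha> Q \<noteq> 0"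
    and lim_eta: "\<And>a. a \<in> Y \<Longrightarrow> (\<lambda>n. eta n a) \<longlonglongrightarrow> eta0 a"
    and lim_zeta: "\<And>b. b \<in> Z \<Longrightarrow> (\<lambda>n. zeta n b) \<longlonglongrightarrow> zeta0 b"
begin

lemma finY: "finite Y" and finZ: "finite Z"
  and deg_pos: "a \<in> Y \<Longrightarrow> deg a \<ge> 1" and sum_crit: "(\<Sum>a\<in>Y. deg a - 1) = 2 * d - 2"
  and sum_fib: "b \<in> Z \<Longrightarrow> (\<Sum>a\<in>{a\<in>Y. F a = b}. deg a) = d"
  using portrait by (auto simp: portrait_def)

text \<open>The marked points over b, with their local degrees, exhaust the degree d, so the
  quotient by their product is a constant. This is where the fibre sums of the portrait
  enter.\<close>

lemma fibre_poly:
  assumes b: "b \<in> Z"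
  defines "R \<equiv> \<lambda>n. p n - smult (zeta n b) (q n)"
  shows "R n = smult (coeff (R n) d) (lprod (eta n) deg {a\<in>Y. F a = b})"
proof -
  have nz: "R n \<noteq> 0" using reduced_indep[OF red d, of "zeta n b" 1] by (simp add: R_def)
  have "[:- eta n a, 1:] ^ deg a dvd R n" if a: "a \<in> Y" "F a = b" for a
  proof -
    have q: "poly (q n) (eta n a) \<noteq> 0" "poly (p n) (eta n a) / poly (q n) (eta n a) = zeta n b"
      using val[OF a(1), of n] a(2) by (auto split: if_splits)
    then have "deg a = order (eta n a) (R n)"
      using ldg[OF a(1), of n] ldeg_Some(1)[OF red d q(1)] by (simp add: R_def)
    then show ?thesis using order_1 by metis
  qed
  then have dvd: "lprod (eta n) deg {a\<in>Y. F a = b} dvd R n"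
    using finY inj by (intro lprod_dvd) (auto intro: inj_on_subset)
  have "degree (R n) \<le> d" unfolding R_def using reducedD(1,2)[OF red]
    by (intro degree_diff_le order.trans[OF degree_smult_le])
  then show ?thesis
    using monic_dvd_eq[OF lprod_monic(1) dvd] by (simp add: lprod_monic(2) sum_fib[OF b])
qed

text \<open>As in \<open>fibre_poly\<close>, with the total 2d - 2 of the critical points in place
  of d.\<close>

lemma wronskian_poly:
  "wronskian (p n) (q n) = smult (coeff (wronskian (p n) (q n)) (2 * d - 2)) (lprod (eta n) (\<lambda>a. deg a - 1) Y)"
proof -
  have "[:- eta n a, 1:] ^ (deg a - 1) dvd wronskian (p n) (q n)" if a: "a \<in> Y" for a
  proof -
    have "deg a - 1 = order (eta n a) (wronskian (p n) (q n))"
      using order_wronskian(2)[OF red[of n] d, of "eta n a"] ldg[OF a, of n] by simp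
    then show ?thesis using order_1 by metis
  qed
  then have dvd: "lprod (eta n) (\<lambda>a. deg a - 1) Y dvd wronskian (p n) (q n)"
    using finY inj by (intro lprod_dvd) auto
  then show ?thesis using wronskian_coeff_top[OF reducedD(1,2)[OF red[of n]] d]
    using monic_dvd_eq[OF lprod_monic(1) dvd] by (simp only: lprod_monic(2) sum_crit)
qed

text \<open>If the coefficient at d vanished, the factorisation would make the whole combination of
  P and Q vanish, against their independence.\<close>

lemma fibre_poly_limit:
  assumes b: "b \<in> Z"
  defines "R \<equiv> P - smult (zeta0 b) Q"
  shows "R = smult (coeff R d) (lprod eta0 deg {a\<in>Y. F a = b})" "coeff R d \<noteq> 0"
proof -
  show e: "R = smult (coeff R d) (lprod eta0 deg {a\<in>Y. F a = b})"
  proof (rule lprod_limit[OF fibre_poly[OF b]])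
    fix i show "(\<lambda>n. coeff (p n - smult (zeta n b) (q n)) i) \<longlonglongrightarrow> coeff R i"
      unfolding R_def coeff_diff coeff_smult by (intro tendsto_intros lim_p lim_q lim_zeta b)
  qed (use lim_eta in auto)
  have "R \<noteq> 0" using indep[of "zeta0 b" 1] by (simp add: R_def)
  then show "coeff R d \<noteq> 0" using e by auto
qed

lemma wronskian_poly_limit:
  "wronskian P Q = smult (coeff (wronskian P Q) (2 * d - 2)) (lprod eta0 (\<lambda>a. deg a - 1) Y)"
  by (rule lprod_limit[OF wronskian_poly lim_eta tendsto_coeff_wronskian[OF lim_p lim_q]])

lemma degP: "degree P \<le> d" and degQ: "degree Q \<le> d"
proof -
  have "coeff P i = 0" if "i > d" for i
  proof -
    have "coeff (p n) i = 0" for n using reducedD(1)[OF red, of n] that by (intro coeff_eq_0) simp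
    then show ?thesis using lim_p[of i] by (simp add: LIMSEQ_const_iff)
  qed
  then show "degree P \<le> d" by (intro degree_le) auto
  have "coeff Q i = 0" if "i > d" for i
  proof -
    have "coeff (q n) i = 0" for n using reducedD(2)[OF red, of n] that by (intro coeff_eq_0) simp
    then show ?thesis using lim_q[of i] by (simp add: LIMSEQ_const_iff)
  qed
  then show "degree Q \<le> d" by (intro degree_le) auto
qed

text \<open>Its roots are the holes, where convergence may fail and part of the degree is
  concentrated.\<close>

definition H :: "complex poly" where "H = gcd P Q"
definition p0 :: "complex poly" where "p0 = P div H"
definition q0 :: "complex poly" where "q0 = Q div H"
definition e :: nat where "e = max (degree p0) (degree q0)"
definition g :: "cs \<Rightarrow> cs" where "g = rat_fun p0 q0"

lemma PQ_ne: "P \<noteq> 0 \<or> Q \<noteq> 0"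
  using indep[of 0 1] by auto

lemma H_ne: "H \<noteq> 0" using PQ_ne by (simp add: H_def)

lemma P_eq: "P = H * p0" and Q_eq: "Q = H * q0"
  by (simp_all add: p0_def q0_def H_def)

lemma red0: "reduced e p0 q0"
  unfolding reduced_iff e_def p0_def q0_def H_def using PQ_ne div_gcd_coprime by auto

lemma e_pos: "e \<ge> 1"
proof (rule ccontr)
  assume "\<not> ?thesis"
  then have "degree p0 = 0" "degree q0 = 0" by (auto simp: e_def)
  then obtain \<alpha> \<beta> where ab: "p0 = [:\<alpha>:]" "q0 = [:\<beta>:]" by (meson degree_eq_zeroE)
  then have "\<alpha> \<noteq> 0 \<or> \<beta> \<noteq> 0" using reduced_roots[OF red0] by auto
  moreover have "smult \<beta> (H * p0) - smult \<alpha> (H * q0) = 0" unfolding ab by (simp add: mult.commute)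
  then have "smult \<beta> P - smult \<alpha> Q = 0" by (simp only: P_eq[symmetric] Q_eq[symmetric])
  ultimately show False using indep by blast
qed

lemma rat_map_g: "rat_map e g"
  using red0 rat_map_iff g_def by blast

lemma fibre_factor: "P - smult c Q = H * (p0 - smult c q0)"
  by (simp add: right_diff_distrib flip: P_eq Q_eq)

lemma fibre_factor_ne: "p0 - smult c q0 \<noteq> 0"
  using reduced_indep[OF red0 e_pos, of c 1] by simp

text \<open>No degree escapes to infinity: for a marked value the fibre polynomial has degree
  exactly d in the limit. So d splits into the degree of the limit map and the total order of the
  holes.\<close>

lemma degree_H: "degree H + e = d"
proof -
  obtain b where b: "b \<in> Z" using Zne by blast
  have "degree (P - smult (zeta0 b) Q) = d"
  proof (rule order_antisym)
    show "degree (P - smult (zeta0 b) Q) \<le> d" using degP degQ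
      by (intro degree_diff_le order.trans[OF degree_smult_le])
    show "d \<le> degree (P - smult (zeta0 b) Q)" using fibre_poly_limit(2)[OF b] by (rule le_degree)
  qed
  then have "d = degree H + degree (p0 - smult (zeta0 b) q0)"
    unfolding fibre_factor using H_ne fibre_factor_ne by (simp add: degree_mult_eq)
  moreover have "degree (p0 - smult (zeta0 b) q0) \<le> e"
    by (intro degree_diff_le order.trans[OF degree_smult_le]) (auto simp: e_def)
  ultimately have "d \<le> degree H + e" by simp
  moreover have "degree H + e \<le> d"
  proof (cases "degree p0 \<ge> degree q0")
    case True
    then have "p0 \<noteq> 0" using e_pos by (auto simp: e_def)
    moreover have "degree (H * p0) \<le> d" using degP by (simp only: P_eq[symmetric])
    ultimately show ?thesis using H_ne True by (simp add: degree_mult_eq e_def)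
  next
    case False
    then have "q0 \<noteq> 0" by auto
    moreover have "degree (H * q0) \<le> d" using degQ by (simp only: Q_eq[symmetric])
    ultimately show ?thesis using H_ne False by (simp add: degree_mult_eq e_def)
  qed
  ultimately show ?thesis by simp
qed

text \<open>The order at h is computed twice: from the product over the marked points, where those
  merging at h contribute their degrees, and from the factorisation into the hole part and the fibre
  equation of the limit map.\<close>

lemma count_fibre:
  assumes b: "b \<in> Z"
  shows "(\<Sum>a\<in>{a\<in>Y. eta0 a = h \<and> F a = b}. deg a) =
    order h H + (if g (Some h) = Some (zeta0 b) then ldeg g (Some h) else 0)"
proof -
  define R where "R = P - smult (zeta0 b) Q"
  have "order h R = order h (smult (coeff R d) (lprod eta0 deg {a\<in>Y. F a = b}))"
    using fibre_poly_limit(1)[OF b] unfolding R_def[symmetric] by (rule arg_cong)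
  also have "\<dots> = order h (lprod eta0 deg {a\<in>Y. F a = b})"
    using fibre_poly_limit(2)[OF b] unfolding R_def[symmetric] by (rule order_smult)
  also have "\<dots> = (\<Sum>a\<in>{a\<in>{a\<in>Y. F a = b}. eta0 a = h}. deg a)" using finY by (simp add: order_lprod)
  also have "{a\<in>{a\<in>Y. F a = b}. eta0 a = h} = {a\<in>Y. eta0 a = h \<and> F a = b}" by auto
  finally have 1: "(\<Sum>a\<in>{a\<in>Y. eta0 a = h \<and> F a = b}. deg a) = order h R" by simp
  have 2: "order h R = order h H + order h (p0 - smult (zeta0 b) q0)"
    unfolding R_def fibre_factor using H_ne fibre_factor_ne by (simp add: order_mult)
  have 3: "order h (p0 - smult (zeta0 b) q0) = (if g (Some h) = Some (zeta0 b) then ldeg g (Some h) else 0)"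
  proof (cases "poly q0 h = 0")
    case True
    then have "poly p0 h \<noteq> 0" using reduced_roots[OF red0, of h] by auto
    then show ?thesis using True by (simp add: g_def order_0I)
  next
    case False
    show ?thesis
    proof (cases "poly p0 h / poly q0 h = zeta0 b")
      case True
      then show ?thesis using False ldeg_Some(1)[OF red0 e_pos False] by (simp add: g_def)
    next
      case f: False
      then have "poly (p0 - smult (zeta0 b) q0) h \<noteq> 0" using False by (auto simp: field_simps)
      then show ?thesis using False f by (simp add: g_def order_0I)
    qed
  qed
  show ?thesis using 1 2 3 by simp
qed

lemma ldeg_g_pos: "ldeg g x \<ge> 1"
  using ldeg_pos[OF rat_map_g e_pos] .

text \<open>The same double count for the Wronskian, where the holes enter twice.\<close>

lemma count_critical:
  "(\<Sum>a\<in>{a\<in>Y. eta0 a = h}. deg a - 1) = 2 * order h H + (ldeg g (Some h) - 1)"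
proof -
  have W: "wronskian P Q = H\<^sup>2 * wronskian p0 q0" 
    using wronskian_mult[of H p0 q0] by (simp only: P_eq[symmetric] Q_eq[symmetric])
  have ne: "wronskian p0 q0 \<noteq> 0" "wronskian P Q \<noteq> 0" using order_wronskian(1)[OF red0 e_pos] H_ne W by auto
  have "order h (wronskian P Q) = 2 * order h H + order h (wronskian p0 q0)"
    unfolding W power2_eq_square using H_ne ne by (simp add: order_mult)
  moreover have "order h (wronskian p0 q0) = ldeg g (Some h) - 1"
    using order_wronskian(2)[OF red0 e_pos, of h] by (simp add: g_def)
  moreover have "coeff (wronskian P Q) (2 * d - 2) \<noteq> 0" using wronskian_poly_limit ne(2) by auto
  then have "order h (wronskian P Q) = order h (lprod eta0 (\<lambda>a. deg a - 1) Y)"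
    by (rule trans[OF arg_cong[OF wronskian_poly_limit, of "order h"] order_smult])
  ultimately show ?thesis using order_lprod[OF finY] by simp
qed

text \<open>A hole covers every value, so marked points over any marked value accumulate
  there.\<close>

lemma roots_H: "poly H h = 0 \<Longrightarrow> h \<in> eta0 ` Y"
proof -
  assume "poly H h = 0"
  then have "order h H \<noteq> 0" using H_ne order_root by blast
  moreover obtain b where b: "b \<in> Z" using Zne by blast
  ultimately have "(\<Sum>a\<in>{a\<in>Y. eta0 a = h \<and> F a = b}. deg a) \<noteq> 0" using count_fibre[OF b, of h] by simp
  then have "{a\<in>Y. eta0 a = h \<and> F a = b} \<noteq> {}" by (metis sum.empty)
  then show ?thesis by auto
qed

lemma sum_order_H: "(\<Sum>h\<in>eta0 ` Y. order h H) = degree H"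
proof -
  have "(\<Sum>h\<in>eta0 ` Y. order h H) = (\<Sum>h | poly H h = 0. order h H)"
    by (rule sum.mono_neutral_right) (use finY roots_H H_ne in \<open>auto simp: order_root\<close>)
  then show ?thesis using sum_order_roots[OF H_ne] by simp
qed

lemma sum_critical_limit: "(\<Sum>h\<in>eta0 ` Y. ldeg g (Some h) - 1) = 2 * e - 2"
proof -
  have "2 * d - 2 = (\<Sum>h\<in>eta0 ` Y. \<Sum>a\<in>{a\<in>Y. eta0 a = h}. deg a - 1)"
    using sum.image_gen[OF finY, of "\<lambda>a. deg a - 1" eta0] sum_crit by simp
  also have "\<dots> = 2 * degree H + (\<Sum>h\<in>eta0 ` Y. ldeg g (Some h) - 1)"
    unfolding count_critical sum.distrib sum_order_H[symmetric] by (simp add: sum_distrib_left)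
  finally show ?thesis using degree_H e_pos by linarith
qed

lemma sum_fibre_limit:
  assumes b: "b \<in> Z"
  shows "(\<Sum>h\<in>{h\<in>eta0 ` Y. g (Some h) = Some (zeta0 b)}. ldeg g (Some h)) = e"
proof -
  have "d = (\<Sum>h\<in>eta0 ` Y. \<Sum>a\<in>{a\<in>Y. eta0 a = h \<and> F a = b}. deg a)"
  proof -
    have "d = (\<Sum>h\<in>eta0 ` {a\<in>Y. F a = b}. \<Sum>a\<in>{a\<in>{a\<in>Y. F a = b}. eta0 a = h}. deg a)"
      using sum.image_gen[of "{a\<in>Y. F a = b}" deg eta0] finY sum_fib[OF b] by simp
    also have "\<dots> = (\<Sum>h\<in>eta0 ` Y. \<Sum>a\<in>{a\<in>{a\<in>Y. F a = b}. eta0 a = h}. deg a)"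
    proof (rule sum.mono_neutral_left)
      show "\<forall>h\<in>eta0 ` Y - eta0 ` {a\<in>Y. F a = b}. (\<Sum>a\<in>{a\<in>{a\<in>Y. F a = b}. eta0 a = h}. deg a) = 0"
      proof
        fix h assume "h \<in> eta0 ` Y - eta0 ` {a\<in>Y. F a = b}"
        then have "h \<notin> eta0 ` {a\<in>Y. F a = b}" by simp
        then have "{a\<in>{a\<in>Y. F a = b}. eta0 a = h} = {}"
          by (metis (mono_tags, lifting) Collect_empty_eq imageI)
        then show "(\<Sum>a\<in>{a\<in>{a\<in>Y. F a = b}. eta0 a = h}. deg a) = 0" by (simp only: sum.empty)
      qed
    qed (use finY in auto)
    also have "\<dots> = (\<Sum>h\<in>eta0 ` Y. \<Sum>a\<in>{a\<in>Y. eta0 a = h \<and> F a = b}. deg a)"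
      by (intro sum.cong refl) auto
    finally show ?thesis .
  qed
  also have "\<dots> = degree H + (\<Sum>h\<in>eta0 ` Y. if g (Some h) = Some (zeta0 b) then ldeg g (Some h) else 0)"
    unfolding count_fibre[OF b] sum.distrib sum_order_H ..
  also have "(\<Sum>h\<in>eta0 ` Y. if g (Some h) = Some (zeta0 b) then ldeg g (Some h) else 0)
      = (\<Sum>h\<in>{h\<in>eta0 ` Y. g (Some h) = Some (zeta0 b)}. ldeg g (Some h))"
    using finY by (simp add: sum.inter_filter)
  finally show ?thesis using degree_H by simp
qed

text \<open>The limits of marked points already carry the full degree e over this value; a further
  preimage would exceed it.\<close>

lemma fibre_in_limit:
  assumes "b \<in> Z" "g x = Some (zeta0 b)" shows "x \<in> Some ` eta0 ` Y"
proof (rule ccontr)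
  assume x: "x \<notin> Some ` eta0 ` Y"
  define S where "S = {h\<in>eta0 ` Y. g (Some h) = Some (zeta0 b)}"
  have fin: "finite {x. g x = Some (zeta0 b)}" and s: "(\<Sum>x | g x = Some (zeta0 b). ldeg g x) = e"
    using sum_ldeg_fibre[OF rat_map_g e_pos] by blast+
  have "(\<Sum>y\<in>insert x (Some ` S). ldeg g y) \<le> (\<Sum>x | g x = Some (zeta0 b). ldeg g x)"
    using fin assms by (intro sum_mono2) (auto simp: S_def)
  moreover have "(\<Sum>y\<in>insert x (Some ` S). ldeg g y) = ldeg g x + (\<Sum>h\<in>S. ldeg g (Some h))"
    using x finY by (subst sum.insert) (auto simp: S_def sum.reindex)
  ultimately show False using s sum_fibre_limit[OF assms(1)] ldeg_g_pos[of x] by (simp add: S_def)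
qed

text \<open>The limits of marked points already use up the Riemann-Hurwitz total 2e - 2.\<close>

lemma critical_in_limit:
  assumes "x \<notin> Some ` eta0 ` Y" shows "ldeg g x = 1"
proof (rule ccontr)
  assume "ldeg g x \<noteq> 1"
  then have x: "ldeg g x \<ge> 2" using ldeg_g_pos[of x] by simp
  have fin: "finite {x. ldeg g x \<ge> 2}" and s: "(\<Sum>x | ldeg g x \<ge> 2. ldeg g x - 1) = 2 * e - 2"
    using sum_ldeg_critical[OF rat_map_g e_pos] by blast+
  have "(\<Sum>y\<in>insert x (Some ` eta0 ` Y). ldeg g y - 1) = (ldeg g x - 1) + (\<Sum>h\<in>eta0 ` Y. ldeg g (Some h) - 1)"
    using assms finY by (subst sum.insert) (auto simp: sum.reindex)
  moreover have "(\<Sum>y\<in>insert x (Some ` eta0 ` Y). ldeg g y - 1) \<le> (\<Sum>x\<in>{x. ldeg g x \<ge> 2} \<union> insert x (Some ` eta0 ` Y). ldeg g x - 1)"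
    using fin finY by (intro sum_mono2) auto
  moreover have "(\<Sum>x\<in>{x. ldeg g x \<ge> 2} \<union> insert x (Some ` eta0 ` Y). ldeg g x - 1) = (\<Sum>x | ldeg g x \<ge> 2. ldeg g x - 1)"
    using fin finY by (intro sum.mono_neutral_right) auto
  ultimately show False using s sum_critical_limit x by simp
qed

text \<open>Away from the limits of marked points the common factor is nonzero, at infinity because
  of its exact degree, and so it cancels in homogeneous coordinates.\<close>

lemma hom_limit:
  assumes "s \<noteq> 0 \<or> t \<noteq> 0" "proj s t \<notin> Some ` eta0 ` Y"
  shows "hom d P s t \<noteq> 0 \<or> hom d Q s t \<noteq> 0" "g (proj s t) = proj (hom d P s t) (hom d Q s t)"
proof -
  have h: "hom (degree H) H s t \<noteq> 0"
  proof (cases "t = 0")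
    case True
    then show ?thesis using assms(1) H_ne by (simp add: hom_0_right)
  next
    case False
    then have "poly H (s / t) \<noteq> 0" using roots_H assms(2) by (auto simp: proj_def)
    then show ?thesis using False by (simp add: hom_eq_poly)
  qed
  have P: "hom d P s t = hom (degree H) H s t * hom e p0 s t"
    using hom_mult[OF order_refl reducedD(1)[OF red0], of H] by (simp add: degree_H flip: P_eq)
  have Q: "hom d Q s t = hom (degree H) H s t * hom e q0 s t"
    using hom_mult[OF order_refl reducedD(2)[OF red0], of H] by (simp add: degree_H flip: Q_eq)
  show "hom d P s t \<noteq> 0 \<or> hom d Q s t \<noteq> 0" unfolding P Q using h reducedD(3)[OF red0 assms(1)] by auto
  show "g (proj s t) = proj (hom d P s t) (hom d Q s t)"
    unfolding P Q g_def reduced_proj[OF red0 assms(1)] proj_scale[OF h] ..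
qed

end

section \<open>Locally uniform convergence and coverings\<close>

text \<open>A failure yields points of K at which the distance stays at least \<epsilon>. Along a
  subsequence their lifts converge, and the values of the maps and those of g tend to the same
  point, since the limit forms do not both vanish there.\<close>

lemma locunif_conv_rat:
  assumes red: "\<And>n. reduced d (p n) (q n)"
    and lim: "\<And>i. (\<lambda>n. coeff (p n) i) \<longlonglongrightarrow> coeff P i" "\<And>i. (\<lambda>n. coeff (q n) i) \<longlonglongrightarrow> coeff Q i"
    and ne: "\<And>s t. s \<noteq> 0 \<or> t \<noteq> 0 \<Longrightarrow> proj s t \<notin> S \<Longrightarrow> hom d P s t \<noteq> 0 \<or> hom d Q s t \<noteq> 0"
    and g: "\<And>s t. s \<noteq> 0 \<or> t \<noteq> 0 \<Longrightarrow> proj s t \<notin> S \<Longrightarrow> g (proj s t) = proj (hom d P s t) (hom d Q s t)"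
  shows "locunif_conv (\<lambda>n. rat_fun (p n) (q n)) g S"
  unfolding locunif_conv_def
proof (intro allI impI, rule ccontr)
  fix K :: "(complex \<times> real) set" and \<epsilon> :: real
  assume K: "compact K \<and> K \<subseteq> stereo ` (UNIV - S)" and \<epsilon>: "\<epsilon> > 0"
  assume "\<not> (\<forall>\<^sub>F n in sequentially. \<forall>z. stereo z \<in> K \<longrightarrow> cs_dist (rat_fun (p n) (q n) z) (g z) < \<epsilon>)"
  from not_eventually_sequentiallyD[OF this] obtain r :: "nat \<Rightarrow> nat" where r: "strict_mono r"
    "\<forall>n. \<not> (\<forall>z. stereo z \<in> K \<longrightarrow> cs_dist (rat_fun (p (r n)) (q (r n)) z) (g z) < \<epsilon>)"
    by blast
  then obtain z where z: "\<And>n. stereo (z n) \<in> K" "\<And>n. \<not> cs_dist (rat_fun (p (r n)) (q (r n)) (z n)) (g (z n)) < \<epsilon>"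
    by metis
  obtain r' s t s0 t0 where r': "strict_mono r'" "\<And>n. s n \<noteq> 0 \<or> t n \<noteq> 0" "\<And>n. z (r' n) = proj (s n) (t n)"
    "s \<longlonglongrightarrow> s0" "t \<longlonglongrightarrow> t0" "s0 \<noteq> 0 \<or> t0 \<noteq> 0" using cs_lift_subseq[of z] by blast
  have inS: "stereo x \<in> K \<Longrightarrow> x \<notin> S" for x using K injD[OF inj_stereo] by blast
  have conv: "(\<lambda>n. stereo (proj (s n) (t n))) \<longlonglongrightarrow> stereo (proj s0 t0)"
    using cs_tendsto_proj[OF r'(4-6)] by (simp add: cs_tendsto_def)
  have inK: "stereo (proj (s n) (t n)) \<in> K" for n using z(1)[of "r' n"] r'(3) by simp
  have "closed K" using K compact_imp_closed by blast
  from closed_sequentially[OF this inK conv] have "stereo (proj s0 t0) \<in> K" .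
  then have nS: "proj s0 t0 \<notin> S" by (rule inS)
  define rr where "rr n = r (r' n)" for n
  have rr: "strict_mono rr" using r(1) r'(1) unfolding rr_def by (simp add: strict_mono_def)
  have sub: "(\<lambda>n. coeff (p (rr n)) i) \<longlonglongrightarrow> coeff P i" "(\<lambda>n. coeff (q (rr n)) i) \<longlonglongrightarrow> coeff Q i" for i
    using LIMSEQ_subseq_LIMSEQ[OF lim(1) rr] LIMSEQ_subseq_LIMSEQ[OF lim(2) rr] by (simp_all add: o_def)
  have 1: "(\<lambda>n. stereo (rat_fun (p (rr n)) (q (rr n)) (proj (s n) (t n)))) \<longlonglongrightarrow> stereo (g (proj s0 t0))"
    unfolding reduced_proj[OF red r'(2)] g[OF r'(6) nS]
    using cs_tendsto_proj[OF tendsto_hom[OF sub(1) r'(4,5)] tendsto_hom[OF sub(2) r'(4,5)] ne[OF r'(6) nS]]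
    by (simp add: cs_tendsto_def)
  have gn: "g (proj (s n) (t n)) = proj (hom d P (s n) (t n)) (hom d Q (s n) (t n))" for n
    using g[OF r'(2)] inS z(1)[of "r' n"] r'(3)[of n] by simp
  have 2: "(\<lambda>n. stereo (g (proj (s n) (t n)))) \<longlonglongrightarrow> stereo (g (proj s0 t0))"
    unfolding gn g[OF r'(6) nS]
    using cs_tendsto_proj[OF tendsto_hom[OF tendsto_const r'(4,5)] tendsto_hom[OF tendsto_const r'(4,5)] ne[OF r'(6) nS]]
    by (simp add: cs_tendsto_def)
  have "(\<lambda>n. dist (stereo (rat_fun (p (rr n)) (q (rr n)) (proj (s n) (t n)))) (stereo (g (proj (s n) (t n))))) \<longlonglongrightarrow> 0"
    using tendsto_dist[OF 1 2] by simp
  then have "eventually (\<lambda>n. cs_dist (rat_fun (p (rr n)) (q (rr n)) (proj (s n) (t n))) (g (proj (s n) (t n))) < \<epsilon>) sequentially"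
    using order_tendstoD(2) \<epsilon> unfolding cs_dist_def by blast
  then obtain n where "cs_dist (rat_fun (p (rr n)) (q (rr n)) (proj (s n) (t n))) (g (proj (s n) (t n))) < \<epsilon>"
    using eventually_happens'[OF sequentially_bot] by blast
  then show False using z(2)[of "r' n"] r'(3)[of n] by (simp add: rr_def)
qed

lemma rat_map_tendsto:
  assumes g: "rat_map N g" "N \<ge> 1" and x: "cs_tendsto x l"
  shows "cs_tendsto (\<lambda>n. g (x n)) (g l)"
proof -
  define m where "m = ldeg g l"
  obtain C \<delta> where c: "C > 0" "\<delta> > 0" "\<And>x. cs_dist x l < \<delta> \<Longrightarrow> cs_dist (g x) (g l) \<le> C * cs_dist x l ^ m"
    using has_ldeg_ldeg[OF g, of l] unfolding has_ldeg_def m_def by blast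
  have m: "m > 0" using ldeg_pos[OF g, of l] by (simp add: m_def)
  have l: "(\<lambda>n. cs_dist (x n) l) \<longlonglongrightarrow> 0" using x by (simp add: cs_tendsto_iff_dist)
  have "(\<lambda>n. C * cs_dist (x n) l ^ m) \<longlonglongrightarrow> C * 0 ^ m" by (intro tendsto_intros l)
  then have lim: "(\<lambda>n. C * cs_dist (x n) l ^ m) \<longlonglongrightarrow> 0" using m by (simp add: power_0_left)
  have "eventually (\<lambda>n. cs_dist (x n) l < \<delta>) sequentially" using order_tendstoD(2)[OF l] c by auto
  then have "eventually (\<lambda>n. cs_dist (g (x n)) (g l) \<le> C * cs_dist (x n) l ^ m) sequentially"
    by (rule eventually_mono) (rule c(3))
  then show ?thesis unfolding cs_tendsto_iff_dist
    by (intro tendsto_sandwich[OF _ _ tendsto_const lim]) auto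
qed

text \<open>At \<alpha> every linear factor is at least as large as that of the nearest root. This
  is continuity of roots with an explicit bound.\<close>

lemma root_near:
  fixes R :: "complex poly"
  assumes "degree R \<ge> 1"
  shows "\<exists>r. poly R r = 0 \<and> cmod (\<alpha> - r) ^ degree R * cmod (lead_coeff R) \<le> cmod (poly R \<alpha>)"
proof -
  obtain A where A: "size A = degree R" "R = smult (lead_coeff R) (\<Prod>x\<in>#A. [:-x, 1:])"
    using alg_closed_imp_factorization[of R] assms by fastforce
  have "A \<noteq> {#}" using A(1) assms by auto
  then have "\<exists>r\<in>#A. \<forall>x\<in>#A. cmod (\<alpha> - r) \<le> cmod (\<alpha> - x)"
    using ex_min_if_finite[of "(\<lambda>x. cmod (\<alpha> - x)) ` set_mset A"] by (auto simp: not_less)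
  then obtain r where r: "r \<in># A" "\<And>x. x \<in># A \<Longrightarrow> cmod (\<alpha> - r) \<le> cmod (\<alpha> - x)" by blast
  have prod: "cmod (\<Prod>x\<in>#B. \<alpha> - x) \<ge> cmod (\<alpha> - r) ^ size B"
    if "\<And>x. x \<in># B \<Longrightarrow> cmod (\<alpha> - r) \<le> cmod (\<alpha> - x)" for B
    using that by (induction B) (auto simp: norm_mult intro!: mult_mono)
  have "poly R c = lead_coeff R * (\<Prod>x\<in>#A. c - x)" for c
    by (subst A(2)) (simp add: poly_prod_mset image_mset.compositionality o_def)
  then have "cmod (poly R \<alpha>) = cmod (lead_coeff R) * cmod (\<Prod>x\<in>#A. \<alpha> - x)" "poly R r = 0"
    using r(1) by (auto simp: norm_mult prod_mset_zero_iff image_iff)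
  then show ?thesis using prod[of A, OF r(2)] A(1) by (intro exI[of _ r]) (simp add: mult.commute mult_left_mono)
qed

text \<open>Openness in terms of sequences. With the value at x moved to 0 and a point outside its
  fibre moved to infinity, lifting \<open>b k\<close> means finding a root of
  \<open>P - smult (\<beta> k) Q\<close> near \<alpha>; its leading coefficient stays away from 0
  and its value at \<alpha> tends to 0, so \<open>root_near\<close> applies.\<close>

lemma rat_map_open:
  assumes g: "rat_map N g" and N: "N \<ge> 1" and b: "cs_tendsto b (g x)"
  shows "\<exists>x'. cs_tendsto x' x \<and> eventually (\<lambda>k. g (x' k) = b k) sequentially"
proof -
  obtain u where u: "g u \<noteq> g x" using rat_map_nonconst[OF g N] by blast
  obtain A where A: "mobius A" "A None = u" using mobius_transitive by blast
  obtain B where B: "mobius B" "B (g x) = Some 0" using mobius_transitive by blast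
  define h where "h = B \<circ> g \<circ> A"
  have h: "rat_map N h" unfolding h_def using ldeg_mobius_conj(1)[OF g N A(1) B(1)] .
  have injB: "inj B" and bijA: "bij A" using mobius_bij A B bij_is_inj by auto
  obtain P Q where PQ: "reduced N P Q" "h = rat_fun P Q" using h rat_map_iff by auto
  have "inv A x \<noteq> None" using A(2) u bijA by (metis bij_inv_eq_iff)
  then obtain \<alpha> where \<alpha>: "inv A x = Some \<alpha>" by auto
  then have A\<alpha>: "A (Some \<alpha>) = x" using bijA by (metis bij_inv_eq_iff)
  have h\<alpha>: "h (Some \<alpha>) = Some 0" using B A\<alpha> by (simp add: h_def)
  then have P\<alpha>: "poly P \<alpha> = 0" "poly Q \<alpha> \<noteq> 0" by (auto simp: PQ(2) split: if_splits)
  have cP: "coeff P N \<noteq> 0"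
  proof
    assume c: "coeff P N = 0"
    have "h (proj 1 0) = proj (coeff P N) (coeff Q N)"
      using reduced_proj[OF PQ(1), of 1 0] PQ(2) by (simp add: hom_0_right)
    then have "h None = Some 0" using c reduced_coeffs[OF PQ(1)] by (simp add: proj_def)
    then show False using u A(2) B(2) injD[OF injB] by (fastforce simp: h_def)
  qed
  have lb: "cs_tendsto (\<lambda>k. B (b k)) (Some 0)" using mobius_tendsto[OF B(1) b] B(2) by simp
  \<comment> \<open>The value 0 is a filler for the finitely many k at which the moved value is
    infinite.\<close>
  define \<beta> where "\<beta> k = (case B (b k) of Some w \<Rightarrow> w | None \<Rightarrow> 0)" for k
  have fin: "eventually (\<lambda>k. B (b k) = Some (\<beta> k)) sequentially"
    using cs_tendsto_eventually_finite[OF lb] by eventually_elim (auto simp: \<beta>_def)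
  have "cs_tendsto (\<lambda>k. Some (\<beta> k)) (Some 0)"
    using lb unfolding cs_tendsto_def
    by (rule Lim_transform_eventually) (use fin in \<open>auto elim: eventually_mono\<close>)
  then have \<beta>: "\<beta> \<longlonglongrightarrow> 0" by (simp add: cs_tendsto_Some_iff)
  define R where "R k = P - smult (\<beta> k) Q" for k
  define l where "l k = coeff P N - \<beta> k * coeff Q N" for k
  have "l \<longlonglongrightarrow> coeff P N - 0 * coeff Q N" unfolding l_def by (intro tendsto_intros \<beta>)
  then have l: "l \<longlonglongrightarrow> coeff P N" by simp
  have lne: "eventually (\<lambda>k. l k \<noteq> 0) sequentially" using tendsto_imp_eventually_ne[OF l cP] .
  have deg: "degree (R k) = N \<and> lead_coeff (R k) = l k" if "l k \<noteq> 0" for k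
  proof -
    have c: "coeff (R k) N = l k" by (simp add: R_def l_def)
    have "degree (R k) \<le> N" unfolding R_def using reducedD(1,2)[OF PQ(1)]
      by (intro degree_diff_le order.trans[OF degree_smult_le])
    moreover have "N \<le> degree (R k)" using that c by (intro le_degree) simp
    ultimately show ?thesis using c by simp
  qed
  have "\<forall>k. \<exists>r. l k \<noteq> 0 \<longrightarrow> poly (R k) r = 0 \<and> cmod (\<alpha> - r) ^ N * cmod (l k) \<le> cmod (poly (R k) \<alpha>)"
    using root_near deg N by metis
  then obtain r where r: "\<And>k. l k \<noteq> 0 \<Longrightarrow> poly (R k) (r k) = 0"
    "\<And>k. l k \<noteq> 0 \<Longrightarrow> cmod (\<alpha> - r k) ^ N * cmod (l k) \<le> cmod (poly (R k) \<alpha>)" by metis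
  have "(\<lambda>k. cmod (\<beta> k * poly Q \<alpha>) / cmod (l k)) \<longlonglongrightarrow> cmod (0 * poly Q \<alpha>) / cmod (coeff P N)"
    by (intro tendsto_intros \<beta> l) (use cP in auto)
  then have lim: "(\<lambda>k. cmod (\<beta> k * poly Q \<alpha>) / cmod (l k)) \<longlonglongrightarrow> 0" by simp
  have "eventually (\<lambda>k. cmod (\<alpha> - r k) ^ N \<le> cmod (\<beta> k * poly Q \<alpha>) / cmod (l k)) sequentially"
    using lne
  proof eventually_elim
    case (elim k)
    then show ?case using r(2)[of k] P\<alpha> by (simp add: R_def field_simps)
  qed
  then have "(\<lambda>k. cmod (\<alpha> - r k) ^ N) \<longlonglongrightarrow> 0"
    by (intro tendsto_sandwich[OF _ _ tendsto_const lim]) auto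
  then have "(\<lambda>k. root N (cmod (\<alpha> - r k) ^ N)) \<longlonglongrightarrow> root N 0" by (intro tendsto_intros)
  then have "(\<lambda>k. cmod (\<alpha> - r k)) \<longlonglongrightarrow> 0" using N by (simp add: real_root_power_cancel)
  then have "(\<lambda>k. cmod (r k - \<alpha>)) \<longlonglongrightarrow> 0" by (simp add: norm_minus_commute)
  then have "(\<lambda>k. r k - \<alpha>) \<longlonglongrightarrow> 0" by (rule tendsto_norm_zero_cancel)
  then have "r \<longlonglongrightarrow> \<alpha>" by (rule LIM_zero_cancel)
  then have "cs_tendsto (\<lambda>k. A (Some (r k))) x"
    using mobius_tendsto[OF A(1), of "\<lambda>k. Some (r k)" "Some \<alpha>"] A\<alpha> by (simp add: cs_tendsto_Some_iff)
  moreover have "eventually (\<lambda>k. g (A (Some (r k))) = b k) sequentially"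
    using lne fin
  proof eventually_elim
    case (elim k)
    have root: "poly P (r k) = \<beta> k * poly Q (r k)" using r(1)[OF elim(1)] by (simp add: R_def)
    then have "poly Q (r k) \<noteq> 0" using reduced_roots[OF PQ(1), of "r k"] by auto
    then have "h (Some (r k)) = Some (\<beta> k)" using root by (simp add: PQ(2))
    then show ?case using elim(2) injD[OF injB] by (simp add: h_def)
  qed
  ultimately show ?thesis by blast
qed

lemma finite_separated:
  fixes S :: "'a::metric_space set"
  assumes "finite S"
  shows "\<exists>e>0. \<forall>x\<in>S. \<forall>y\<in>S. x \<noteq> y \<longrightarrow> ball x e \<inter> ball y e = {}"
proof -
  define D where "D = insert 1 ((\<lambda>(x, y). dist x y / 2) ` {(x, y) \<in> S \<times> S. x \<noteq> y})"
  have fin: "finite D" using assms unfolding D_def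
    by (intro finite.insertI finite_imageI finite_subset[OF _ finite_cartesian_product[OF assms assms]]) auto
  have pos: "Min D > 0" using fin by (subst Min_gr_iff) (auto simp: D_def)
  have "ball x (Min D) \<inter> ball y (Min D) = {}" if "x \<in> S" "y \<in> S" "x \<noteq> y" for x y
  proof -
    have "dist x y / 2 \<in> D" using that by (auto simp: D_def)
    then have "Min D \<le> dist x y / 2" by (rule Min_le[OF fin])
    then show ?thesis by (intro disjoint_ballI) simp
  qed
  then show ?thesis using pos by blast
qed

lemma card_le_sum_pos:
  assumes "finite S" "\<And>x. x \<in> S \<Longrightarrow> f x \<ge> (1::nat)" shows "card S \<le> sum f S"
  using sum_mono[of S "\<lambda>_. 1" f] assms by simp

text \<open>Fibres over the complement of B have exactly N points because nothing there is critical,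
  and no fibre has more. Take disjoint neighbourhoods of the N points over b and intersect their
  images: each value in the intersection V has a preimage in every neighbourhood, hence just one in
  each and none elsewhere. Openness makes the sheets homeomorphic to V.\<close>

lemma rat_map_covering:
  assumes g: "rat_map N g" and N: "N \<ge> 1" and A: "A = {x. g x \<in> B}"
    and crit: "\<And>x. x \<notin> A \<Longrightarrow> ldeg g x = 1"
  shows "covering_space (stereo ` (UNIV - A)) (stereo \<circ> g \<circ> inv stereo) (stereo ` (UNIV - B))"
proof -
  define G where "G = stereo \<circ> g \<circ> inv stereo"
  define S where "S = stereo ` (UNIV - A)"
  define T where "T = stereo ` (UNIV - B)"
  have G: "G (stereo x) = stereo (g x)" for x by (simp add: G_def)
  have seq: "\<exists>x. y = (\<lambda>n. stereo (x n)) \<and> (\<forall>n. x n \<notin> A)" if "\<And>n::nat. y n \<in> S" for y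
  proof -
    have "\<forall>n. \<exists>x. y n = stereo x \<and> x \<notin> A" using that by (auto simp: S_def)
    then show ?thesis by metis
  qed
  have cont: "continuous_on S G" unfolding continuous_on_sequentially
  proof (intro allI ballI impI, elim conjE)
    fix y a assume a: "a \<in> S" and y: "\<forall>n. y n \<in> S" "y \<longlonglongrightarrow> a"
    obtain x where x: "y = (\<lambda>n. stereo (x n))" using seq y by blast
    obtain z where z: "a = stereo z" using a by (auto simp: S_def)
    have "cs_tendsto x z" using y x z by (simp add: cs_tendsto_def)
    from rat_map_tendsto[OF g N this] show "(G \<circ> y) \<longlonglongrightarrow> G a"
      unfolding x z o_def G cs_tendsto_def .
  qed
  have surj: "\<exists>x. g x = b" for b
  proof (rule ccontr)
    assume "\<not> ?thesis"
    then have "{x. g x = b} = {}" by auto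
    then have "(\<Sum>x | g x = b. ldeg g x) = 0" by (simp only: sum.empty)
    then show False using sum_ldeg_fibre(2)[OF g N, of b] N by simp
  qed
  have img: "G ` S = T"
  proof
    show "G ` S \<subseteq> T" by (auto simp: S_def T_def G A)
    show "T \<subseteq> G ` S"
    proof
      fix t assume "t \<in> T"
      then obtain b where b: "t = stereo b" "b \<notin> B" by (auto simp: T_def)
      obtain x where x: "g x = b" using surj by blast
      then have "stereo x \<in> S" using b by (auto simp: S_def A)
      then show "t \<in> G ` S" using b x G by (metis image_eqI)
    qed
  qed
  have opn: "openin (top_of_set T) (G ` U)" if U: "openin (top_of_set S) U" for U
  proof -
    obtain O' where O': "open O'" "U = S \<inter> O'" using U by (auto simp: openin_open)
    have sub: "G ` U \<subseteq> T" using O' img by auto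
    have "\<exists>e>0. \<forall>y\<in>T. dist y t < e \<longrightarrow> y \<in> G ` U" if t: "t \<in> G ` U" for t
    proof (rule ccontr)
      assume "\<not> ?thesis"
      then have "\<forall>n::nat. \<exists>y\<in>T. dist y t < inverse (real (Suc n)) \<and> y \<notin> G ` U"
        by (metis inverse_positive_iff_positive of_nat_0_less_iff zero_less_Suc)
      then obtain y where y: "\<And>n. y n \<in> T" "\<And>n. dist (y n) t < inverse (real (Suc n))" "\<And>n. y n \<notin> G ` U" by metis
      have "\<forall>n. \<exists>b. y n = stereo b \<and> b \<notin> B" using y(1) by (auto simp: T_def)
      then obtain b where b: "\<And>n. y n = stereo (b n)" "\<And>n. b n \<notin> B" by metis
      obtain x where x: "stereo x \<in> U" "t = stereo (g x)"
      proof -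
        obtain y0 where y0: "y0 \<in> U" "t = G y0" using t by blast
        then obtain x where "y0 = stereo x" using O' by (auto simp: S_def)
        then show ?thesis using that y0 G by simp
      qed
      have "(\<lambda>n. dist (y n) t) \<longlonglongrightarrow> 0"
        by (rule tendsto_sandwich[OF _ _ tendsto_const LIMSEQ_inverse_real_of_nat])
          (use y(2) in \<open>auto intro!: always_eventually less_imp_le\<close>)
      then have "cs_tendsto b (g x)" unfolding cs_tendsto_iff_dist cs_dist_def by (simp add: b(1) x(2))
      then obtain x' where x': "cs_tendsto x' x" "eventually (\<lambda>k. g (x' k) = b k) sequentially"
        using rat_map_open[OF g N] by blast
      have "eventually (\<lambda>k. stereo (x' k) \<in> O') sequentially"
        using x'(1) O' x(1) unfolding cs_tendsto_def by (intro topological_tendstoD) auto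
      with x'(2) have "eventually (\<lambda>k. g (x' k) = b k \<and> stereo (x' k) \<in> O') sequentially"
        by (rule eventually_conj)
      then obtain k where k: "g (x' k) = b k" "stereo (x' k) \<in> O'"
        using eventually_happens'[OF sequentially_bot] by blast
      then have "stereo (x' k) \<in> U" using O' b(2)[of k] by (auto simp: S_def A)
      then have "G (stereo (x' k)) \<in> G ` U" by blast
      then show False using y(3)[of k] k(1) b(1) G by simp
    qed
    then show ?thesis using sub unfolding openin_euclidean_subtopology_iff by blast
  qed
  show ?thesis unfolding G_def[symmetric] S_def[symmetric] T_def[symmetric]
  proof (rule covering_spaceI[OF cont img])
    fix t assume "t \<in> T"
    then obtain b where b: "t = stereo b" "b \<notin> B" by (auto simp: T_def)
    define Fb where "Fb = {x. g x = b}"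
    have finF: "finite {x. g x = c}" and sumF: "(\<Sum>x | g x = c. ldeg g x) = N" for c
      using sum_ldeg_fibre[OF g N] by blast+
    have Fb: "finite Fb" using finF by (simp add: Fb_def)
    have FbA: "x \<notin> A" if "x \<in> Fb" for x using that b by (auto simp: Fb_def A)
    have cardF: "card Fb = N"
    proof -
      have "N = (\<Sum>x\<in>Fb. ldeg g x)" using sumF by (simp add: Fb_def)
      also have "\<dots> = (\<Sum>x\<in>Fb. 1)" using crit FbA by (intro sum.cong) auto
      finally show ?thesis by simp
    qed
    have card_le: "card {x. g x = c} \<le> N" for c
      using card_le_sum_pos[OF finF, of c "ldeg g"] ldeg_pos[OF g N] sumF[of c] by simp
    obtain e where e: "e > 0" "\<And>x y. x \<in> stereo ` Fb \<Longrightarrow> y \<in> stereo ` Fb \<Longrightarrow> x \<noteq> y \<Longrightarrow> ball x e \<inter> ball y e = {}"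
      using finite_separated[of "stereo ` Fb"] Fb by blast
    define W where "W x = S \<inter> ball (stereo x) e" for x
    have Wd: "W x \<inter> W y = {}" if "x \<in> Fb" "y \<in> Fb" "x \<noteq> y" for x y
      using e(2)[of "stereo x" "stereo y"] that inj_eq[OF inj_stereo] by (auto simp: W_def)
    have Wo: "openin (top_of_set S) (W x)" for x unfolding W_def by (simp add: openin_open_Int)
    define V where "V = (\<Inter>x\<in>Fb. G ` W x)"
    have Fne: "Fb \<noteq> {}" using cardF N by auto
    have Vo: "openin (top_of_set T) V" unfolding V_def
      using Fb Fne opn[OF Wo] by (intro openin_INT2) auto
    have tV: "t \<in> V" unfolding V_def
    proof
      fix x assume x: "x \<in> Fb"
      then have "stereo x \<in> W x" using FbA e(1) by (auto simp: W_def S_def)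
      moreover have "G (stereo x) = t" using x b G by (simp add: Fb_def)
      ultimately show "t \<in> G ` W x" by blast
    qed
    have key: "\<exists>x\<in>Fb. y \<in> W x" and uniq: "\<And>x y'. x \<in> Fb \<Longrightarrow> y \<in> W x \<Longrightarrow> y' \<in> W x \<Longrightarrow> G y' = G y \<Longrightarrow> y' = y"
      if y: "y \<in> S" "G y \<in> V" for y
    proof -
      obtain y0 where y0: "y = stereo y0" using y(1) by (auto simp: S_def)
      have "\<forall>x\<in>Fb. \<exists>w. stereo w \<in> W x \<and> g w = g y0"
      proof
        fix x assume "x \<in> Fb"
        then have "G y \<in> G ` W x" using y(2) by (auto simp: V_def)
        then obtain w' where w': "w' \<in> W x" "G y = G w'" by blast
        obtain w where w: "w' = stereo w" using w'(1) by (auto simp: W_def S_def)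
        then have "g w = g y0" using w'(2) G y0 injD[OF inj_stereo] by auto
        then show "\<exists>w. stereo w \<in> W x \<and> g w = g y0" using w w' by blast
      qed
      then obtain w where w: "\<And>x. x \<in> Fb \<Longrightarrow> stereo (w x) \<in> W x" "\<And>x. x \<in> Fb \<Longrightarrow> g (w x) = g y0" by metis
      have inj: "inj_on w Fb"
      proof (rule inj_onI, rule ccontr)
        fix x x' assume "x \<in> Fb" "x' \<in> Fb" "w x = w x'" "x \<noteq> x'"
        then show False using w(1)[of x] w(1)[of x'] Wd[of x x'] by auto
      qed
      have "w ` Fb = {x. g x = g y0}"
      proof (rule card_seteq)
        show "card {x. g x = g y0} \<le> card (w ` Fb)" using card_image[OF inj] cardF card_le by simp
      qed (use finF w in auto)
      then have all: "\<exists>x\<in>Fb. z = w x" if "g z = g y0" for z using that by blast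
      show "\<exists>x\<in>Fb. y \<in> W x" using all[of y0] w(1) y0 by auto
      show "y' = y" if x: "x \<in> Fb" "y \<in> W x" "y' \<in> W x" "G y' = G y" for x y'
      proof -
        obtain z where z: "y' = stereo z" using x(3) by (auto simp: W_def S_def)
        have "g z = g y0" using x(4) z y0 G injD[OF inj_stereo] by auto
        then obtain x1 where x1: "x1 \<in> Fb" "z = w x1" using all by blast
        obtain x2 where x2: "x2 \<in> Fb" "y0 = w x2" using all by blast
        have "x1 = x" using Wd[OF x1(1) x(1)] w(1)[OF x1(1)] x1 z x(3) by auto
        moreover have "x2 = x" using Wd[OF x2(1) x(1)] w(1)[OF x2(1)] x2 y0 x(2) by auto
        ultimately show "y' = y" using z y0 x1 x2 by simp
      qed
    qed
    have GV: "openin (top_of_set S) (S \<inter> G -` V)"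
      using continuous_openin_preimage_gen[OF cont] Vo img by (metis continuous_openin_preimage cont order_refl image_subset_iff_funcset)
    define v where "v = (\<lambda>x. W x \<inter> (S \<inter> G -` V)) ` Fb"
    show "\<exists>T'. t \<in> T' \<and> openin (top_of_set T) T' \<and> (\<exists>v. \<Union> v = S \<inter> G -` T' \<and>
        (\<forall>u\<in>v. openin (top_of_set S) u) \<and> pairwise disjnt v \<and> (\<forall>u\<in>v. \<exists>q. homeomorphism u T' G q))"
    proof (intro exI[of _ V] exI[of _ v] conjI)
      show "t \<in> V" "openin (top_of_set T) V" using tV Vo by blast+
      show "\<Union> v = S \<inter> G -` V" using key by (auto simp: v_def)
      show "\<forall>u\<in>v. openin (top_of_set S) u" using openin_Int[OF Wo GV] by (auto simp: v_def)
      show "pairwise disjnt v" unfolding pairwise_def disjnt_def v_def using Wd by blast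
      show "\<forall>u\<in>v. \<exists>q. homeomorphism u V G q"
      proof
        fix u assume "u \<in> v"
        then obtain x where x: "x \<in> Fb" "u = W x \<inter> (S \<inter> G -` V)" by (auto simp: v_def)
        have uo: "openin (top_of_set S) u" using openin_Int[OF Wo GV] x by blast
        have "continuous_on u G" using cont by (rule continuous_on_subset) (use x in auto)
        moreover have im: "G ` u = V"
        proof
          show "G ` u \<subseteq> V" using x by auto
          show "V \<subseteq> G ` u"
          proof
            fix s assume s: "s \<in> V"
            then obtain y where y: "y \<in> W x" "s = G y" using x(1) by (auto simp: V_def)
            then have "y \<in> u" using s unfolding x(2) by (simp add: W_def)
            then show "s \<in> G ` u" using y(2) by blast
          qed
        qed
        moreover have "inj_on G u"
          by (rule inj_onI) (use uniq[of _ x] x in auto)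
        moreover have "openin (top_of_set V) (G ` U)" if U: "openin (top_of_set u) U" for U
        proof -
          have "openin (top_of_set S) U" using openin_trans[OF U uo] .
          then have "openin (top_of_set T) (G ` U)" by (rule opn)
          moreover have "G ` U \<subseteq> V" using openin_imp_subset[OF U] im by auto
          moreover have "V \<subseteq> T" using Vo openin_imp_subset by blast
          ultimately show ?thesis using openin_subset_trans by blast
        qed
        ultimately show "\<exists>q. homeomorphism u V G q"
          using homeomorphism_injective_open_map by metis
      qed
    qed
  qed
qed

section \<open>Subsequences and convergence of Moebius transformations\<close>

lemma strict_mono_compose: "strict_mono (r :: nat \<Rightarrow> nat) \<Longrightarrow> strict_mono (s :: nat \<Rightarrow> nat) \<Longrightarrow> strict_mono (\<lambda>n. r (s n))"
  by (simp add: strict_mono_def)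

text \<open>Properties that survive further extraction are secured one index at a time, with no
  diagonal argument.\<close>

lemma finite_common_subseq:
  fixes C :: "'i \<Rightarrow> (nat \<Rightarrow> nat) \<Rightarrow> bool"
  assumes "finite I"
    and ex: "\<And>i (r :: nat \<Rightarrow> nat). i \<in> I \<Longrightarrow> strict_mono r \<Longrightarrow> \<exists>s :: nat \<Rightarrow> nat. strict_mono s \<and> C i (\<lambda>n. r (s n))"
    and mono: "\<And>i (r :: nat \<Rightarrow> nat) (s :: nat \<Rightarrow> nat). i \<in> I \<Longrightarrow> C i r \<Longrightarrow> strict_mono s \<Longrightarrow> C i (\<lambda>n. r (s n))"
  shows "\<exists>r. strict_mono r \<and> (\<forall>i\<in>I. C i r)"
  using assms
proof (induction I rule: finite_induct)
  case empty
  then show ?case using strict_mono_id by (intro exI[of _ id]) (auto simp: strict_mono_def)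
next
  case (insert x F)
  then obtain r where r: "strict_mono r" "\<forall>i\<in>F. C i r" by auto
  obtain s where s: "strict_mono s" "C x (\<lambda>n. r (s n))" using insert.prems(1)[of x r] r(1) by auto
  have "\<forall>i\<in>insert x F. C i (\<lambda>n. r (s n))" using r(2) s insert.prems(2) by auto
  then show ?case using strict_mono_compose[OF r(1) s(1)] by blast
qed

lemma constant_subseq:
  fixes f :: "nat \<Rightarrow> 'a"
  assumes "finite A" "\<And>n. f n \<in> A"
  shows "\<exists>r c. strict_mono (r :: nat \<Rightarrow> nat) \<and> (\<forall>n. f (r n) = c)"
proof -
  have "\<exists>c\<in>f ` UNIV. infinite {n \<in> UNIV. f n = c}"
  proof (rule ccontr)
    assume "\<not> ?thesis"
    then have "finite (\<Union>c\<in>f ` UNIV. {n. f n = c})"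
      using assms by (intro finite_UN_I finite_subset[OF _ assms(1)]) auto
    moreover have "(\<Union>c\<in>f ` UNIV. {n. f n = c}) = UNIV" by auto
    ultimately show False by simp
  qed
  then obtain c where "infinite {n. f n = c}" by auto
  then obtain r where "strict_mono (r :: nat \<Rightarrow> nat)" "\<forall>n. r n \<in> {n. f n = c}" using infinite_enumerate by blast
  then show ?thesis by auto
qed

text \<open>Normalising by the largest \<open>2 \<times> 2\<close> minor of the coefficient matrix bounds all coefficients by 1
  and keeps the limits independent.\<close>
lemma normalised_limit:
  assumes red: "\<And>n. reduced d (p n) (q n)" and d: "d \<ge> 1"
  shows "\<exists>r a b c e P Q. strict_mono (r :: nat \<Rightarrow> nat) \<and> (\<forall>n. a n * e n - b n * c n \<noteq> 0) \<and>
    (\<forall>i. (\<lambda>n. coeff (smult (a n) (p (r n)) + smult (b n) (q (r n))) i) \<longlonglongrightarrow> coeff P i) \<and>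
    (\<forall>i. (\<lambda>n. coeff (smult (c n) (p (r n)) + smult (e n) (q (r n))) i) \<longlonglongrightarrow> coeff Q i) \<and>
    (\<forall>\<alpha> \<beta>. \<alpha> \<noteq> 0 \<or> \<beta> \<noteq> 0 \<longrightarrow> smult \<beta> P - smult \<alpha> Q \<noteq> 0)"
proof -
  \<comment> \<open>The minors of the coefficient matrix, that is, the Pluecker coordinates of the
    pencil spanned by the two forms.\<close>
  define m where "m n i j = coeff (p n) i * coeff (q n) j - coeff (p n) j * coeff (q n) i" for n i j
  have m0: "\<exists>i j. i \<le> d \<and> j \<le> d \<and> m n i j \<noteq> 0" for n
  proof (rule ccontr)
    assume z: "\<not> ?thesis"
    have c: "coeff (p n) i = 0 \<and> coeff (q n) i = 0" if "i > d" for i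
      using reducedD(1,2)[OF red, of n] that by (auto intro!: coeff_eq_0)
    have "smult (coeff (q n) d) (p n) - smult (coeff (p n) d) (q n) = 0"
    proof (rule poly_eqI)
      fix i
      have "m n i d = 0" using z by (cases "i \<le> d") (auto simp: m_def c)
      then show "coeff (smult (coeff (q n) d) (p n) - smult (coeff (p n) d) (q n)) i = coeff 0 i"
        by (simp add: m_def mult.commute)
    qed
    then show False using reduced_indep[OF red d, of "coeff (p n) d" "coeff (q n) d" n] reduced_coeffs[OF red, of n] by blast
  qed
  have "\<exists>i j. i \<le> d \<and> j \<le> d \<and> m n i j \<noteq> 0 \<and> (\<forall>k l. k \<le> d \<longrightarrow> l \<le> d \<longrightarrow> cmod (m n k l) \<le> cmod (m n i j))" for n
  proof -
    define S where "S = {..d} \<times> {..d}"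
    have "finite S" "S \<noteq> {}" by (auto simp: S_def)
    define V where "V = (\<lambda>kl. cmod (m n (fst kl) (snd kl))) ` S"
    have V: "finite V" "V \<noteq> {}" using \<open>finite S\<close> \<open>S \<noteq> {}\<close> by (auto simp: V_def)
    obtain ij where ij: "ij \<in> S" "cmod (m n (fst ij) (snd ij)) = Max V" using Max_in[OF V] by (auto simp: V_def)
    have ij: "ij \<in> S" "\<And>kl. kl \<in> S \<Longrightarrow> cmod (m n (fst kl) (snd kl)) \<le> cmod (m n (fst ij) (snd ij))"
      using ij Max_ge[OF V(1)] by (auto simp: V_def)
    have mx: "cmod (m n k l) \<le> cmod (m n (fst ij) (snd ij))" if "k \<le> d" "l \<le> d" for k l
      using ij(2)[of "(k, l)"] that by (simp add: S_def)
    obtain i j where "i \<le> d" "j \<le> d" "m n i j \<noteq> 0" using m0 by blast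
    then have "m n (fst ij) (snd ij) \<noteq> 0" using mx[of i j] by auto
    then show ?thesis using mx ij(1) by (intro exI[of _ "fst ij"] exI[of _ "snd ij"]) (auto simp: S_def)
  qed
  then obtain I J where IJ: "\<And>n. I n \<le> d" "\<And>n. J n \<le> d" "\<And>n. m n (I n) (J n) \<noteq> 0"
    "\<And>n k l. k \<le> d \<Longrightarrow> l \<le> d \<Longrightarrow> cmod (m n k l) \<le> cmod (m n (I n) (J n))" by metis
  obtain r0 ij where r0: "strict_mono (r0 :: nat \<Rightarrow> nat)" "\<And>n. (I (r0 n), J (r0 n)) = ij"
    using constant_subseq[of "{..d} \<times> {..d}" "\<lambda>n. (I n, J n)"] IJ by auto
  define i j where "i = fst ij" and "j = snd ij"
  have ij: "I (r0 n) = i" "J (r0 n) = j" for n using r0(2)[of n] by (auto simp: i_def j_def)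
  have ijd: "i \<le> d" "j \<le> d" using IJ(1)[of "r0 0"] IJ(2)[of "r0 0"] ij by auto
  define M where "M n = m (r0 n) i j" for n
  have M: "M n \<noteq> 0" "\<And>k l. k \<le> d \<Longrightarrow> l \<le> d \<Longrightarrow> cmod (m (r0 n) k l) \<le> cmod (M n)" for n
    using IJ(3,4)[of "r0 n"] IJ(4)[of _ _ "r0 n"] ij by (auto simp: M_def)
  \<comment> \<open>The inverse of the submatrix with columns i, j is applied to the pair. Every new
    coefficient is a minor divided by the largest one, and columns i, j become the identity matrix,
    which persists in the limit and gives independence.\<close>
  define p' where "p' n = smult (coeff (q (r0 n)) j / M n) (p (r0 n)) + smult (- coeff (p (r0 n)) j / M n) (q (r0 n))" for n
  define q' where "q' n = smult (- coeff (q (r0 n)) i / M n) (p (r0 n)) + smult (coeff (p (r0 n)) i / M n) (q (r0 n))" for n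
  have p': "coeff (p' n) k = m (r0 n) k j / M n" for n k
    by (simp add: p'_def m_def diff_divide_distrib mult.commute)
  have q': "coeff (q' n) k = m (r0 n) i k / M n" for n k
    by (simp add: q'_def m_def diff_divide_distrib mult.commute)
  have big: "coeff (p' n) k = 0" "coeff (q' n) k = 0" if "k > d" for n k
    using reducedD(1,2)[OF red, of "r0 n"] that unfolding p' q' m_def by (simp_all add: coeff_eq_0)
  have bd: "cmod (coeff (p' n) k) \<le> 1" "cmod (coeff (q' n) k) \<le> 1" for n k
  proof -
    show "cmod (coeff (p' n) k) \<le> 1"
    proof (cases "k \<le> d")
      case True then show ?thesis unfolding p' using M(1)[of n] M(2)[of k j n] ijd by (simp add: norm_divide)
    qed (simp add: big)
    show "cmod (coeff (q' n) k) \<le> 1"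
    proof (cases "k \<le> d")
      case True then show ?thesis unfolding q' using M(1)[of n] M(2)[of i k n] ijd by (simp add: norm_divide)
    qed (simp add: big)
  qed
  have ex: "\<exists>s. strict_mono s \<and> convergent (\<lambda>n. f (r (s n)))" if "\<And>n. cmod (f n) \<le> 1" for f :: "nat \<Rightarrow> complex" and r :: "nat \<Rightarrow> nat"
  proof -
    have "bounded (range (\<lambda>n. f (r n)))" using that by (intro boundedI[of _ 1]) auto
    then obtain l s where "strict_mono (s :: nat \<Rightarrow> nat)" "((\<lambda>n. f (r n)) \<circ> s) \<longlonglongrightarrow> l"
      using bounded_imp_convergent_subsequence by blast
    then show ?thesis by (auto simp: o_def convergent_def)
  qed
  have mono: "convergent (\<lambda>n. f (r (s n)))" if "convergent (\<lambda>n. f (r n))" "strict_mono s" for f :: "nat \<Rightarrow> complex" and r s :: "nat \<Rightarrow> nat"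
    using convergent_subseq_convergent[OF that] by (simp add: o_def)
  have "\<exists>r. strict_mono r \<and> (\<forall>k\<in>{..d} \<times> UNIV. convergent (\<lambda>n. if snd k then coeff (p' (r n)) (fst k) else coeff (q' (r n)) (fst k)))"
  proof (rule finite_common_subseq)
    fix k :: "nat \<times> bool" and r :: "nat \<Rightarrow> nat"
    show "\<exists>s. strict_mono s \<and> convergent (\<lambda>n. if snd k then coeff (p' (r (s n))) (fst k) else coeff (q' (r (s n))) (fst k))"
      using ex[of "\<lambda>n. if snd k then coeff (p' n) (fst k) else coeff (q' n) (fst k)" r] bd by auto
  next
    fix k :: "nat \<times> bool" and r s :: "nat \<Rightarrow> nat"
    assume "convergent (\<lambda>n. if snd k then coeff (p' (r n)) (fst k) else coeff (q' (r n)) (fst k))" "strict_mono s"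
    then show "convergent (\<lambda>n. if snd k then coeff (p' (r (s n))) (fst k) else coeff (q' (r (s n))) (fst k))"
      by (rule mono[of "\<lambda>n. if snd k then coeff (p' n) (fst k) else coeff (q' n) (fst k)"])
  qed auto
  then obtain r where r0': "strict_mono (r :: nat \<Rightarrow> nat)"
    "\<forall>k\<in>{..d} \<times> UNIV. convergent (\<lambda>n. if snd k then coeff (p' (r n)) (fst k) else coeff (q' (r n)) (fst k))" by blast
  have cp: "convergent (\<lambda>n. coeff (p' (r n)) k)" for k
    using bspec[OF r0'(2), of "(k, True)"] big(1)[of k] by (cases "k \<le> d") (auto simp: convergent_const)
  have cq: "convergent (\<lambda>n. coeff (q' (r n)) k)" for k
    using bspec[OF r0'(2), of "(k, False)"] big(2)[of k] by (cases "k \<le> d") (auto simp: convergent_const)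
  have limpoly: "\<exists>P. \<forall>k. (\<lambda>n. coeff (f n) k) \<longlonglongrightarrow> coeff P k"
    if "\<And>k. convergent (\<lambda>n. coeff (f n) k)" "\<And>n k. k > d \<Longrightarrow> coeff (f n) k = 0" for f :: "nat \<Rightarrow> complex poly"
  proof -
    define P where "P = (\<Sum>k\<le>d. monom (lim (\<lambda>n. coeff (f n) k)) k)"
    have "coeff P k = lim (\<lambda>n. coeff (f n) k)" for k
    proof (cases "k \<le> d")
      case True
      then show ?thesis by (simp add: P_def coeff_sum)
    next
      case False
      then have "(\<lambda>n. coeff (f n) k) = (\<lambda>n. 0)" using that(2) by auto
      then show ?thesis using False by (simp add: P_def coeff_sum limI)
    qed
    then show ?thesis using that(1) convergent_LIMSEQ_iff by metis
  qed
  obtain P where P: "\<And>k. (\<lambda>n. coeff (p' (r n)) k) \<longlonglongrightarrow> coeff P k" using limpoly[of "\<lambda>n. p' (r n)"] cp big by auto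
  obtain Q where Q: "\<And>k. (\<lambda>n. coeff (q' (r n)) k) \<longlonglongrightarrow> coeff Q k" using limpoly[of "\<lambda>n. q' (r n)"] cq big by auto
  have const: "l = c" if "(\<lambda>n. c) \<longlonglongrightarrow> l" for l c :: complex using LIMSEQ_unique[OF that tendsto_const] .
  have "m n i i = 0" "m n j j = 0" for n by (simp_all add: m_def)
  then have "coeff P i = 1" "coeff P j = 0" "coeff Q i = 0" "coeff Q j = 1"
    using P[of i] P[of j] Q[of i] Q[of j] M(1) unfolding p' q' M_def[symmetric] by (auto intro: const)
  then have indep: "smult \<beta> P - smult \<alpha> Q \<noteq> 0" if "\<alpha> \<noteq> 0 \<or> \<beta> \<noteq> 0" for \<alpha> \<beta>
  proof -
    assume "coeff P i = 1" "coeff P j = 0" "coeff Q i = 0" "coeff Q j = 1"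
    then have "coeff (smult \<beta> P - smult \<alpha> Q) i = \<beta>" "coeff (smult \<beta> P - smult \<alpha> Q) j = - \<alpha>" by simp_all
    then show ?thesis using that by (metis coeff_0 neg_equal_0_iff_equal)
  qed
  have det: "coeff (q (r0 n)) j / M n * (coeff (p (r0 n)) i / M n) - - coeff (p (r0 n)) j / M n * (- coeff (q (r0 n)) i / M n) \<noteq> 0" for n
  proof -
    have "coeff (q (r0 n)) j / M n * (coeff (p (r0 n)) i / M n) - - coeff (p (r0 n)) j / M n * (- coeff (q (r0 n)) i / M n)
        = (coeff (p (r0 n)) i * coeff (q (r0 n)) j - coeff (p (r0 n)) j * coeff (q (r0 n)) i) / (M n * M n)"
      by (simp add: diff_divide_distrib mult.commute)
    also have "\<dots> = 1 / M n" using M(1)[of n] by (simp add: M_def m_def)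
    finally show ?thesis using M(1)[of n] by simp
  qed
  show ?thesis
  proof (intro exI conjI allI impI)
    show "strict_mono (\<lambda>n. r0 (r n))" using strict_mono_compose[OF r0(1) r0'(1)] .
    show "coeff (q (r0 (r n))) j / M (r n) * (coeff (p (r0 (r n))) i / M (r n)) - - coeff (p (r0 (r n))) j / M (r n) * (- coeff (q (r0 (r n))) i / M (r n)) \<noteq> 0" for n
      using det .
    show "(\<lambda>n. coeff (smult (coeff (q (r0 (r n))) j / M (r n)) (p (r0 (r n))) + smult (- coeff (p (r0 (r n))) j / M (r n)) (q (r0 (r n)))) k) \<longlonglongrightarrow> coeff P k" for k
      using P[of k] unfolding p'_def .
    show "(\<lambda>n. coeff (smult (- coeff (q (r0 (r n))) i / M (r n)) (p (r0 (r n))) + smult (coeff (p (r0 (r n))) i / M (r n)) (q (r0 (r n)))) k) \<longlonglongrightarrow> coeff Q k" for k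
      using Q[of k] unfolding q'_def .
    show "\<alpha> \<noteq> 0 \<or> \<beta> \<noteq> 0 \<Longrightarrow> smult \<beta> P - smult \<alpha> Q \<noteq> 0" for \<alpha> \<beta> using indep .
  qed
qed

text \<open>The matrix with rows \<open>(N1, N2)\<close>, \<open>(N3, N4)\<close> sends \<open>x, y, z\<close> to \<open>0, 1, \<infinity>\<close>.\<close>
abbreviation "N1 x y z \<equiv> y - (z::complex)"
abbreviation "N2 x y z \<equiv> - x * (y - (z::complex))"
abbreviation "N3 x y z \<equiv> y - (x::complex)"
abbreviation "N4 x y z \<equiv> - z * (y - (x::complex))"

lemma normaliser_det:
  assumes "distinct [x, y, z]" shows "N1 x y z * N4 x y z - N2 x y z * N3 x y z \<noteq> 0"
proof -
  have "N1 x y z * N4 x y z - N2 x y z * N3 x y z = (y - z) * (y - x) * (x - z)" by algebra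
  then show ?thesis using assms by auto
qed

lemma normaliser_values:
  assumes "distinct [x, y, z]"
  shows "lft (N1 x y z) (N2 x y z) (N3 x y z) (N4 x y z) (Some x) = Some 0"
    "lft (N1 x y z) (N2 x y z) (N3 x y z) (N4 x y z) (Some y) = Some 1"
    "lft (N1 x y z) (N2 x y z) (N3 x y z) (N4 x y z) (Some z) = None"
proof -
  have 1: "y \<noteq> z" "y \<noteq> x" "x \<noteq> z" using assms by auto
  have e: "N4 x y z + y * N3 x y z = (y - z) * (y - x)" "N2 x y z + y * N1 x y z = (y - z) * (y - x)"
    "N4 x y z + x * N3 x y z = (x - z) * (y - x)" "N2 x y z + x * N1 x y z = 0" "N4 x y z + z * N3 x y z = 0" by algebra+
  show "lft (N1 x y z) (N2 x y z) (N3 x y z) (N4 x y z) (Some x) = Some 0"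
    using 1 by (simp add: e)
  show "lft (N1 x y z) (N2 x y z) (N3 x y z) (N4 x y z) (Some y) = Some 1"
    using 1 by (simp add: e) (simp add: algebra_simps)
  show "lft (N1 x y z) (N2 x y z) (N3 x y z) (N4 x y z) (Some z) = None"
    using 1 by (simp add: e)
qed

lemma mobius_fixing:
  assumes "mobius \<phi>" "\<phi> (Some 0) = Some 0" "\<phi> (Some 1) = Some 1" "\<phi> None = None"
  shows "\<phi> = id"
proof -
  obtain a b c d where d: "a * d - b * c \<noteq> 0" "\<phi> = lft a b c d" using assms by (auto simp: mobius_def)
  have 0: "\<phi> (proj 0 1) = proj b d" "\<phi> (proj 1 1) = proj (a + b) (c + d)" "\<phi> (proj 1 0) = proj a c"
    using mat_proj[OF d(1), of 0 1] mat_proj[OF d(1), of 1 1] mat_proj[OF d(1), of 1 0] d(2) by auto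
  have "c = 0" using 0(3) assms(4) by (auto simp: proj_def split: if_splits)
  moreover have "b = 0" using 0(1) assms(2) by (auto simp: proj_def split: if_splits)
  moreover have "a = d" using 0(2) assms(3) calculation by (auto simp: proj_def split: if_splits)
  ultimately show ?thesis using d mat_id[of d] by simp
qed

lemma adjugate_det:
  fixes a b c d :: complex
  shows "a * d - b * c \<noteq> 0 \<Longrightarrow> d * a - - b * - c \<noteq> 0"
  by (simp add: mult.commute)

lemma mob_convergesI:
  assumes "\<And>n. \<phi> n = lft (a n) (b n) (c n) (d n)" "\<And>n. a n * d n - b n * c n \<noteq> 0"
    "a \<longlonglongrightarrow> a0" "b \<longlonglongrightarrow> b0" "c \<longlonglongrightarrow> c0" "d \<longlonglongrightarrow> d0" "a0 * d0 - b0 * c0 \<noteq> 0"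
  shows "mob_converges \<phi>"
  unfolding mob_converges_def using assms by blast

text \<open>A Moebius map is the normaliser of a triple followed by the inverse normaliser of the
  image triple. Both matrices are polynomial in the points and stay invertible in the limit because
  the limit triples are distinct.\<close>

lemma three_point_convergence:
  assumes A: "\<And>n. mobius (A n)"
    and x: "\<And>n. distinct [x n, y n, z n]" "distinct [x0, y0, z0]"
    and lx: "x \<longlonglongrightarrow> x0" "y \<longlonglongrightarrow> y0" "z \<longlonglongrightarrow> z0"
    and u: "\<And>n. A n (Some (x n)) = Some (u n)" "\<And>n. A n (Some (y n)) = Some (v n)" "\<And>n. A n (Some (z n)) = Some (w n)"
    and lu: "u \<longlonglongrightarrow> u0" "v \<longlonglongrightarrow> v0" "w \<longlonglongrightarrow> w0" and d0: "distinct [u0, v0, w0]"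
  shows "mob_converges A"
proof -
  have du: "distinct [u n, v n, w n]" for n
  proof -
    have i: "inj (A n)" using mobius_bij[OF A] bij_is_inj by blast
    show ?thesis using x(1)[of n] inj_eq[OF i, of "Some (x n)" "Some (y n)"]
        inj_eq[OF i, of "Some (x n)" "Some (z n)"] inj_eq[OF i, of "Some (y n)" "Some (z n)"] by (simp add: u)
  qed
  define M where "M n = lft (N1 (x n) (y n) (z n)) (N2 (x n) (y n) (z n)) (N3 (x n) (y n) (z n)) (N4 (x n) (y n) (z n))" for n
  define K where "K n = lft (N1 (u n) (v n) (w n)) (N2 (u n) (v n) (w n)) (N3 (u n) (v n) (w n)) (N4 (u n) (v n) (w n))" for n
  have mM: "mobius (M n)" and mK: "mobius (K n)" for n
    unfolding M_def K_def mobius_def using normaliser_det[OF x(1)] normaliser_det[OF du] by blast+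
  have vM: "M n (Some (x n)) = Some 0" "M n (Some (y n)) = Some 1" "M n (Some (z n)) = None" for n
    unfolding M_def by (rule normaliser_values[OF x(1)])+
  have vK: "K n (Some (u n)) = Some 0" "K n (Some (v n)) = Some 1" "K n (Some (w n)) = None" for n
    unfolding K_def by (rule normaliser_values[OF du])+
  have iM: "inv (M n) (Some 0) = Some (x n)" "inv (M n) (Some 1) = Some (y n)" "inv (M n) None = Some (z n)" for n
    using vM[of n] mobius_bij[OF mM] by (metis bij_inv_eq_iff)+
  have "K n \<circ> A n \<circ> inv (M n) = id" for n
    by (rule mobius_fixing) (use mobius_comp mobius_inv mM mK A iM u vK in auto)
  then have "K n (A n (inv (M n) (M n s))) = M n s" for n s by (metis comp_apply id_apply)
  then have KA: "K n (A n s) = M n s" for n s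
    using mobius_bij[OF mM] by (metis bij_is_inj inv_f_f)
  have AK: "A n = inv (K n) \<circ> M n" for n
    using KA mobius_bij[OF mK] by (metis (no_types, lifting) bij_inv_eq_iff comp_apply ext)
  note det = normaliser_det[OF du] normaliser_det[OF x(1)]
  have det': "N4 (u n) (v n) (w n) * N1 (u n) (v n) (w n) - - N2 (u n) (v n) (w n) * - N3 (u n) (v n) (w n) \<noteq> 0" for n
    by (rule adjugate_det[OF det(1)])
  have det0': "N4 u0 v0 w0 * N1 u0 v0 w0 - - N2 u0 v0 w0 * - N3 u0 v0 w0 \<noteq> 0"
    by (rule adjugate_det[OF normaliser_det[OF d0]])
  note C = mat_comp[OF det' det(2)] and C0 = mat_comp(2)[OF det0' normaliser_det[OF x(2)]]
  have A': "A n = lft (N4 (u n) (v n) (w n)) (- N2 (u n) (v n) (w n)) (- N3 (u n) (v n) (w n)) (N1 (u n) (v n) (w n)) \<circ>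
     lft (N1 (x n) (y n) (z n)) (N2 (x n) (y n) (z n)) (N3 (x n) (y n) (z n)) (N4 (x n) (y n) (z n))" for n
    unfolding AK unfolding K_def inv_mat[OF det(1)] unfolding M_def ..
  show ?thesis
    by (rule mob_convergesI[OF trans[OF A' C(1)] C(2) _ _ _ _ C0]) (intro tendsto_intros lx lu)+
qed

lemma mob_converges_limit:
  assumes "mob_converges \<phi>"
  obtains \<phi>0 where "mobius \<phi>0" "\<And>x l. x \<longlonglongrightarrow> l \<Longrightarrow> cs_tendsto (\<lambda>n. \<phi> n (Some (x n))) (\<phi>0 (Some l))"
proof -
  obtain a b c d :: "nat \<Rightarrow> complex" and a0 b0 c0 d0 where
    1: "\<And>n. a n * d n - b n * c n \<noteq> 0" "\<And>n. \<phi> n = lft (a n) (b n) (c n) (d n)" and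
    2: "a \<longlonglongrightarrow> a0" "b \<longlonglongrightarrow> b0" "c \<longlonglongrightarrow> c0" "d \<longlonglongrightarrow> d0" and 3: "a0 * d0 - b0 * c0 \<noteq> 0"
    using assms unfolding mob_converges_def by blast
  have "cs_tendsto (\<lambda>n. \<phi> n (Some (x n))) (lft a0 b0 c0 d0 (Some l))" if "x \<longlonglongrightarrow> l" for x l
  proof -
    have s: "Some y = proj y 1" for y by (simp add: proj_def)
    have "cs_tendsto (\<lambda>n. proj (a n * x n + b n * 1) (c n * x n + d n * 1)) (proj (a0 * l + b0 * 1) (c0 * l + d0 * 1))"
      by (intro cs_tendsto_proj tendsto_intros 2 that matrix_kernel[OF 3]) simp
    then show ?thesis unfolding s 1(2) using mat_proj[OF 1(1)] mat_proj[OF 3] by simp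
  qed
  moreover have "mobius (lft a0 b0 c0 d0)" using 3 by (auto simp: mobius_def)
  ultimately show thesis using that by blast
qed

section \<open>Stable trees from separated triples\<close>

text \<open>A stable tree described by the positions \<open>a v x\<close> of the marked points on
  the spheres of the internal vertices alone. Any three leaves meet at exactly one vertex, which is
  \<open>sep\<close> and \<open>sep_unique\<close>; having three distinct positions is
  stability.\<close>

locale split_tree =
  fixes X I :: "nat set" and a :: "nat \<Rightarrow> nat \<Rightarrow> complex"
  assumes finX: "finite X" and finI: "finite I" and disj: "X \<inter> I = {}" and cardX: "card X \<ge> 3"
    and ge3: "\<And>v. v \<in> I \<Longrightarrow> card (a v ` X) \<ge> 3"
    and sep: "\<And>x y z. x \<in> X \<Longrightarrow> y \<in> X \<Longrightarrow> z \<in> X \<Longrightarrow> distinct [x, y, z] \<Longrightarrow> \<exists>v\<in>I. distinct [a v x, a v y, a v z]"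
    and sep_unique: "\<And>v w x y z. v \<in> I \<Longrightarrow> w \<in> I \<Longrightarrow> x \<in> X \<Longrightarrow> y \<in> X \<Longrightarrow> z \<in> X \<Longrightarrow>
      distinct [a v x, a v y, a v z] \<Longrightarrow> distinct [a w x, a w y, a w z] \<Longrightarrow> v = w"
begin

definition VV :: "nat set" where "VV = X \<union> I"

definition fib :: "nat \<Rightarrow> nat \<Rightarrow> nat set" where "fib v x = {y \<in> X. a v y = a v x}"

text \<open>The blocks of a vertex are the traces on the leaves of the components of its complement.\<close>
definition bl :: "nat \<Rightarrow> nat set set" where
  "bl u = (if u \<in> I then fib u ` X else {X - {u}})"

definition EE :: "nat set set" where
  "EE = {{u, w} | u w. u \<in> VV \<and> w \<in> VV \<and> (\<exists>B\<in>bl u. X - B \<in> bl w)}"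

text \<open>All leaves in one branch have the same position (\<open>tI_TT\<close>), so the choice
  made by \<open>SOME\<close> is immaterial.\<close>

definition TT :: tos where
  "TT = \<lparr>tV = VV, tE = EE, tI = \<lambda>v e. Some (a v (SOME x. x \<in> X \<and> x \<in> branch VV EE v e))\<rparr>"

lemma third_value:
  assumes "v \<in> I" shows "\<exists>z\<in>X. a v z \<noteq> p \<and> a v z \<noteq> q"
proof (rule ccontr)
  assume "\<not> ?thesis"
  then have "a v ` X \<subseteq> {p, q}" by auto
  then have "card (a v ` X) \<le> card {p, q}" by (intro card_mono) auto
  also have "\<dots> \<le> 2" by (simp add: card_insert_if)
  finally show False using ge3[OF assms] by simp
qed

lemma bl_I: "v \<in> I \<Longrightarrow> bl v = fib v ` X"
  by (simp add: bl_def)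

lemma bl_X: "x \<in> X \<Longrightarrow> bl x = {X - {x}}"
  using disj by (auto simp: bl_def)

lemma two_others: "\<exists>y\<in>X. y \<noteq> x"
proof (rule ccontr)
  assume "\<not> ?thesis"
  then have "X \<subseteq> {x}" by auto
  then have "card X \<le> 1" using card_mono[of "{x}" X] by simp
  then show False using cardX by simp
qed

lemma bl_sub: "B \<in> bl u \<Longrightarrow> B \<subseteq> X"
  by (auto simp: bl_def fib_def split: if_splits)

lemma bl_ne: "B \<in> bl u \<Longrightarrow> B \<noteq> {}"
  using two_others by (auto simp: bl_def fib_def split: if_splits)

lemma bl_proper: "u \<in> VV \<Longrightarrow> B \<in> bl u \<Longrightarrow> B \<noteq> X"
proof (cases "u \<in> I")
  case True
  assume "B \<in> bl u"
  then obtain x where x: "x \<in> X" "B = fib u x" using True by (auto simp: bl_I)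
  obtain z where "z \<in> X" "a u z \<noteq> a u x" using third_value[OF True] by blast
  then show ?thesis using x by (auto simp: fib_def)
next
  case False
  assume "u \<in> VV" "B \<in> bl u"
  then show ?thesis using False by (auto simp: bl_X VV_def)
qed

lemma bl_disj: "B \<in> bl u \<Longrightarrow> B' \<in> bl u \<Longrightarrow> B \<noteq> B' \<Longrightarrow> B \<inter> B' = {}"
  by (auto simp: bl_def fib_def split: if_splits)

lemma bl_cover: "x \<in> X \<Longrightarrow> x \<noteq> u \<Longrightarrow> \<exists>B\<in>bl u. x \<in> B"
  by (auto simp: bl_def fib_def)

text \<open>An internal vertex has a third block; a leaf lies in the complement of its only
  block.\<close>

lemma bl_compl: 
  assumes "u \<in> VV" "B \<in> bl u" shows "X - B \<notin> bl u"
proof (cases "u \<in> I")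
  case True
  obtain x where x: "x \<in> X" "B = fib u x" using True assms by (auto simp: bl_I)
  show ?thesis
  proof
    assume "X - B \<in> bl u"
    then obtain y where y: "y \<in> X" "X - B = fib u y" using True by (auto simp: bl_I)
    obtain z where "z \<in> X" "a u z \<noteq> a u x" "a u z \<noteq> a u y" using third_value[OF True] by blast
    then show False using x y by (auto simp: fib_def)
  qed
next
  case False
  then have "u \<in> X" using assms by (auto simp: VV_def)
  then have "bl u = {X - {u}}" "X - (X - {u}) \<noteq> X - {u}" by (auto simp: bl_X)
  then show ?thesis using assms by auto
qed

text \<open>Koenig's theorem for the incidence matrix of the two partitions: without three cells in
  general position, one row and one column cover everything.\<close>
lemma common_line:
  assumes v: "v \<in> I" and w: "w \<in> I" and ne: "v \<noteq> w"
  shows "\<exists>x\<in>X. \<exists>y\<in>X. X \<subseteq> fib v x \<union> fib w y"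
proof -
  have no: False if "x \<in> X" "y \<in> X" "z \<in> X" "distinct [a v x, a v y, a v z]" "distinct [a w x, a w y, a w z]" for x y z
    using sep_unique[OF v w that] ne by blast
  have no: False if "x \<in> X" "y \<in> X" "z \<in> X" "a v x \<noteq> a v y" "a v x \<noteq> a v z" "a v y \<noteq> a v z"
      "a w x \<noteq> a w y" "a w x \<noteq> a w z" "a w y \<noteq> a w z" for x y z
    using no[of x y z] that by simp
  obtain x0 where x0: "x0 \<in> X" using two_others by blast
  obtain y0 where y0: "y0 \<in> X" "a v y0 \<noteq> a v x0" using third_value[OF v] by blast
  obtain z0 where z0: "z0 \<in> X" "a w z0 \<noteq> a w x0" "a w z0 \<noteq> a w y0" using third_value[OF w] by blast
  \<comment> \<open>Call the blocks of v rows and those of w columns. Some two points differ in both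
    row and column.\<close>
  have "\<exists>x\<in>X. \<exists>y\<in>X. a v x \<noteq> a v y \<and> a w x \<noteq> a w y" using x0 y0 z0 by metis
  then obtain x1 y1 where xy1: "x1 \<in> X" "y1 \<in> X" "a v x1 \<noteq> a v y1" "a w x1 \<noteq> a w y1" by blast
  obtain z where z: "z \<in> X" "a v z \<noteq> a v x1" "a v z \<noteq> a v y1" using third_value[OF v] by blast
  have "a w z = a w x1 \<or> a w z = a w y1" using no[of x1 y1 z] xy1 z by metis
  \<comment> \<open>A point off both rows must share a column with one of the two; the names are
    arranged so that it is the column of y.\<close>
  then obtain x y where xy: "x \<in> X" "y \<in> X" "a v x \<noteq> a v y" "a w x \<noteq> a w y"
    and z: "z \<in> X" "a v z \<noteq> a v x" "a v z \<noteq> a v y" "a w z = a w y"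
    using xy1 z by metis
  obtain t where t: "t \<in> X" "a w t \<noteq> a w x" "a w t \<noteq> a w y" using third_value[OF w] by blast
  have "a v t = a v x \<or> a v t = a v y" using no[of x y t] xy t by metis
  moreover have "a v t \<noteq> a v y" using no[of x z t] xy z t by metis
  ultimately have tx: "a v t = a v x" by blast
  \<comment> \<open>Now x, t lie in one row and y, z in one column. For a point s off this row and
    this column, one of x, t avoids the column of s and one of y, z avoids its row; with s they
    would be separated by both v and w.\<close>
  have "s \<in> fib v x \<union> fib w y" if s: "s \<in> X" for s
  proof (rule ccontr)
    assume "s \<notin> fib v x \<union> fib w y"
    then have s': "a v s \<noteq> a v x" "a w s \<noteq> a w y" using s by (auto simp: fib_def)
    obtain p where p: "p \<in> X" "a v p = a v x" "a w p \<noteq> a w s" "a w p \<noteq> a w y"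
      using xy t tx by metis
    obtain q where q: "q \<in> X" "a w q = a w y" "a v q \<noteq> a v s" "a v q \<noteq> a v x"
      using xy z by metis
    show False using no[OF s p(1) q(1)] p q s' by metis
  qed
  then show ?thesis using xy by blast
qed

text \<open>The two blocks are the directions in which the vertices see each other. For internal
  vertices this is \<open>common_line\<close>; a leaf x contributes everything but itself, and the
  block of the other vertex at x adds the rest.\<close>

lemma bl_two_cover:
  assumes "u \<in> VV" "w \<in> VV" "u \<noteq> w"
  shows "\<exists>B\<in>bl u. \<exists>B'\<in>bl w. B \<union> B' = X"
proof -
  have leaf: "\<exists>B\<in>bl x. \<exists>B'\<in>bl w. B \<union> B' = X" if x: "x \<in> X" "x \<noteq> w" for x w
  proof -
    obtain B' where "B' \<in> bl w" "x \<in> B'" using bl_cover[OF x] by blast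
    then show ?thesis using x bl_sub[of B' w] by (auto simp: bl_X)
  qed
  consider "u \<in> X" | "w \<in> X" | "u \<in> I" "w \<in> I" using assms by (auto simp: VV_def)
  then show ?thesis
  proof cases
    case 1 then show ?thesis using leaf assms by blast
  next
    case 2 then show ?thesis using leaf[of w u] assms by (metis sup_commute)
  next
    case 3
    from common_line[OF this assms(3)] obtain x y where "x \<in> X" "y \<in> X" "X \<subseteq> fib u x \<union> fib w y" by blast
    then have "fib u x \<in> bl u" "fib w y \<in> bl w" "fib u x \<union> fib w y = X" using 3 by (auto simp: bl_I fib_def)
    then show ?thesis by blast
  qed
qed

text \<open>A covering pair of blocks for two different owners of D would show that one of them owns
  both D and its complement, which \<open>bl_compl\<close> forbids.\<close>

lemma bl_unique:
  assumes "w \<in> VV" "w' \<in> VV" "D \<in> bl w" "D \<in> bl w'" shows "w = w'"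
proof (rule ccontr)
  assume "w \<noteq> w'"
  then obtain B B' where B: "B \<in> bl w" "B' \<in> bl w'" "B \<union> B' = X" using bl_two_cover assms by blast
  have "B = D \<Longrightarrow> False"
  proof -
    assume D: "B = D"
    then have "B' \<noteq> D" using B(3) bl_proper[OF assms(1,3)] by auto
    then have "B' \<inter> D = {}" using bl_disj B(2) assms(4) by blast
    then have "B' = X - D" using B(3) D bl_sub[OF B(2)] by auto
    then show False using bl_compl[OF assms(2,4)] B(2) by simp
  qed
  moreover have "B \<noteq> D \<Longrightarrow> False"
  proof -
    assume "B \<noteq> D"
    then have d: "B \<inter> D = {}" using bl_disj B(1) assms(3) by blast
    then have "D \<subseteq> B'" using B(3) bl_sub[OF assms(3)] by auto
    then have "B' = D" using bl_disj[OF B(2) assms(4)] bl_ne[OF assms(3)] by blast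
    then have "B = X - D" using B(3) d bl_sub[OF B(1)] by auto
    then show False using bl_compl[OF assms(1,3)] B(1) by simp
  qed
  ultimately show False by blast
qed

text \<open>Existence of the far end of an edge. A singleton leads to its leaf. Otherwise fix a
  point outside B; among the vertices separating it from two points of B, the one whose block at
  that point is smallest has exactly the complement of B as this block.\<close>

lemma bl_next:
  assumes u: "u \<in> VV" and B: "B \<in> bl u" shows "\<exists>w\<in>VV. X - B \<in> bl w"
proof (cases "\<exists>x. B = {x}")
  case True
  then obtain x where x: "B = {x}" by blast
  then have "x \<in> X" using bl_sub[OF B] by auto
  then show ?thesis using x by (intro bexI[of _ x]) (auto simp: bl_X VV_def)
next
  case False
  obtain o' where o': "o' \<in> X" "o' \<notin> B" using bl_proper[OF u B] bl_sub[OF B] by blast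
  define ok where "ok w \<longleftrightarrow> w \<in> I \<and> (\<exists>x\<in>B. \<exists>y\<in>B. distinct [a w o', a w x, a w y])" for w
  have ex: "\<exists>w. ok w \<and> distinct [a w o', a w x, a w y]" if "x \<in> B" "y \<in> B" "x \<noteq> y" for x y
  proof -
    have "\<exists>v\<in>I. distinct [a v o', a v x, a v y]"
      using that o' bl_sub[OF B] by (intro sep) auto
    then show ?thesis using that unfolding ok_def by blast
  qed
  have "\<exists>x\<in>B. \<exists>y\<in>B. x \<noteq> y" using False bl_ne[OF B] by blast
  then obtain w0 where "ok w0" using ex by blast
  then obtain w where w: "ok w" "\<And>w'. ok w' \<Longrightarrow> card (fib w o') \<le> card (fib w' o')"
    using ex_has_least_nat[of ok w0 "\<lambda>w. card (fib w o')"] by blast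
  obtain x y where xy: "w \<in> I" "x \<in> B" "y \<in> B" "distinct [a w o', a w x, a w y]" using w(1) by (auto simp: ok_def)
  have blk: "B2 = fib w' o'" if "B2 \<in> bl w'" "o' \<in> B2" "w' \<in> I" for B2 w'
    using that by (auto simp: bl_I fib_def)
  have uw: "u \<noteq> w"
  proof
    assume "u = w"
    then obtain p where "B = fib w p" using B xy(1) by (auto simp: bl_I)
    then show False using xy by (auto simp: fib_def)
  qed
  have wV: "w \<in> VV" using xy(1) by (simp add: VV_def)
  obtain B1 B2 where B12: "B1 \<in> bl u" "B2 \<in> bl w" "B1 \<union> B2 = X" using bl_two_cover[OF u wV uw] by blast
  have xyX: "x \<in> X" "y \<in> X" using xy bl_sub[OF B] by auto
  \<comment> \<open>Otherwise B, and with it x and y, would lie in a single block of w, which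
    separates them.\<close>
  have "B1 = B"
  proof (rule ccontr)
    assume "B1 \<noteq> B"
    then have "x \<in> B2" "y \<in> B2" using bl_disj[OF B12(1) B] B12(3) xy xyX by blast+
    then show False using B12(2) xy by (auto simp: bl_I fib_def)
  qed
  then have sub: "X - B \<subseteq> fib w o'" using B12 blk[OF B12(2) _ xy(1)] o' by blast
  \<comment> \<open>A point x' of B on the side of \<open>o'\<close> would give a vertex separating
    \<open>o'\<close>, x' and x, whose block at \<open>o'\<close> is strictly smaller.\<close>
  have "fib w o' \<inter> B = {}"
  proof (rule ccontr)
    assume "fib w o' \<inter> B \<noteq> {}"
    then obtain x' where x': "x' \<in> B" "x' \<in> X" "a w x' = a w o'" by (auto simp: fib_def)
    have "x' \<noteq> x" using x' xy by auto
    then obtain w' where w': "ok w'" "distinct [a w' o', a w' x', a w' x]" using ex[of x' x] x' xy by blast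
    have w'I: "w' \<in> I" using w'(1) by (simp add: ok_def)
    have "w' \<noteq> w" using w'(2) x' by auto
    then obtain C1 C2 where C: "C1 \<in> bl w" "C2 \<in> bl w'" "C1 \<union> C2 = X"
      using bl_two_cover[of w w'] wV w'I by (auto simp: VV_def)
    have "C1 = fib w o'"
    proof (rule ccontr)
      assume ne: "C1 \<noteq> fib w o'"
      have "fib w o' \<in> bl w" using xy(1) o' by (simp add: bl_I)
      then have "C1 \<inter> fib w o' = {}" using bl_disj C(1) ne by blast
      then have "o' \<in> C2" "x' \<in> C2" using C(3) o' x' by (auto simp: fib_def)
      then show False using C(2) w'I w'(2) by (auto simp: bl_I fib_def)
    qed
    moreover have "x \<notin> fib w o'" using xy by (auto simp: fib_def)
    ultimately have "x \<in> C2" using C(3) xyX by auto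
    then have "fib w' o' \<inter> C2 = {}" using C(2) w'I w'(2) by (auto simp: bl_I fib_def)
    then have "fib w' o' \<subseteq> fib w o'" using C(3) \<open>C1 = fib w o'\<close> by (auto simp: fib_def)
    moreover have "x' \<in> fib w o'" "x' \<notin> fib w' o'" using x' w'(2) by (auto simp: fib_def)
    ultimately have "fib w' o' \<subset> fib w o'" by blast
    then have "card (fib w' o') < card (fib w o')" using finX by (intro psubset_card_mono) (auto simp: fib_def)
    then show False using w(2)[OF w'(1)] by simp
  qed
  then have "X - B = fib w o'" using sub by (auto simp: fib_def)
  then show ?thesis using wV xy(1) o' by (intro bexI[of _ w]) (auto simp: bl_I)
qed

section \<open>Edges, paths and the absence of cycles\<close>

lemma adj_iff: "adj EE u w \<longleftrightarrow> u \<in> VV \<and> w \<in> VV \<and> (\<exists>B\<in>bl u. X - B \<in> bl w)"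
proof
  assume "adj EE u w"
  then obtain u' w' B where e: "{u, w} = {u', w'}" "u' \<in> VV" "w' \<in> VV" "B \<in> bl u'" "X - B \<in> bl w'"
    by (auto simp: adj_def EE_def)
  have "X - (X - B) = B" using bl_sub[OF e(4)] by auto
  then show "u \<in> VV \<and> w \<in> VV \<and> (\<exists>B\<in>bl u. X - B \<in> bl w)"
    using e by (auto simp: doubleton_eq_iff intro: bexI[of _ "X - B"])
qed (auto simp: adj_def EE_def)

lemma adj_sym: "adj EE u w \<Longrightarrow> adj EE w u"
  by (simp add: adj_def insert_commute)

lemma adj_ne: "adj EE u w \<Longrightarrow> u \<noteq> w"
  using bl_compl by (auto simp: adj_iff)

text \<open>Going on from w without turning back, one sees strictly fewer leaves ahead; this
  monotonicity drives the arguments on paths.\<close>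

lemma block_shrinks:
  assumes "w \<in> VV" "X - B \<in> bl w" "B' \<in> bl w" "B' \<noteq> X - B" "B \<subseteq> X"
  shows "B' \<subset> B"
proof -
  have "B' \<inter> (X - B) = {}" using bl_disj[OF assms(3,2,4)] .
  then have "B' \<subseteq> B" using bl_sub[OF assms(3)] by auto
  moreover have "B' \<noteq> B" using bl_compl[OF assms(1,3)] assms(2) by auto
  ultimately show ?thesis by blast
qed

text \<open>The sets of leaves ahead would decrease strictly for ever inside a finite set.\<close>

lemma no_infinite_walk:
  assumes adj: "\<And>i. adj EE (c i) (c (Suc i))" and nb: "\<And>i. c (Suc (Suc i)) \<noteq> c i"
  shows False
proof -
  have "\<forall>i. \<exists>B. B \<in> bl (c i) \<and> X - B \<in> bl (c (Suc i))" using adj by (auto simp: adj_iff)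
  then obtain B where B: "\<And>i. B i \<in> bl (c i)" "\<And>i. X - B i \<in> bl (c (Suc i))" by metis
  have V: "c i \<in> VV" for i using adj[of i] by (simp add: adj_iff)
  have "B (Suc i) \<subset> B i" for i
  proof (rule block_shrinks[OF V[of "Suc i"] B(2) B(1)])
    show "B i \<subseteq> X" using bl_sub[OF B(1)] .
    show "B (Suc i) \<noteq> X - B i"
    proof
      assume "B (Suc i) = X - B i"
      then have "X - B (Suc i) = B i" using bl_sub[OF B(1)[of i]] by auto
      then have "B i \<in> bl (c (Suc (Suc i)))" using B(2)[of "Suc i"] by simp
      then show False using bl_unique[OF V V] B(1) nb by blast
    qed
  qed
  then have lt: "card (B (Suc i)) < card (B i)" for i
    using finX bl_sub[OF B(1)] by (meson finite_subset psubset_card_mono)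
  have "card (B i) + i \<le> card (B 0)" for i
    by (induction i) (use lt in \<open>auto simp: Suc_le_eq intro: less_le_trans\<close>, metis add_less_mono1 add_Suc_right less_le_trans Suc_leI lt)
  from this[of "Suc (card (B 0))"] show False by simp
qed

text \<open>A cycle traversed periodically is an infinite walk; a step back would force its length
  to divide 2.\<close>

lemma no_cycle: "\<not> is_cycle EE vs"
proof
  assume "is_cycle EE vs"
  then have c: "length vs \<ge> 3" "distinct vs" "\<And>i. Suc i < length vs \<Longrightarrow> adj EE (vs ! i) (vs ! Suc i)"
    "adj EE (last vs) (hd vs)" by (auto simp: is_cycle_def)
  define n where "n = length vs"
  define c where "c i = vs ! (i mod n)" for i
  have n: "n \<ge> 3" "vs \<noteq> []" using c(1) by (auto simp: n_def)
  have "adj EE (c i) (c (Suc i))" for i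
  proof (cases "Suc (i mod n) < n")
    case True
    then have "Suc i mod n = Suc (i mod n)" by (simp add: mod_Suc)
    then show ?thesis using c(3) True by (simp add: c_def n_def)
  next
    case False
    moreover have "i mod n < n" using n by simp
    ultimately have "i mod n = n - 1" "Suc i mod n = 0" by (auto simp: mod_Suc)
    then show ?thesis using c(4) n by (simp add: c_def n_def last_conv_nth hd_conv_nth)
  qed
  moreover have "c (Suc (Suc i)) \<noteq> c i" for i
  proof
    assume "c (Suc (Suc i)) = c i"
    then have "Suc (Suc i) mod n = i mod n"
      using c(2) n by (simp add: c_def n_def nth_eq_iff_index_eq)
    then have "n dvd 2" using mod_eq_dvd_iff_nat[of i "Suc (Suc i)" n] by simp
    then show False using n dvd_imp_le[of n 2] by simp
  qed
  ultimately show False using no_infinite_walk by blast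
qed

text \<open>The path heads for \<open>x0\<close> with strictly fewer leaves ahead than
  \<open>Bv\<close>, so it never meets v, from where the whole of \<open>Bv\<close> lies
  ahead.\<close>

lemma descend:
  assumes v: "v \<in> VV" "Bv \<in> bl v" "x0 \<in> Bv"
  shows "u \<in> VV \<Longrightarrow> B \<in> bl u \<Longrightarrow> x0 \<in> B \<Longrightarrow> B \<subset> Bv \<Longrightarrow> conn_avoid EE v u x0"
proof (induction "card B" arbitrary: u B rule: less_induct)
  case less
  obtain w where w: "w \<in> VV" "X - B \<in> bl w" using bl_next less.prems by blast
  have x0: "x0 \<in> X" using v bl_sub by auto
  have uv: "u \<noteq> v" using bl_disj[OF less.prems(2), of Bv] v less.prems by auto
  have wv: "w \<noteq> v"
  proof
    assume "w = v"
    then have "X - B = Bv \<or> (X - B) \<inter> Bv = {}" using bl_disj w(2) v(2) by blast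
    then show False using less.prems v bl_sub[OF v(2)] by auto
  qed
  have ad: "adj EE u w" using w less.prems by (auto simp: adj_iff)
  have "conn_avoid EE v w x0"
  proof (cases "w = x0")
    case True
    then show ?thesis by (simp add: conn_avoid_def)
  next
    case False
    then obtain B' where B': "B' \<in> bl w" "x0 \<in> B'" using bl_cover[OF x0, of w] by auto
    have "B' \<noteq> X - B" using B' less.prems by auto
    then have "B' \<subset> B" using block_shrinks w B' bl_sub[OF less.prems(2)] by blast
    then have "card B' < card B" using finX bl_sub[OF less.prems(2)] by (meson finite_subset psubset_card_mono)
    then show ?thesis using less.hyps w(1) B' \<open>B' \<subset> B\<close> less.prems(4) by blast
  qed
  moreover have "adj EE u w \<and> u \<noteq> v \<and> w \<noteq> v" using ad uv wv by simp
  ultimately show ?case unfolding conn_avoid_def by (rule converse_rtranclp_into_rtranclp[rotated])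
qed

lemma conn_next:
  assumes "v \<in> VV" "w \<in> VV" "B \<in> bl v" "X - B \<in> bl w" "x \<in> B"
  shows "conn_avoid EE v w x"
proof (cases "w = x")
  case True
  then show ?thesis by (simp add: conn_avoid_def)
next
  case False
  have "x \<in> X" using assms bl_sub by auto
  then obtain B' where B': "B' \<in> bl w" "x \<in> B'" using bl_cover False by metis
  have "B' \<noteq> X - B" using B' assms by auto
  then have "B' \<subset> B" using block_shrinks assms B' bl_sub[OF assms(3)] by blast
  then show ?thesis using descend[OF assms(1,3,5) assms(2) B'] by blast
qed

lemma conn_avoid_adj: "conn_avoid E v u w \<Longrightarrow> (adj E)\<^sup>*\<^sup>* u w"
  unfolding conn_avoid_def by (rule rtranclp_mono[THEN predicate2D, rotated]) auto

lemma connected_leaf: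
  assumes "u \<in> VV" "x \<in> X" shows "(adj EE)\<^sup>*\<^sup>* u x"
proof (cases "u = x")
  case False
  then obtain B where B: "B \<in> bl u" "x \<in> B" using bl_cover[OF assms(2), of u] by auto
  then obtain w where w: "w \<in> VV" "X - B \<in> bl w" using bl_next[OF assms(1)] by blast
  have "adj EE u w" using w B assms by (auto simp: adj_iff)
  then show ?thesis using conn_avoid_adj[OF conn_next[OF assms(1) w(1) B(1) w(2) B(2)]]
    by (rule converse_rtranclp_into_rtranclp)
qed simp

text \<open>The invariant of a path that enters the direction B and avoids v: the leaves outside B
  always lie in a single block, the way back to v.\<close>

lemma conn_invariant:
  assumes v: "v \<in> VV" "B \<in> bl v" and w: "w \<in> VV" "X - B \<in> bl w"
    and c: "conn_avoid EE v w u"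
  shows "\<exists>D\<in>bl u. X - B \<subseteq> D"
  using c unfolding conn_avoid_def
proof (induction rule: rtranclp_induct)
  case base
  then show ?case using w by blast
next
  case (step u u')
  then obtain D where D: "D \<in> bl u" "X - B \<subseteq> D" by blast
  have V: "u \<in> VV" "u' \<in> VV" "u' \<noteq> v" using step by (auto simp: adj_iff)
  obtain G where G: "G \<in> bl u" "X - G \<in> bl u'" using step by (auto simp: adj_iff)
  obtain D1 D2 where D12: "D1 \<in> bl v" "D2 \<in> bl u'" "D1 \<union> D2 = X"
    using bl_two_cover[OF v(1) V(2)] V(3) by metis
  show ?case
  proof (cases "D1 = B \<or> G \<noteq> D")
    case True
    then show ?thesis
    proof
      assume "D1 = B" then show ?thesis using D12 by (intro bexI[of _ D2]) auto
    next
      assume "G \<noteq> D"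
      then have "G \<inter> D = {}" using bl_disj G(1) D(1) by blast
      then show ?thesis using D G(2) by (intro bexI[of _ "X - G"]) auto
    qed
  next
    case False
    \<comment> \<open>Here the path steps back through D itself; then B would be a block of
      \<open>u'\<close>, so \<open>u'\<close> would be v.\<close>
    then have "B \<subseteq> D2" using bl_disj[OF D12(1) v(2)] D12(3) bl_sub[OF v(2)] by blast
    moreover have "X - D \<subseteq> B" using D by auto
    moreover have "X - D \<noteq> {}" "X - D \<in> bl u'" using G(2) False bl_ne by auto
    ultimately have "X - D = D2" using bl_disj[OF _ D12(2), of "X - D"] by blast
    then have "B = D2" using \<open>B \<subseteq> D2\<close> \<open>X - D \<subseteq> B\<close> by auto
    then show ?thesis using bl_unique[OF V(2) v(1) D12(2)] v(2) V(3) by auto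
  qed
qed

text \<open>Links the branches of the graph with the blocks it was built from: one inclusion is
  \<open>conn_next\<close>, the other the invariant, since the only block of a leaf x omits
  x.\<close>

lemma branch_iff:
  assumes v: "v \<in> VV" "B \<in> bl v" and w: "w \<in> VV" "X - B \<in> bl w" and x: "x \<in> X" "x \<noteq> v"
  shows "x \<in> branch VV EE v {v, w} \<longleftrightarrow> x \<in> B"
proof
  have wv: "w \<noteq> v" using adj_ne[of v w] v w by (auto simp: adj_iff)
  show "x \<in> B \<Longrightarrow> x \<in> branch VV EE v {v, w}"
    using conn_next[OF v(1) w(1) v(2) w(2)] x wv by (auto simp: branch_def VV_def)
  assume "x \<in> branch VV EE v {v, w}"
  then have "conn_avoid EE v w x" by (auto simp: branch_def)
  then obtain D where "D \<in> bl x" "X - B \<subseteq> D" using conn_invariant[OF v w] by blast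
  then show "x \<in> B" using x(1) by (auto simp: bl_X)
qed

lemma edges_at_iff: "e \<in> edges_at EE v \<longleftrightarrow> (\<exists>w. e = {v, w} \<and> adj EE v w)"
proof
  assume "e \<in> edges_at EE v"
  then have e: "e \<in> EE" "v \<in> e" by (auto simp: edges_at_def)
  then obtain p q where pq: "e = {p, q}" by (auto simp: EE_def)
  then have "v = p \<or> v = q" using e(2) by auto
  then obtain w where "e = {v, w}" using pq by (metis insert_commute)
  then show "\<exists>w. e = {v, w} \<and> adj EE v w" using e(1) by (auto simp: adj_def)
qed (auto simp: adj_def edges_at_def)

text \<open>Each block has exactly one vertex across, and different blocks lead to different
  neighbours.\<close>

lemma valence_eq:
  assumes "u \<in> VV" shows "valence EE u = card (bl u)"
proof -
  have "\<forall>B\<in>bl u. \<exists>w. w \<in> VV \<and> X - B \<in> bl w" using bl_next[OF assms] by blast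
  then obtain nx where nx: "\<And>B. B \<in> bl u \<Longrightarrow> nx B \<in> VV \<and> X - B \<in> bl (nx B)" by metis
  have "inj_on (\<lambda>B. {u, nx B}) (bl u)"
  proof (rule inj_onI, rule ccontr)
    fix B B' assume B: "B \<in> bl u" "B' \<in> bl u" "{u, nx B} = {u, nx B'}" "B \<noteq> B'"
    then have eq: "nx B = nx B'" by (auto simp: doubleton_eq_iff)
    have s: "B \<subseteq> X" "B' \<subseteq> X" using B bl_sub by auto
    have d: "B \<inter> B' = {}" using bl_disj B by blast
    have "X - B \<noteq> X - B'" using B(4) s by auto
    then have "(X - B) \<inter> (X - B') = {}" using bl_disj nx B eq by metis
    then have "B' = X - B" using s d by auto
    then show False using bl_compl[OF assms B(1)] B(2) by simp
  qed
  moreover have "edges_at EE u = (\<lambda>B. {u, nx B}) ` bl u"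
  proof
    show "(\<lambda>B. {u, nx B}) ` bl u \<subseteq> edges_at EE u"
    proof (rule image_subsetI)
      fix B assume B: "B \<in> bl u"
      then have "adj EE u (nx B)" using nx[OF B] assms by (auto simp: adj_iff)
      then show "{u, nx B} \<in> edges_at EE u" by (auto simp: edges_at_iff)
    qed
    show "edges_at EE u \<subseteq> (\<lambda>B. {u, nx B}) ` bl u"
    proof
      fix e assume "e \<in> edges_at EE u"
      then obtain w B where w: "e = {u, w}" "w \<in> VV" "B \<in> bl u" "X - B \<in> bl w" by (auto simp: edges_at_iff adj_iff)
      then have "w = nx B" using bl_unique nx by metis
      then show "e \<in> (\<lambda>B. {u, nx B}) ` bl u" using w by blast
    qed
  qed
  ultimately show ?thesis by (simp add: valence_def card_image)
qed

lemma valence_leaf: "x \<in> X \<Longrightarrow> valence EE x = 1"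
  by (simp add: valence_eq VV_def bl_X)

lemma valence_internal:
  assumes "v \<in> I" shows "valence EE v \<ge> 3"
proof -
  have "a v ` X = (\<lambda>B. a v (SOME x. x \<in> B)) ` bl v"
  proof -
    have "a v (SOME y. y \<in> fib v x) = a v x" if "x \<in> X" for x
    proof -
      have "x \<in> fib v x" using that by (simp add: fib_def)
      then have "(SOME y. y \<in> fib v x) \<in> fib v x" by (rule someI[where P = "\<lambda>y. y \<in> fib v x"])
      then show ?thesis by (simp add: fib_def)
    qed
    then show ?thesis using assms by (auto simp: bl_I image_image)
  qed
  then have "card (a v ` X) \<le> card (bl v)" using finX assms by (simp add: bl_I card_image_le)
  then show ?thesis using ge3[OF assms] valence_eq[of v] assms by (simp add: VV_def)
qed

section \<open>The tree of spheres and its marked points\<close>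

lemma leaves_eq: "leaves VV EE = X"
  using valence_leaf valence_internal disj by (force simp: leaves_def VV_def)

lemma internal_eq: "internal VV EE = I"
  using disj unfolding internal_def leaves_eq by (auto simp: VV_def)

lemma IV_TT: "IV TT = I"
  by (simp add: TT_def internal_eq)

lemma tV_TT: "tV TT = X \<union> I"
  by (simp add: TT_def VV_def)

lemma is_tree_TT: "is_tree VV EE"
  unfolding is_tree_def
proof (intro conjI ballI)
  show "finite VV" "VV \<noteq> {}" using finX finI cardX by (auto simp: VV_def)
  fix e assume "e \<in> EE"
  then obtain u w where "e = {u, w}" "adj EE u w" unfolding adj_def EE_def by blast
  then show "\<exists>u w. u \<noteq> w \<and> u \<in> VV \<and> w \<in> VV \<and> e = {u, w}" using adj_ne adj_iff by blast
next
  fix u w assume uw: "u \<in> VV" "w \<in> VV"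
  obtain x where x: "x \<in> X" using two_others by blast
  have "symp (adj EE)" using adj_sym by (auto intro: sympI)
  then have "symp ((adj EE)\<^sup>*\<^sup>*)" by (rule symp_rtranclp)
  then have "(adj EE)\<^sup>*\<^sup>* x w" using connected_leaf[OF uw(2) x] by (auto dest: sympD)
  then show "(adj EE)\<^sup>*\<^sup>* u w" using connected_leaf[OF uw(1) x] by auto
next
  show "\<nexists>vs. is_cycle EE vs" using no_cycle by blast
qed

lemma tI_TT:
  assumes v: "v \<in> I" and w: "adj EE v w" and B: "B \<in> bl v" "X - B \<in> bl w" "x \<in> B"
  shows "tI TT v {v, w} = Some (a v x)"
proof -
  have V: "v \<in> VV" "w \<in> VV" using w by (auto simp: adj_iff)
  have xX: "x \<in> X" using B bl_sub by auto
  define y where "y = (SOME x. x \<in> X \<and> x \<in> branch VV EE v {v, w})"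
  have ne: "z \<noteq> v" if "z \<in> X" for z using that v disj by auto
  have "x \<in> X \<and> x \<in> branch VV EE v {v, w}" using branch_iff[OF V(1) B(1) V(2) B(2) xX] ne xX B by auto
  then have "y \<in> X \<and> y \<in> branch VV EE v {v, w}" unfolding y_def by (rule someI)
  then have "y \<in> B" using branch_iff[OF V(1) B(1) V(2) B(2), of y] ne by auto
  then have "a v y = a v x" using B v by (auto simp: bl_I fib_def)
  then show ?thesis by (simp add: TT_def y_def)
qed

lemma tree_of_spheres_TT: "tree_of_spheres X TT"
  unfolding tree_of_spheres_def
proof (intro conjI ballI)
  show "marked_stable_tree X (tV TT) (tE TT)"
    unfolding marked_stable_tree_def using is_tree_TT finX cardX leaves_eq internal_eq valence_internal
    by (simp add: TT_def)
  fix v assume "v \<in> IV TT"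
  then have v: "v \<in> I" by (simp add: IV_TT)
  show "inj_on (tI TT v) (edges_at (tE TT) v)"
  proof (rule inj_onI)
    fix e e' assume e: "e \<in> edges_at (tE TT) v" "e' \<in> edges_at (tE TT) v" "tI TT v e = tI TT v e'"
    then obtain w w' where w: "e = {v, w}" "adj EE v w" "e' = {v, w'}" "adj EE v w'"
      by (auto simp: TT_def edges_at_iff)
    then obtain B B' where B: "B \<in> bl v" "X - B \<in> bl w" "B' \<in> bl v" "X - B' \<in> bl w'" by (auto simp: adj_iff)
    obtain x x' where x: "x \<in> B" "x' \<in> B'" using bl_ne B by blast
    have "a v x = a v x'" using e(3) tI_TT[OF v w(2) B(1,2) x(1)] tI_TT[OF v w(4) B(3,4) x(2)] w by simp
    then have "B = B'" using B x v by (auto simp: bl_I fib_def)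
    then show "e = e'" using bl_unique w B by (metis adj_iff)
  qed
qed

lemma edge_of_leaf:
  assumes "v \<in> I" "x \<in> X"
  shows "\<exists>w. adj EE v w \<and> fib v x \<in> bl v \<and> X - fib v x \<in> bl w"
proof -
  have v: "v \<in> VV" using assms by (simp add: VV_def)
  have b: "fib v x \<in> bl v" using assms by (simp add: bl_I)
  then show ?thesis using bl_next[OF v b] v by (auto simp: adj_iff)
qed

lemma amark_TT:
  assumes "v \<in> I" "x \<in> X" shows "amark TT v x = Some (a v x)"
proof -
  have v: "v \<in> VV" "x \<noteq> v" using assms disj by (auto simp: VV_def)
  obtain w where w: "adj EE v w" "fib v x \<in> bl v" "X - fib v x \<in> bl w" using edge_of_leaf[OF assms] by blast
  have wV: "w \<in> VV" using w by (simp add: adj_iff)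
  have xf: "x \<in> fib v x" using assms by (simp add: fib_def)
  have "(THE e. e \<in> edges_at EE v \<and> x \<in> branch VV EE v e) = {v, w}"
  proof (rule the_equality)
    show "{v, w} \<in> edges_at EE v \<and> x \<in> branch VV EE v {v, w}"
      using w branch_iff[OF v(1) w(2) wV w(3) assms(2) v(2)] xf by (auto simp: edges_at_iff)
    fix e assume e: "e \<in> edges_at EE v \<and> x \<in> branch VV EE v e"
    then obtain w' B where w': "e = {v, w'}" "w' \<in> VV" "B \<in> bl v" "X - B \<in> bl w'" by (auto simp: edges_at_iff adj_iff)
    then have "x \<in> B" using branch_iff[OF v(1) w'(3,2,4) assms(2) v(2)] e by auto
    then have "B = fib v x" using w'(3) assms by (auto simp: bl_I fib_def)
    then show "e = {v, w}" using w' w wV bl_unique by blast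
  qed
  then show ?thesis unfolding amark_def using tI_TT[OF assms(1) w(1,2,3) xf] by (simp add: TT_def)
qed

lemma attach_TT: "v \<in> I \<Longrightarrow> attach TT v = Some ` a v ` X"
proof -
  assume v: "v \<in> I"
  have "attach TT v = tI TT v ` edges_at EE v" by (simp add: attach_def TT_def)
  also have "\<dots> = Some ` a v ` X"
  proof
    show "tI TT v ` edges_at EE v \<subseteq> Some ` a v ` X"
    proof (rule image_subsetI)
      fix e assume "e \<in> edges_at EE v"
      then obtain w B where w: "e = {v, w}" "adj EE v w" "B \<in> bl v" "X - B \<in> bl w" by (auto simp: edges_at_iff adj_iff)
      then obtain x where "x \<in> B" using bl_ne by blast
      then show "tI TT v e \<in> Some ` a v ` X" using tI_TT[OF v w(2-4)] w(1) bl_sub[OF w(3)] by auto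
    qed
    show "Some ` a v ` X \<subseteq> tI TT v ` edges_at EE v"
    proof
      fix c assume "c \<in> Some ` a v ` X"
      then obtain x where x: "x \<in> X" "c = Some (a v x)" by auto
      obtain w where w: "adj EE v w" "fib v x \<in> bl v" "X - fib v x \<in> bl w" using edge_of_leaf[OF v x(1)] by blast
      have "tI TT v {v, w} = c" using tI_TT[OF v w] x by (simp add: fib_def)
      moreover have "{v, w} \<in> edges_at EE v" using w(1) edges_at_iff by blast
      ultimately show "c \<in> tI TT v ` edges_at EE v" by blast
    qed
  qed
  finally show ?thesis .
qed

lemma conn_from_neighbour:
  assumes "u \<in> VV" "v \<in> VV" "u \<noteq> v"
  shows "\<exists>w. adj EE v w \<and> conn_avoid EE v w u"
proof -
  have "(adj EE)\<^sup>*\<^sup>* v u" using is_tree_TT assms by (simp add: is_tree_def)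
  then have "u = v \<or> (\<exists>w. adj EE v w \<and> conn_avoid EE v w u)"
  proof (induction rule: rtranclp_induct)
    case (step y z)
    show ?case
    proof (cases "z = v \<or> y = v")
      case True
      then show ?thesis using step by (auto simp: conn_avoid_def)
    next
      case False
      then obtain w where w: "adj EE v w" "conn_avoid EE v w y" using step by blast
      then have "conn_avoid EE v w z" using False step unfolding conn_avoid_def
        by (auto intro: rtranclp.rtrancl_into_rtrancl)
      then show ?thesis using w by blast
    qed
  qed simp
  then show ?thesis using assms by blast
qed

lemma conn_avoid_sym: "conn_avoid EE v u w \<Longrightarrow> conn_avoid EE v w u"
proof -
  have "symp (\<lambda>a b. adj EE a b \<and> a \<noteq> v \<and> b \<noteq> v)" using adj_sym by (auto intro: sympI)
  then have "symp ((\<lambda>a b. adj EE a b \<and> a \<noteq> v \<and> b \<noteq> v)\<^sup>*\<^sup>*)" by (rule symp_rtranclp)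
  then show "conn_avoid EE v u w \<Longrightarrow> conn_avoid EE v w u" unfolding conn_avoid_def by (auto dest: sympD)
qed

text \<open>A leaf has a single neighbour, to which all other vertices remain connected.\<close>

lemma not_separates_leaf:
  assumes "x \<in> X" shows "\<not> separates VV EE x v1 v2 v3"
proof
  assume s: "separates VV EE x v1 v2 v3"
  have x: "x \<in> VV" using assms by (simp add: VV_def)
  obtain w1 where w1: "adj EE x w1" "conn_avoid EE x w1 v1" using conn_from_neighbour s x unfolding separates_def by blast
  obtain w2 where w2: "adj EE x w2" "conn_avoid EE x w2 v2" using conn_from_neighbour s x unfolding separates_def by blast
  have "w1 = w2" using w1 w2 assms bl_unique by (auto simp: adj_iff bl_X)
  then have "conn_avoid EE x v1 v2" using w2 conn_avoid_sym[OF w1(2)] unfolding conn_avoid_def by simp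
  then show False using s by (simp add: separates_def)
qed

lemma conn_avoid_leaves:
  assumes v: "v \<in> I" and x: "x \<in> X" "y \<in> X"
  shows "conn_avoid EE v x y \<longleftrightarrow> a v x = a v y"
proof -
  obtain w where w: "adj EE v w" "fib v x \<in> bl v" "X - fib v x \<in> bl w" using edge_of_leaf[OF v x(1)] by blast
  have V: "v \<in> VV" "w \<in> VV" using w by (auto simp: adj_iff)
  have wx: "conn_avoid EE v w x" using conn_next[OF V w(2,3)] x by (simp add: fib_def)
  have "conn_avoid EE v x y \<longleftrightarrow> conn_avoid EE v w y"
    using wx conn_avoid_sym[OF wx] unfolding conn_avoid_def by (meson rtranclp_trans)
  also have "\<dots> \<longleftrightarrow> y \<in> fib v x"
  proof
    show "y \<in> fib v x \<Longrightarrow> conn_avoid EE v w y" using conn_next[OF V w(2,3)] by blast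
    assume "conn_avoid EE v w y"
    then obtain D where "D \<in> bl y" "X - fib v x \<subseteq> D" using conn_invariant[OF V(1) w(2) V(2) w(3)] by blast
    then show "y \<in> fib v x" using x(2) by (auto simp: bl_X)
  qed
  finally show ?thesis using x by (auto simp: fib_def)
qed

lemma separates_internal:
  assumes "v \<in> I" "x \<in> X" "y \<in> X" "z \<in> X"
  shows "separates VV EE v x y z \<longleftrightarrow> distinct [a v x, a v y, a v z]"
  using assms conn_avoid_leaves disj by (auto simp: separates_def VV_def)

end

section \<open>Counting on the limit tree\<close>

text \<open>Numerical data of the limit maps: \<open>C v h\<close> is the set of marked values which, seen from the image
  of \<open>v\<close>, lie in the direction of the image of \<open>h\<close>; \<open>m v h\<close> is the local degree at \<open>h\<close> and \<open>om v h\<close> the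
  number of times the hole \<open>h\<close> covers the whole sphere.\<close>
locale cover_data = split_tree Y I a for Y I :: "nat set" and a :: "nat \<Rightarrow> nat \<Rightarrow> complex" +
  fixes d :: nat and Z :: "nat set" and F deg :: "nat \<Rightarrow> nat"
    and om :: "nat \<Rightarrow> complex \<Rightarrow> nat" and m :: "nat \<Rightarrow> complex \<Rightarrow> nat"
    and \<gamma> :: "nat \<Rightarrow> complex \<Rightarrow> cs" and \<zeta> :: "nat \<Rightarrow> nat \<Rightarrow> complex" and ee :: "nat \<Rightarrow> nat"
  assumes d: "d \<ge> 1" and port: "portrait d Y Z F deg" and cardZ: "card Z \<ge> 2"
    and m_pos: "\<And>v h. v \<in> I \<Longrightarrow> m v h \<ge> 1" and ee_pos: "\<And>v. v \<in> I \<Longrightarrow> ee v \<ge> 1"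
    and fibre: "\<And>v h b. v \<in> I \<Longrightarrow> b \<in> Z \<Longrightarrow> (\<Sum>x\<in>{x\<in>Y. a v x = h \<and> F x = b}. deg x) =
      om v h + (if \<gamma> v h = Some (\<zeta> v b) then m v h else 0)"
    and critical: "\<And>v h. v \<in> I \<Longrightarrow> (\<Sum>x\<in>{x\<in>Y. a v x = h}. deg x - 1) = 2 * om v h + (m v h - 1)"
    and sum_critical: "\<And>v. v \<in> I \<Longrightarrow> (\<Sum>h\<in>a v ` Y. m v h - 1) = 2 * ee v - 2"
    and sum_fibre: "\<And>v b. v \<in> I \<Longrightarrow> b \<in> Z \<Longrightarrow> (\<Sum>h\<in>{h\<in>a v ` Y. \<gamma> v h = Some (\<zeta> v b)}. m v h) = ee v"
begin

definition C :: "nat \<Rightarrow> complex \<Rightarrow> nat set" where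
  "C v h = {b \<in> Z. \<gamma> v h = Some (\<zeta> v b)}"

lemma Z_ne: "Z \<noteq> {}" and finZ: "finite Z" and deg_pos: "x \<in> Y \<Longrightarrow> deg x \<ge> 1" and F_Z: "x \<in> Y \<Longrightarrow> F x \<in> Z"
  and port_critical: "(\<Sum>x\<in>Y. deg x - 1) = 2 * d - 2"
  and port_fibre: "b \<in> Z \<Longrightarrow> (\<Sum>x\<in>{x\<in>Y. F x = b}. deg x) = d"
  using port cardZ by (auto simp: portrait_def)

text \<open>Add up both ends of the edge. By the critical count, d minus the two hole orders equals
  (m + m') / 2; by the fibre count, it equals the sum of those of m, m' whose direction lies over b.
  As m and m' are positive, exactly one is present for each b, and m = m'.\<close>

lemma edge_counts:
  assumes v: "v \<in> I" "v' \<in> I" and B: "fib v x \<in> bl v" "Y - fib v x = fib v' x'" and x: "x \<in> Y" "x' \<in> Y"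
  shows "C v (a v x) \<union> C v' (a v' x') = Z" "C v (a v x) \<inter> C v' (a v' x') = {}" "m v (a v x) = m v' (a v' x')"
proof -
  define h h' where "h = a v x" and "h' = a v' x'"
  have Bs: "{y\<in>Y. a v y = h} = fib v x" "{y\<in>Y. a v' y = h'} = Y - fib v x"
    using B(2) by (auto simp: h_def h'_def fib_def)
  have fs: "fib v x \<subseteq> Y" by (auto simp: fib_def)
  have crit: "2 * om v h + (m v h - 1) + (2 * om v' h' + (m v' h' - 1)) = 2 * d - 2"
    unfolding critical[OF v(1), symmetric] critical[OF v(2), symmetric] Bs port_critical[symmetric]
    using sum.subset_diff[OF fs finX, of "\<lambda>x. deg x - 1"] by simp
  have fib: "om v h + (if b \<in> C v h then m v h else 0) + (om v' h' + (if b \<in> C v' h' then m v' h' else 0)) = d"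
    if b: "b \<in> Z" for b
  proof -
    have "{y\<in>Y. a v y = h \<and> F y = b} = {y\<in>Y. F y = b} \<inter> fib v x"
      "{y\<in>Y. a v' y = h' \<and> F y = b} = {y\<in>Y. F y = b} - fib v x" using Bs by auto
    then have "(\<Sum>y\<in>{y\<in>Y. a v y = h \<and> F y = b}. deg y) + (\<Sum>y\<in>{y\<in>Y. a v' y = h' \<and> F y = b}. deg y) = d"
      using sum.Int_Diff[of "{y\<in>Y. F y = b}" deg "fib v x"] finX port_fibre[OF b] by simp
    then show ?thesis unfolding fibre[OF v(1) b] fibre[OF v(2) b] using b by (simp add: C_def)
  qed
  have pos: "m v h \<ge> 1" "m v' h' \<ge> 1" using m_pos v by auto
  have each: "(b \<in> C v h) \<noteq> (b \<in> C v' h')" "m v h = m v' h'" if b: "b \<in> Z" for b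
    using fib[OF b] crit pos d by (auto split: if_splits)
  show "C v (a v x) \<union> C v' (a v' x') = Z" "C v (a v x) \<inter> C v' (a v' x') = {}"
    unfolding h_def[symmetric] h'_def[symmetric] using each(1) by (auto simp: C_def)
  show "m v (a v x) = m v' (a v' x')"
    unfolding h_def[symmetric] h'_def[symmetric] using each(2) Z_ne by blast
qed

text \<open>A value other than F x has no marked preimage in this direction, so there is no hole;
  two marked values are needed for this test.\<close>

lemma leaf_counts:
  assumes v: "v \<in> I" and x: "x \<in> Y" "fib v x = {x}"
  shows "C v (a v x) = {F x}" "m v (a v x) = deg x"
proof -
  define h where "h = a v x"
  have Bs: "{y\<in>Y. a v y = h} = {x}" using x by (auto simp: h_def fib_def)
  have pos: "m v h \<ge> 1" "deg x \<ge> 1" using m_pos[OF v] deg_pos[OF x(1)] by auto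
  have crit: "deg x - 1 = 2 * om v h + (m v h - 1)" using critical[OF v, of h] unfolding Bs by simp
  have fib: "(if b = F x then deg x else 0) = om v h + (if b \<in> C v h then m v h else 0)" if b: "b \<in> Z" for b
  proof -
    have "{y\<in>Y. a v y = h \<and> F y = b} = (if b = F x then {x} else {})" using Bs by auto
    then have "(\<Sum>y\<in>{y\<in>Y. a v y = h \<and> F y = b}. deg y) = (if b = F x then deg x else 0)" by simp
    then show ?thesis unfolding fibre[OF v b] using b by (simp add: C_def)
  qed
  obtain b where b: "b \<in> Z" "b \<noteq> F x"
  proof -
    have "\<not> Z \<subseteq> {F x}" using cardZ card_mono[of "{F x}" Z] by auto
    then show thesis using that by blast
  qed
  have om: "om v h = 0" using fib[OF b(1)] b(2) by simp
  have "c \<in> C v h \<longleftrightarrow> c = F x" if c: "c \<in> Z" for c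
    using fib[OF c] om pos by (auto split: if_splits)
  then show "C v (a v x) = {F x}" using F_Z[OF x(1)] by (auto simp: C_def h_def[symmetric])
  show "m v (a v x) = deg x" using crit om pos unfolding h_def[symmetric] by simp
qed

lemma sum_m:
  assumes v: "v \<in> I" shows "(\<Sum>h\<in>a v ` Y. m v h) = card (a v ` Y) + (2 * ee v - 2)"
proof -
  have "(\<Sum>h\<in>a v ` Y. m v h) = (\<Sum>h\<in>a v ` Y. 1 + (m v h - 1))"
    by (simp only: le_add_diff_inverse[OF m_pos[OF v]])
  then show ?thesis unfolding sum.distrib sum_critical[OF v] by simp
qed

text \<open>If \<open>C v (a v x)\<close> were empty, all marked values would lie in one direction at the next vertex, and the
  Riemann-Hurwitz count there would produce another empty direction, with fewer leaves behind it.\<close>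
lemma C_nonempty:
  "v \<in> I \<Longrightarrow> x \<in> Y \<Longrightarrow> C v (a v x) \<noteq> {}"
proof (induction "card (fib v x)" arbitrary: v x rule: less_induct)
  case less
  show ?case
  proof
    assume empty: "C v (a v x) = {}"
    have v: "v \<in> VV" "fib v x \<in> bl v" using less.prems by (auto simp: VV_def bl_I)
    then obtain w where w: "w \<in> VV" "Y - fib v x \<in> bl w" using bl_next by blast
    \<comment> \<open>A leaf across the edge would be x itself, and then \<open>leaf_counts\<close>
      gives a nonempty set.\<close>
    have wI: "w \<in> I"
    proof (rule ccontr)
      assume "w \<notin> I"
      then have wY: "w \<in> Y" using w(1) by (auto simp: VV_def)
      then have "Y - fib v x = Y - {w}" using w(2) by (simp add: bl_X)
      then have "fib v x = {w}" using wY by (auto simp: fib_def)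
      then have "fib v x = {x}" using less.prems(2) by (auto simp: fib_def)
      then show False using leaf_counts(1)[OF less.prems] empty by simp
    qed
    then obtain x' where x': "x' \<in> Y" "Y - fib v x = fib w x'" using w(2) by (auto simp: bl_I)
    have CZ: "C w (a w x') = Z" using edge_counts(1)[OF less.prems(1) wI v(2) x'(2) less.prems(2) x'(1)] empty by simp
    \<comment> \<open>All marked values coincide at w. If no direction were empty, all directions
      would have this one image, and the m would add up to \<open>ee w\<close>; Riemann-Hurwitz with
      three directions gives at least \<open>2 * ee w + 1\<close>.\<close>
    have "\<exists>z\<in>Y. C w (a w z) = {}"
    proof (rule ccontr)
      assume ne: "\<not> ?thesis"
      obtain b where b: "b \<in> Z" using Z_ne by blast
      have "\<gamma> w (a w z) = Some (\<zeta> w b)" if z: "z \<in> Y" for z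
      proof -
        have "C w (a w z) \<noteq> {}" using ne z by simp
        then obtain c where "c \<in> C w (a w z)" by auto
        then have c: "c \<in> Z" "\<gamma> w (a w z) = Some (\<zeta> w c)" by (auto simp: C_def)
        moreover have "\<gamma> w (a w x') = Some (\<zeta> w c)" "\<gamma> w (a w x') = Some (\<zeta> w b)" using CZ b c(1) by (auto simp: C_def)
        ultimately show ?thesis by simp
      qed
      then have "{h\<in>a w ` Y. \<gamma> w h = Some (\<zeta> w b)} = a w ` Y" by auto
      then have "(\<Sum>h\<in>a w ` Y. m w h) = ee w" using sum_fibre[OF wI b] by simp
      then show False using sum_m[OF wI] ge3[OF wI] ee_pos[OF wI] by linarith
    qed
    then obtain z where z: "z \<in> Y" "C w (a w z) = {}" by blast
    \<comment> \<open>The empty direction is not the one back to v, over which all marked values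
      lie; so fewer leaves are ahead.\<close>
    have "fib w z \<noteq> Y - fib v x"
    proof
      assume "fib w z = Y - fib v x"
      then have "z \<in> fib w x'" using x' z by (auto simp: fib_def)
      then have "a w z = a w x'" by (simp add: fib_def)
      then show False using z CZ Z_ne by simp
    qed
    then have "fib w z \<subset> fib v x"
      using block_shrinks[OF w(1,2), of "fib w z"] wI z by (auto simp: bl_I fib_def)
    then have "card (fib w z) < card (fib v x)" using finX by (intro psubset_card_mono) (auto simp: fib_def)
    then show False using less.hyps wI z by blast
  qed
qed

text \<open>By \<open>C_nonempty\<close> every direction lies over a marked value. With at most two
  values the m would add up to at most \<open>2 * ee v\<close>, but Riemann-Hurwitz with three
  directions gives at least \<open>2 * ee v + 1\<close>.\<close>

lemma three_images:
  assumes v: "v \<in> I" shows "card (\<zeta> v ` Z) \<ge> 3"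
proof (rule ccontr)
  assume "\<not> ?thesis"
  then have le: "card (\<zeta> v ` Z) \<le> 2" by simp
  have fin: "finite (a v ` Y)" using finX by simp
  have img: "(\<lambda>h. \<gamma> v h) ` (a v ` Y) \<subseteq> Some ` \<zeta> v ` Z" using C_nonempty[OF v] by (fastforce simp: C_def)
  have "(\<Sum>h\<in>a v ` Y. m v h) = (\<Sum>c\<in>Some ` \<zeta> v ` Z. \<Sum>h\<in>{h\<in>a v ` Y. \<gamma> v h = c}. m v h)"
    using sum.group[OF fin _ img, of "m v"] finZ by simp
  also have "\<dots> = (\<Sum>c\<in>Some ` \<zeta> v ` Z. ee v)"
    using sum_fibre[OF v] by (intro sum.cong) auto
  also have "\<dots> = card (\<zeta> v ` Z) * ee v" by (simp add: card_image)
  also have "\<dots> \<le> 2 * ee v" using le by simp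
  finally show False using sum_m[OF v] ge3[OF v] ee_pos[OF v] by linarith
qed

end

section \<open>Marked points\<close>

lemma ldeg_le:
  assumes "rat_map d g" "d \<ge> 1" shows "ldeg g x \<le> d"
proof -
  have "ldeg g x \<le> (\<Sum>y | g y = g x. ldeg g y)"
    using sum_ldeg_fibre(1)[OF assms, of "g x"] by (intro member_le_sum) auto
  then show ?thesis using sum_ldeg_fibre(2)[OF assms] by simp
qed

lemma card_fibre_le:
  assumes "rat_map d g" "d \<ge> 1" shows "card {x. g x = b} \<le> d"
  using card_le_sum_pos[OF sum_ldeg_fibre(1)[OF assms], of b "ldeg g"] ldeg_pos[OF assms] sum_ldeg_fibre(2)[OF assms] by simp

lemma card_critical_le:
  assumes "rat_map d g" "d \<ge> 1" shows "card {x. ldeg g x \<ge> 2} \<le> 2 * d - 2"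
  using card_le_sum_pos[OF sum_ldeg_critical(1)[OF assms], of "\<lambda>x. ldeg g x - 1"] sum_ldeg_critical(2)[OF assms] by fastforce

lemma preimage_card_le:
  assumes "rat_map d g" "d \<ge> 1" "finite S"
  shows "finite {x. g x \<in> S}" "card {x. g x \<in> S} \<le> d * card S"
proof -
  have e: "{x. g x \<in> S} = (\<Union>b\<in>S. {x. g x = b})" by auto
  show "finite {x. g x \<in> S}" unfolding e using sum_ldeg_fibre(1)[OF assms(1,2)] assms(3) by simp
  have "card {x. g x \<in> S} \<le> (\<Sum>b\<in>S. card {x. g x = b})" unfolding e by (rule card_UN_le[OF assms(3)])
  also have "\<dots> \<le> (\<Sum>b\<in>S. d)" using card_fibre_le[OF assms(1,2)] by (intro sum_mono)
  finally show "card {x. g x \<in> S} \<le> d * card S" by (simp add: mult.commute)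
qed

text \<open>The indices 0, 1, 2 are reserved for 0, 1 and infinity, so that the source and target
  markings agree there.\<close>

lemma enumerate_from:
  assumes "finite S" "{Some 0, Some 1, None} \<subseteq> S"
  shows "\<exists>y :: nat \<Rightarrow> cs. bij_betw y {..<card S} S \<and> y 0 = Some 0 \<and> y 1 = Some 1 \<and> y 2 = None"
proof -
  obtain xs where xs: "set xs = S - {Some 0, Some 1, None}" "distinct xs"
    using finite_distinct_list[of "S - {Some 0, Some 1, None}"] assms(1) by auto
  define ys where "ys = [Some 0, Some 1, None] @ xs"
  have ys: "distinct ys" "set ys = S" using xs assms(2) by (auto simp: ys_def)
  have "length ys = card S" using distinct_card[OF ys(1)] ys(2) by simp
  then have "bij_betw ((!) ys) {..<card S} S" using bij_betw_nth[OF ys(1)] ys(2) by (simp add: bij_betw_nth)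
  then show ?thesis by (intro exI[of _ "(!) ys"]) (simp add: ys_def numeral_2_eq_2)
qed

text \<open>The sums are exact because the marked source points form a full preimage containing all
  critical points: one is Riemann-Hurwitz, the other the fibre count.\<close>

lemma portrait_of_marking:
  assumes f: "rat_map d f" "d \<ge> 1" and y: "bij_betw y Y {x. f x \<in> z ` Z}" and z: "inj_on z Z"
    and fin: "finite Y" "finite Z" and crit: "\<And>x. ldeg f x \<ge> 2 \<Longrightarrow> f x \<in> z ` Z"
    and F: "\<And>a. a \<in> Y \<Longrightarrow> F a \<in> Z \<and> z (F a) = f (y a)" and deg: "\<And>a. a \<in> Y \<Longrightarrow> deg a = ldeg f (y a)"
  shows "portrait d Y Z F deg"
  unfolding portrait_def
proof (intro conjI ballI)
  show "finite Y" "finite Z" "F ` Y \<subseteq> Z" using fin F by auto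
  show "deg a \<ge> 1" if "a \<in> Y" for a using deg[OF that] ldeg_pos[OF f] by simp
  have inj: "inj_on y Y" and im: "y ` Y = {x. f x \<in> z ` Z}" using y by (auto simp: bij_betw_def)
  have "(\<Sum>a\<in>Y. deg a - 1) = (\<Sum>a\<in>Y. ldeg f (y a) - 1)" using deg by (intro sum.cong) auto
  also have "\<dots> = (\<Sum>x\<in>y ` Y. ldeg f x - 1)" using inj by (simp add: sum.reindex)
  also have "\<dots> = (\<Sum>x | ldeg f x \<ge> 2. ldeg f x - 1)"
  proof (rule sum.mono_neutral_right)
    show "finite (y ` Y)" using fin by simp
    show "{x. ldeg f x \<ge> 2} \<subseteq> y ` Y" unfolding im using crit by auto
  qed auto
  finally show "(\<Sum>a\<in>Y. deg a - 1) = 2 * d - 2" using sum_ldeg_critical(2)[OF f] by simp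
  fix b assume b: "b \<in> Z"
  have "y ` {a\<in>Y. F a = b} = {x. f x = z b}"
  proof
    show "y ` {a\<in>Y. F a = b} \<subseteq> {x. f x = z b}" using F by auto
    show "{x. f x = z b} \<subseteq> y ` {a\<in>Y. F a = b}"
    proof
      fix x assume x: "x \<in> {x. f x = z b}"
      then have "x \<in> y ` Y" using im b by auto
      then obtain a where a: "a \<in> Y" "x = y a" by auto
      then have "z (F a) = z b" using F x by auto
      then have "F a = b" using z F[OF a(1)] b by (auto dest: inj_onD)
      then show "x \<in> y ` {a\<in>Y. F a = b}" using a by auto
    qed
  qed
  then have "(\<Sum>x | f x = z b. ldeg f x) = (\<Sum>a\<in>{a\<in>Y. F a = b}. ldeg f (y a))"
    using sum.reindex[OF inj_on_subset[OF inj], of "{a\<in>Y. F a = b}" "ldeg f"] by auto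
  also have "\<dots> = (\<Sum>a\<in>{a\<in>Y. F a = b}. deg a)" using deg by (intro sum.cong) auto
  finally show "(\<Sum>a\<in>{a\<in>Y. F a = b}. deg a) = d" using sum_ldeg_fibre(2)[OF f] by simp
qed

text \<open>All cardinalities are bounded independently of n, so along a subsequence the index sets,
  the map, the degrees and the labels of the prescribed points are constant.\<close>

lemma marked_points:
  fixes f :: "nat \<Rightarrow> cs \<Rightarrow> cs" and \<rho> :: "nat \<Rightarrow> 'j \<Rightarrow> cs"
  assumes f: "\<And>n. rat_map d (f n)" and d: "d \<ge> 1" and J: "finite J"
  shows "\<exists>\<sigma> Y Z F deg y z mk. strict_mono (\<sigma> :: nat \<Rightarrow> nat) \<and> {0, 1, 2} \<subseteq> Y \<inter> Z \<and> portrait d Y Z F deg \<and>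
    (\<forall>n. dyn_marked d Y Z F deg {0, 1, 2} (f (\<sigma> n)) (y n) (z n)) \<and>
    (\<forall>j\<in>J. mk j \<in> Y \<and> (\<forall>n. y n (mk j) = \<rho> (\<sigma> n) j))"
proof -
  define X where "X = {Some 0, Some 1, None :: cs}"
  \<comment> \<open>The images of X are included so that X lies in the full preimage, and X itself
    so that it lies in the target.\<close>
  define Zs where "Zs n = f n ` ({x. ldeg (f n) x \<ge> 2} \<union> X \<union> \<rho> n ` J) \<union> X" for n
  define Ys where "Ys n = {x. f n x \<in> Zs n}" for n
  have finC: "finite {x. ldeg (f n) x \<ge> 2}" for n using sum_ldeg_critical(1)[OF f d] .
  have finZ: "finite (Zs n)" for n unfolding Zs_def using finC J by (simp add: X_def)
  have finY: "finite (Ys n)" for n unfolding Ys_def using preimage_card_le(1)[OF f d finZ] .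
  \<comment> \<open>At most 2d - 2 critical values, three images of X, \<open>card J\<close> images
    of prescribed points, and the three points of X.\<close>
  define N where "N = 2 * d - 2 + 3 + card J + 3"
  have cX: "card X \<le> 3" unfolding X_def by (rule order.trans[OF card_insert_le_m1]) (auto simp: card_insert_if)
  have cZ: "card (Zs n) \<le> N" for n
  proof -
    have "card (f n ` ({x. ldeg (f n) x \<ge> 2} \<union> X \<union> \<rho> n ` J)) \<le> card ({x. ldeg (f n) x \<ge> 2} \<union> X \<union> \<rho> n ` J)"
      using finC J by (intro card_image_le) (simp add: X_def)
    also have "\<dots> \<le> card {x. ldeg (f n) x \<ge> 2} + card X + card (\<rho> n ` J)"
      by (meson add_le_mono1 card_Un_le order.trans)
    also have "\<dots> \<le> 2 * d - 2 + 3 + card J"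
      using card_critical_le[OF f d, of n] cX card_image_le[OF J, of "\<rho> n"] by linarith
    finally show ?thesis unfolding Zs_def N_def
      using card_Un_le[of "f n ` ({x. ldeg (f n) x \<ge> 2} \<union> X \<union> \<rho> n ` J)" X] cX by linarith
  qed
  have cY: "card (Ys n) \<le> d * N" for n
    using preimage_card_le(2)[OF f d finZ, of n n] mult_le_mono2[OF cZ, of d n] unfolding Ys_def by linarith
  have XZ: "X \<subseteq> Zs n" for n by (auto simp: Zs_def)
  have XY: "X \<subseteq> Ys n" for n by (auto simp: Ys_def Zs_def)
  have "\<exists>y :: nat \<Rightarrow> cs. bij_betw y {..<card (Ys n)} (Ys n) \<and> y 0 = Some 0 \<and> y 1 = Some 1 \<and> y 2 = None" for n
    using enumerate_from[OF finY] XY by (simp add: X_def)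
  then obtain y where y: "\<And>n. bij_betw (y n) {..<card (Ys n)} (Ys n)" "\<And>n. y n 0 = Some (0::complex)" "\<And>n. y n 1 = Some (1::complex)" "\<And>n. y n 2 = None"
    by metis
  have "\<exists>z :: nat \<Rightarrow> cs. bij_betw z {..<card (Zs n)} (Zs n) \<and> z 0 = Some 0 \<and> z 1 = Some 1 \<and> z 2 = None" for n
    using enumerate_from[OF finZ] XZ by (simp add: X_def)
  then obtain z where z: "\<And>n. bij_betw (z n) {..<card (Zs n)} (Zs n)" "\<And>n. z n 0 = Some (0::complex)" "\<And>n. z n 1 = Some (1::complex)" "\<And>n. z n 2 = None"
    by metis
  obtain r1 kl where r1: "strict_mono (r1 :: nat \<Rightarrow> nat)" "\<And>n. (card (Ys (r1 n)), card (Zs (r1 n))) = kl"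
    using constant_subseq[of "{..d * N} \<times> {..N}" "\<lambda>n. (card (Ys n), card (Zs n))"] cY cZ by auto
  define Y where "Y = {..<fst kl}"
  define Z where "Z = {..<snd kl}"
  have Y: "bij_betw (y (r1 n)) Y (Ys (r1 n))" and Z: "bij_betw (z (r1 n)) Z (Zs (r1 n))" for n
    using y(1)[of "r1 n"] z(1)[of "r1 n"] r1(2)[of n] by (auto simp: Y_def Z_def)
  have "\<forall>n. \<exists>F. \<forall>a\<in>Y. F a \<in> Z \<and> z (r1 n) (F a) = f (r1 n) (y (r1 n) a)"
  proof
    fix n
    have "\<forall>a\<in>Y. \<exists>b\<in>Z. z (r1 n) b = f (r1 n) (y (r1 n) a)"
    proof
      fix a assume "a \<in> Y"
      then have "y (r1 n) a \<in> Ys (r1 n)" using Y[of n] bij_betwE by blast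
      then have "f (r1 n) (y (r1 n) a) \<in> z (r1 n) ` Z" using Z[of n] by (simp add: Ys_def bij_betw_def)
      then show "\<exists>b\<in>Z. z (r1 n) b = f (r1 n) (y (r1 n) a)" by (metis imageE)
    qed
    then show "\<exists>F. \<forall>a\<in>Y. F a \<in> Z \<and> z (r1 n) (F a) = f (r1 n) (y (r1 n) a)" by metis
  qed
  then obtain F where F: "\<And>n a. a \<in> Y \<Longrightarrow> F n a \<in> Z" "\<And>n a. a \<in> Y \<Longrightarrow> z (r1 n) (F n a) = f (r1 n) (y (r1 n) a)"
    by metis
  have "\<forall>n. \<exists>mk. \<forall>j\<in>J. mk j \<in> Y \<and> y (r1 n) (mk j) = \<rho> (r1 n) j"
  proof
    fix n
    have "\<forall>j\<in>J. \<exists>a\<in>Y. y (r1 n) a = \<rho> (r1 n) j"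
    proof
      fix j assume "j \<in> J"
      then have "\<rho> (r1 n) j \<in> Ys (r1 n)" by (auto simp: Ys_def Zs_def)
      then show "\<exists>a\<in>Y. y (r1 n) a = \<rho> (r1 n) j" using Y[of n] unfolding bij_betw_def by (metis imageE)
    qed
    then show "\<exists>mk. \<forall>j\<in>J. mk j \<in> Y \<and> y (r1 n) (mk j) = \<rho> (r1 n) j" by metis
  qed
  then obtain mk where mk: "\<And>n j. j \<in> J \<Longrightarrow> mk n j \<in> Y" "\<And>n j. j \<in> J \<Longrightarrow> y (r1 n) (mk n j) = \<rho> (r1 n) j" by metis
  define dg where "dg n a = ldeg (f (r1 n)) (y (r1 n) a)" for n a
  \<comment> \<open>\<open>restrict\<close> fixes the values outside the finite domains, so that
    only finitely many data occur.\<close>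
  define D where "D n = (restrict (F n) Y, restrict (dg n) Y, restrict (mk n) J)" for n
  have fYZ: "finite Y" "finite Z" by (simp_all add: Y_def Z_def)
  have "D n \<in> (Y \<rightarrow>\<^sub>E Z) \<times> (Y \<rightarrow>\<^sub>E {..d}) \<times> (J \<rightarrow>\<^sub>E Y)" for n
    using F mk ldeg_le[OF f d] by (auto simp: D_def dg_def)
  moreover have "finite ((Y \<rightarrow>\<^sub>E Z) \<times> (Y \<rightarrow>\<^sub>E {..d}) \<times> (J \<rightarrow>\<^sub>E Y))"
    using fYZ J by (intro finite_cartesian_product finite_PiE) auto
  ultimately obtain r2 D0 where r2: "strict_mono (r2 :: nat \<Rightarrow> nat)" "\<And>n. D (r2 n) = D0"
    using constant_subseq[of "(Y \<rightarrow>\<^sub>E Z) \<times> (Y \<rightarrow>\<^sub>E {..d}) \<times> (J \<rightarrow>\<^sub>E Y)" D] by auto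
  define F0 where "F0 = fst D0"
  define dg0 where "dg0 = fst (snd D0)"
  define mk0 where "mk0 = snd (snd D0)"
  have F0: "F (r2 n) a = F0 a" "dg (r2 n) a = dg0 a" if "a \<in> Y" for n a
    using r2(2)[of n] that by (auto simp: D_def F0_def dg0_def)
  have mk0: "mk (r2 n) j = mk0 j" if "j \<in> J" for n j
    using r2(2)[of n] that by (auto simp: D_def mk0_def)
  define \<sigma> where "\<sigma> n = r1 (r2 n)" for n
  have \<sigma>: "strict_mono \<sigma>" unfolding \<sigma>_def using strict_mono_compose[OF r1(1) r2(1)] .
  have imZ: "z (\<sigma> n) ` Z = Zs (\<sigma> n)" for n using Z by (simp add: \<sigma>_def bij_betw_def)
  have port: "portrait d Y Z F0 dg0"
  proof (rule portrait_of_marking[where f = "f (\<sigma> 0)" and y = "y (\<sigma> 0)" and z = "z (\<sigma> 0)"])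
    show "bij_betw (y (\<sigma> 0)) Y {x. f (\<sigma> 0) x \<in> z (\<sigma> 0) ` Z}" unfolding imZ using Y by (simp add: \<sigma>_def Ys_def)
    show "inj_on (z (\<sigma> 0)) Z" using Z by (simp add: \<sigma>_def bij_betw_def)
    show "f (\<sigma> 0) x \<in> z (\<sigma> 0) ` Z" if "ldeg (f (\<sigma> 0)) x \<ge> 2" for x unfolding imZ using that by (auto simp: Zs_def)
    show "F0 a \<in> Z \<and> z (\<sigma> 0) (F0 a) = f (\<sigma> 0) (y (\<sigma> 0) a)" if "a \<in> Y" for a
      using F[OF that, of "r2 0"] F0(1)[OF that, of 0] by (simp add: \<sigma>_def)
    show "dg0 a = ldeg (f (\<sigma> 0)) (y (\<sigma> 0) a)" if "a \<in> Y" for a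
      using F0(2)[OF that, of 0] by (simp add: \<sigma>_def dg_def)
  qed (use f d fYZ in auto)
  have c3: "3 \<le> card S" if "X \<subseteq> S" "finite S" for S
  proof -
    have "card X = 3" by (simp add: X_def)
    then show ?thesis using card_mono[OF that(2,1)] by simp
  qed
  have "{0, 1, 2} \<subseteq> Y \<inter> Z"
    using c3[OF XY finY, of "r1 0"] c3[OF XZ finZ, of "r1 0"] r1(2)[of 0] by (auto simp: Y_def Z_def)
  moreover have "dyn_marked d Y Z F0 dg0 {0, 1, 2} (f (\<sigma> n)) (y (\<sigma> n)) (z (\<sigma> n))" for n
    unfolding dyn_marked_def
  proof (intro conjI ballI)
    show "rat_map d (f (\<sigma> n))" by (rule f)
    show "inj_on (y (\<sigma> n)) Y" "inj_on (z (\<sigma> n)) Z" using Y Z by (auto simp: \<sigma>_def bij_betw_def)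
    show "f (\<sigma> n) (y (\<sigma> n) a) = z (\<sigma> n) (F0 a)" if "a \<in> Y" for a
      using F(2)[OF that, of "r2 n"] F0(1)[OF that, of n] by (simp add: \<sigma>_def)
    show "ldeg (f (\<sigma> n)) (y (\<sigma> n) a) = dg0 a" if "a \<in> Y" for a
      using F0(2)[OF that, of n] by (simp add: \<sigma>_def dg_def)
    show "y (\<sigma> n) x = z (\<sigma> n) x" if "x \<in> {0, 1, 2}" for x using that y(2-4)[of "\<sigma> n"] z(2-4)[of "\<sigma> n"] by auto
  qed
  moreover have "mk0 j \<in> Y \<and> (\<forall>n. y (\<sigma> n) (mk0 j) = \<rho> (\<sigma> n) j)" if "j \<in> J" for j
    using mk[OF that] mk0[OF that] by (metis \<sigma>_def)
  ultimately show ?thesis using \<sigma> port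
    by (intro exI[of _ \<sigma>] exI[of _ Y] exI[of _ Z] exI[of _ F0] exI[of _ dg0]
        exI[of _ "\<lambda>n. y (\<sigma> n)"] exI[of _ "\<lambda>n. z (\<sigma> n)"] exI[of _ mk0] conjI allI ballI) simp_all
qed

lemma cs_tendsto_the:
  assumes "cs_tendsto x (Some l)" "\<And>n. x n \<noteq> None" shows "(\<lambda>n. the (x n)) \<longlonglongrightarrow> l"
proof -
  have "x = (\<lambda>n. Some (the (x n)))" using assms(2) by auto
  then show ?thesis using assms(1) cs_tendsto_Some_iff by metis
qed

text \<open>Finitely many limits miss some finite point u; sending u to infinity by one fixed map
  makes all limits finite, and all terms as well once finitely many are dropped.\<close>

lemma finite_charts:
  fixes s :: "'i \<Rightarrow> nat \<Rightarrow> cs"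
  assumes D: "finite D"
  shows "\<exists>r A l. strict_mono (r :: nat \<Rightarrow> nat) \<and> mobius A \<and>
    (\<forall>i\<in>D. cs_tendsto (\<lambda>n. A (s i (r n))) (Some (l i)) \<and> (\<forall>n. A (s i (r n)) \<noteq> None))"
proof -
  have "\<exists>r. strict_mono (r :: nat \<Rightarrow> nat) \<and> (\<forall>i\<in>D. \<exists>L. cs_tendsto (\<lambda>n. s i (r n)) L)"
  proof (rule finite_common_subseq[OF D])
    show "\<exists>t. strict_mono t \<and> (\<exists>L. cs_tendsto (\<lambda>n. s i (r (t n))) L)" for i and r :: "nat \<Rightarrow> nat"
      using cs_convergent_subseq[of "\<lambda>n. s i (r n)"] by blast
    show "\<exists>L. cs_tendsto (\<lambda>n. s i (r (t n))) L" if "\<exists>L. cs_tendsto (\<lambda>n. s i (r n)) L" "strict_mono t" for i and r t :: "nat \<Rightarrow> nat"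
      using that cs_tendsto_subseq[of "\<lambda>n. s i (r n)" _ t] by blast
  qed
  then obtain r L where r: "strict_mono (r :: nat \<Rightarrow> nat)" "\<And>i. i \<in> D \<Longrightarrow> cs_tendsto (\<lambda>n. s i (r n)) (L i)" by metis
  have "finite (the ` L ` D)" using D by simp
  then obtain u where u: "u \<notin> the ` L ` D" using ex_new_if_finite[OF infinite_UNIV_char_0] by blast
  define A where "A = lft 0 1 1 (-u)"
  have A: "mobius A" unfolding A_def mobius_def
    by (intro exI[of _ 0] exI[of _ 1] exI[of _ "-u"]) simp
  have An: "A x = None \<Longrightarrow> x = Some u" for x by (cases x) (auto simp: A_def split: if_splits)
  have "A (L i) \<noteq> None" if "i \<in> D" for i
  proof
    assume "A (L i) = None"
    from An[OF this] have "the (L i) = u" by simp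
    then show False using u that by auto
  qed
  then have lim: "cs_tendsto (\<lambda>n. A (s i (r n))) (Some (the (A (L i))))" if "i \<in> D" for i
    using mobius_tendsto[OF A r(2)[OF that]] that by auto
  have "eventually (\<lambda>n. \<forall>i\<in>D. A (s i (r n)) \<noteq> None) sequentially"
    using D cs_tendsto_eventually_finite[OF lim] by (intro eventually_ball_finite) auto
  then obtain N where N: "\<And>n i. n \<ge> N \<Longrightarrow> i \<in> D \<Longrightarrow> A (s i (r n)) \<noteq> None" by (auto simp: eventually_sequentially)
  have sh: "strict_mono (\<lambda>n. n + N)" by (simp add: strict_mono_def)
  show ?thesis
  proof (intro exI conjI ballI allI)
    show "strict_mono (\<lambda>n. r (n + N))" using strict_mono_compose[OF r(1) sh] .
    show "mobius A" by (rule A)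
    show "cs_tendsto (\<lambda>n. A (s i (r (n + N)))) (Some (the (A (L i))))" if "i \<in> D" for i
      using cs_tendsto_subseq[OF lim[OF that] sh] .
    show "A (s i (r (n + N))) \<noteq> None" if "i \<in> D" for i n using N that by simp
  qed
qed

lemma mobius_three_ex:
  assumes "distinct [x, y, z :: cs]"
  shows "\<exists>\<phi>. mobius \<phi> \<and> \<phi> x = Some 0 \<and> \<phi> y = Some 1 \<and> \<phi> z = None"
proof -
  have "finite (the ` {x, y, z})" by simp
  then obtain u where u: "u \<notin> the ` {x, y, z}" using ex_new_if_finite[OF infinite_UNIV_char_0] by blast
  obtain B where B: "mobius B" "B (Some u) = None" using mobius_to_infinity by blast
  have injB: "inj B" using mobius_bij[OF B(1)] bij_is_inj by blast
  have fin: "B s \<noteq> None" if "s \<in> {x, y, z}" for s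
  proof
    assume "B s = None"
    then have "s = Some u" using B(2) injD[OF injB] by metis
    then show False using u that by force
  qed
  define x' y' z' where "x' = the (B x)" and "y' = the (B y)" and "z' = the (B z)"
  have B': "B x = Some x'" "B y = Some y'" "B z = Some z'" using fin by (auto simp: x'_def y'_def z'_def)
  have d: "distinct [x', y', z']" using assms B' inj_eq[OF injB] by (metis distinct_length_2_or_more distinct_singleton)
  define K where "K = lft (N1 x' y' z') (N2 x' y' z') (N3 x' y' z') (N4 x' y' z')"
  have "mobius K" unfolding K_def mobius_def using normaliser_det[OF d] by blast
  moreover have "K (B x) = Some 0" "K (B y) = Some 1" "K (B z) = None"
    unfolding K_def B' by (rule normaliser_values[OF d])+
  ultimately show ?thesis using mobius_comp[OF _ B(1), of K] by (intro exI[of _ "K \<circ> B"]) simp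
qed

section \<open>Charts\<close>

text \<open>Convergence as pairs of forms and not as maps: the limit pair may have a common factor,
  but independence keeps the limit nonconstant. \<open>\<phi>\<close> is the source chart and
  \<open>\<psi>\<close> the target chart.\<close>

definition converges_to :: "nat \<Rightarrow> (nat \<Rightarrow> cs \<Rightarrow> cs) \<Rightarrow> (nat \<Rightarrow> cs \<Rightarrow> cs) \<Rightarrow> (nat \<Rightarrow> cs \<Rightarrow> cs) \<Rightarrow>
    complex poly \<Rightarrow> complex poly \<Rightarrow> bool" where
  "converges_to d f \<phi> \<psi> P Q \<longleftrightarrow>
    (\<exists>p q. (\<forall>n. reduced d (p n) (q n) \<and> \<psi> n \<circ> f n \<circ> inv (\<phi> n) = rat_fun (p n) (q n)) \<and>
      (\<forall>i. (\<lambda>n. coeff (p n) i) \<longlonglongrightarrow> coeff P i) \<and> (\<forall>i. (\<lambda>n. coeff (q n) i) \<longlonglongrightarrow> coeff Q i)) \<and>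
    (\<forall>\<alpha> \<beta>. \<alpha> \<noteq> 0 \<or> \<beta> \<noteq> 0 \<longrightarrow> smult \<beta> P - smult \<alpha> Q \<noteq> 0)"

lemma converges_toI:
  assumes "\<And>n. reduced d (p n) (q n)" "\<And>n. \<psi> n \<circ> f n \<circ> inv (\<phi> n) = rat_fun (p n) (q n)"
    "\<And>i. (\<lambda>n. coeff (p n) i) \<longlonglongrightarrow> coeff P i" "\<And>i. (\<lambda>n. coeff (q n) i) \<longlonglongrightarrow> coeff Q i"
    "\<And>\<alpha> \<beta>. \<alpha> \<noteq> 0 \<or> \<beta> \<noteq> 0 \<Longrightarrow> smult \<beta> P - smult \<alpha> Q \<noteq> 0"
  shows "converges_to d f \<phi> \<psi> P Q"
  unfolding converges_to_def using assms by blast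

lemma converges_to_subseq:
  assumes "converges_to d f \<phi> \<psi> P Q" "strict_mono r"
  shows "converges_to d (\<lambda>n. f (r n)) (\<lambda>n. \<phi> (r n)) (\<lambda>n. \<psi> (r n)) P Q"
proof -
  obtain p q where pq: "\<And>n. reduced d (p n) (q n)" "\<And>n. \<psi> n \<circ> f n \<circ> inv (\<phi> n) = rat_fun (p n) (q n)"
    "\<And>i. (\<lambda>n. coeff (p n) i) \<longlonglongrightarrow> coeff P i" "\<And>i. (\<lambda>n. coeff (q n) i) \<longlonglongrightarrow> coeff Q i"
    using assms(1) unfolding converges_to_def by blast
  have "(\<lambda>n. coeff (p (r n)) i) \<longlonglongrightarrow> coeff P i" "(\<lambda>n. coeff (q (r n)) i) \<longlonglongrightarrow> coeff Q i" for i
    using LIMSEQ_subseq_LIMSEQ[OF pq(3) assms(2)] LIMSEQ_subseq_LIMSEQ[OF pq(4) assms(2)] by (simp_all add: o_def)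
  then show ?thesis using assms(1) pq(1,2) unfolding converges_to_def
    by (intro conjI exI[of _ "\<lambda>n. p (r n)"] exI[of _ "\<lambda>n. q (r n)"]) auto
qed

text \<open>Lets a target chart be exchanged for an equivalent one; independence survives because
  the limit matrix is invertible.\<close>

lemma converges_to_post:
  assumes c: "converges_to d f \<phi> \<psi> P Q" and \<psi>: "\<And>n. mobius (\<psi> n)" and m: "mob_converges (\<lambda>n. \<theta> n \<circ> inv (\<psi> n))"
  shows "\<exists>P' Q'. converges_to d f \<phi> \<theta> P' Q'"
proof -
  obtain p q where pq: "\<And>n. reduced d (p n) (q n)" "\<And>n. \<psi> n \<circ> f n \<circ> inv (\<phi> n) = rat_fun (p n) (q n)"
    "\<And>i. (\<lambda>n. coeff (p n) i) \<longlonglongrightarrow> coeff P i" "\<And>i. (\<lambda>n. coeff (q n) i) \<longlonglongrightarrow> coeff Q i"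
    and indep: "\<And>\<alpha> \<beta>. \<alpha> \<noteq> 0 \<or> \<beta> \<noteq> 0 \<Longrightarrow> smult \<beta> P - smult \<alpha> Q \<noteq> 0"
    using c unfolding converges_to_def by blast
  obtain a b c e :: "nat \<Rightarrow> complex" and a0 b0 c0 e0 where
    1: "\<And>n. a n * e n - b n * c n \<noteq> 0" "\<And>n. \<theta> n \<circ> inv (\<psi> n) = lft (a n) (b n) (c n) (e n)" and
    2: "a \<longlonglongrightarrow> a0" "b \<longlonglongrightarrow> b0" "c \<longlonglongrightarrow> c0" "e \<longlonglongrightarrow> e0" and 3: "a0 * e0 - b0 * c0 \<noteq> 0"
    using m unfolding mob_converges_def by blast
  define p' where "p' n = smult (a n) (p n) + smult (b n) (q n)" for n
  define q' where "q' n = smult (c n) (p n) + smult (e n) (q n)" for n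
  define P' where "P' = smult a0 P + smult b0 Q"
  define Q' where "Q' = smult c0 P + smult e0 Q"
  have red: "reduced d (p' n) (q' n)" for n unfolding p'_def q'_def using reduced_post[OF pq(1) 1(1)] .
  have eq: "\<theta> n \<circ> f n \<circ> inv (\<phi> n) = rat_fun (p' n) (q' n)" for n
  proof -
    have "inj (\<psi> n)" using mobius_bij[OF \<psi>] bij_is_inj by blast
    then have "inv (\<psi> n) \<circ> \<psi> n = id" by simp
    then have "\<theta> n \<circ> f n \<circ> inv (\<phi> n) = (\<theta> n \<circ> inv (\<psi> n)) \<circ> (\<psi> n \<circ> f n \<circ> inv (\<phi> n))"
      by (metis comp_assoc comp_id)
    then show ?thesis unfolding 1(2) pq(2) p'_def q'_def mat_comp_rat_fun[OF pq(1) 1(1)] .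
  qed
  have lim: "(\<lambda>n. coeff (p' n) i) \<longlonglongrightarrow> coeff P' i" "(\<lambda>n. coeff (q' n) i) \<longlonglongrightarrow> coeff Q' i" for i
    unfolding p'_def q'_def P'_def Q'_def coeff_add coeff_smult
    by (rule tendsto_add[OF tendsto_mult[OF 2(1) pq(3)] tendsto_mult[OF 2(2) pq(4)]],
        rule tendsto_add[OF tendsto_mult[OF 2(3) pq(3)] tendsto_mult[OF 2(4) pq(4)]])
  have "smult \<beta> P' - smult \<alpha> Q' \<noteq> 0" if ab: "\<alpha> \<noteq> 0 \<or> \<beta> \<noteq> 0" for \<alpha> \<beta>
  proof -
    have "smult \<beta> P' - smult \<alpha> Q' = smult (\<beta> * a0 - \<alpha> * c0) P - smult (\<alpha> * e0 - \<beta> * b0) Q"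
      unfolding P'_def Q'_def by (simp add: smult_add_right smult_diff_left)
    moreover have "e0 * \<alpha> + (- b0) * \<beta> \<noteq> 0 \<or> (- c0) * \<alpha> + a0 * \<beta> \<noteq> 0"
      by (rule matrix_kernel[OF adjugate_det[OF 3] ab])
    then have "\<alpha> * e0 - \<beta> * b0 \<noteq> 0 \<or> \<beta> * a0 - \<alpha> * c0 \<noteq> 0" by (simp add: mult.commute)
    ultimately show ?thesis using indep by simp
  qed
  then have "converges_to d f \<phi> \<theta> P' Q'" by (rule converges_toI[OF red eq lim])
  then show ?thesis by blast
qed

lemma mob_converges_const: "mobius A \<Longrightarrow> mob_converges (\<lambda>n. A)"
proof -
  assume "mobius A"
  then obtain a b c d where d: "a * d - b * c \<noteq> 0" "A = lft a b c d" by (auto simp: mobius_def)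
  show ?thesis by (rule mob_convergesI[OF d(2) d(1) tendsto_const tendsto_const tendsto_const tendsto_const d(1)])
qed

text \<open>The target chart comes from normalising coefficients, and a final constant map makes the
  limits of the marked values finite. Whether it belongs to a vertex of the target tree is decided
  only by the count.\<close>

lemma converges_to_exists:
  fixes Z :: "nat set"
  assumes f: "\<And>n. rat_map d (f n)" and d: "d \<ge> 1" and \<phi>: "\<And>n. mobius (\<phi> n)" and Z: "finite Z"
  shows "\<exists>s \<psi> P Q \<zeta>. strict_mono (s :: nat \<Rightarrow> nat) \<and> (\<forall>n. mobius (\<psi> n)) \<and>
    converges_to d (\<lambda>n. f (s n)) (\<lambda>n. \<phi> (s n)) \<psi> P Q \<and>
    (\<forall>b\<in>Z. cs_tendsto (\<lambda>n. \<psi> n (z (s n) b)) (Some (\<zeta> b)) \<and> (\<forall>n. \<psi> n (z (s n) b) \<noteq> None))"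
proof -
  have "rat_map d (f n \<circ> inv (\<phi> n))" for n using rat_map_comp_mobius(1)[OF f mobius_inv[OF \<phi>]] .
  then have "\<forall>n. \<exists>P Q. reduced d P Q \<and> f n \<circ> inv (\<phi> n) = rat_fun P Q" using rat_map_iff by auto
  then obtain p q where pq: "\<And>n. reduced d (p n) (q n)" "\<And>n. f n \<circ> inv (\<phi> n) = rat_fun (p n) (q n)" by metis
  from normalised_limit[of d p q, OF pq(1) d] show ?thesis
  proof (elim exE conjE)
    fix r :: "nat \<Rightarrow> nat" and a b c e :: "nat \<Rightarrow> complex" and P Q :: "complex poly"
    assume r0: "strict_mono r" "\<forall>n. a n * e n - b n * c n \<noteq> 0"
      "\<forall>i. (\<lambda>n. coeff (smult (a n) (p (r n)) + smult (b n) (q (r n))) i) \<longlonglongrightarrow> coeff P i"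
      "\<forall>i. (\<lambda>n. coeff (smult (c n) (p (r n)) + smult (e n) (q (r n))) i) \<longlonglongrightarrow> coeff Q i"
      "\<forall>\<alpha> \<beta>. \<alpha> \<noteq> 0 \<or> \<beta> \<noteq> 0 \<longrightarrow> smult \<beta> P - smult \<alpha> Q \<noteq> 0"
    have r: "strict_mono r" "\<And>n. a n * e n - b n * c n \<noteq> 0" using r0(1,2) by auto
    define \<psi> where "\<psi> n = lft (a n) (b n) (c n) (e n)" for n
    have m\<psi>: "mobius (\<psi> n)" for n unfolding \<psi>_def mobius_def using r(2) by blast
    have eq: "\<psi> n \<circ> f (r n) \<circ> inv (\<phi> (r n)) = rat_fun (smult (a n) (p (r n)) + smult (b n) (q (r n))) (smult (c n) (p (r n)) + smult (e n) (q (r n)))" for n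
      unfolding comp_assoc pq(2) \<psi>_def mat_comp_rat_fun[OF pq(1) r(2)] ..
    have conv: "converges_to d (\<lambda>n. f (r n)) (\<lambda>n. \<phi> (r n)) \<psi> P Q"
      by (rule converges_toI[OF reduced_post[OF pq(1) r(2)] eq]) (use r0(3-5) in simp_all)
    obtain t A \<zeta> where t: "strict_mono (t :: nat \<Rightarrow> nat)" "mobius A"
      "\<forall>b\<in>Z. cs_tendsto (\<lambda>n. A (\<psi> (t n) (z (r (t n)) b))) (Some (\<zeta> b)) \<and> (\<forall>n. A (\<psi> (t n) (z (r (t n)) b)) \<noteq> None)"
      using finite_charts[OF Z, of "\<lambda>b n. \<psi> n (z (r n) b)"] by blast
    have conv': "converges_to d (\<lambda>n. f (r (t n))) (\<lambda>n. \<phi> (r (t n))) (\<lambda>n. \<psi> (t n)) P Q"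
      using converges_to_subseq[OF conv t(1)] .
    have "A \<circ> \<psi> (t n) \<circ> inv (\<psi> (t n)) = A" for n
      unfolding comp_assoc using mobius_bij[OF m\<psi>[of "t n"]] by (metis bij_is_surj comp_id surj_iff)
    then have "mob_converges (\<lambda>n. A \<circ> \<psi> (t n) \<circ> inv (\<psi> (t n)))" using mob_converges_const[OF t(2)] by simp
    then obtain P' Q' where "converges_to d (\<lambda>n. f (r (t n))) (\<lambda>n. \<phi> (r (t n))) (\<lambda>n. A \<circ> \<psi> (t n)) P' Q'"
      using converges_to_post[OF conv' m\<psi>, of "\<lambda>n. A \<circ> \<psi> (t n)"] by blast
    then show ?thesis using strict_mono_compose[OF r(1) t(1)] mobius_comp[OF t(2) m\<psi>] t(3)
      by (intro exI[of _ "\<lambda>n. r (t n)"] exI[of _ "\<lambda>n. A \<circ> \<psi> (t n)"] exI[of _ P'] exI[of _ Q'] exI[of _ \<zeta>]) simp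
  qed
qed

text \<open>A triple separated in both limits makes the change of charts convergent by
  \<open>three_point_convergence\<close>. Its limit carries positions to positions and, being
  injective, preserves which points coincide.\<close>

lemma common_triple_converges:
  assumes \<phi>: "\<And>n. mobius (\<phi> n)" "\<And>n. mobius (\<theta> n)" and inj: "\<And>n. inj_on (y n) S"
    and lim: "\<And>e. e \<in> S \<Longrightarrow> cs_tendsto (\<lambda>n. \<phi> n (y n e)) (Some (\<alpha> e))" "\<And>e n. e \<in> S \<Longrightarrow> \<phi> n (y n e) \<noteq> None"
    and lim': "\<And>e. e \<in> S \<Longrightarrow> cs_tendsto (\<lambda>n. \<theta> n (y n e)) (Some (\<beta> e))" "\<And>e n. e \<in> S \<Longrightarrow> \<theta> n (y n e) \<noteq> None"
    and t: "t1 \<in> S" "t2 \<in> S" "t3 \<in> S" "distinct [\<alpha> t1, \<alpha> t2, \<alpha> t3]" "distinct [\<beta> t1, \<beta> t2, \<beta> t3]"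
  shows "mob_converges (\<lambda>n. \<theta> n \<circ> inv (\<phi> n))" "\<And>e e'. e \<in> S \<Longrightarrow> e' \<in> S \<Longrightarrow> \<alpha> e = \<alpha> e' \<longleftrightarrow> \<beta> e = \<beta> e'"
proof -
  define u where "u n e = the (\<phi> n (y n e))" for n e
  define w where "w n e = the (\<theta> n (y n e))" for n e
  have u: "\<phi> n (y n e) = Some (u n e)" "\<theta> n (y n e) = Some (w n e)" if "e \<in> S" for n e
    using lim(2) lim'(2) that by (auto simp: u_def w_def)
  have lu: "(\<lambda>n. u n e) \<longlonglongrightarrow> \<alpha> e" "(\<lambda>n. w n e) \<longlonglongrightarrow> \<beta> e" if "e \<in> S" for e
    unfolding u_def w_def using cs_tendsto_the lim lim' that by blast+
  have bij: "bij (\<phi> n)" for n using mobius_bij[OF \<phi>(1)] .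
  have A: "(\<theta> n \<circ> inv (\<phi> n)) (Some (u n e)) = Some (w n e)" if "e \<in> S" for n e
    using u[OF that, of n] inv_f_f[OF bij_is_inj[OF bij]] by (metis comp_apply)
  have dist: "distinct [u n t1, u n t2, u n t3]" for n
  proof -
    have "u n e \<noteq> u n e'" if e: "e \<in> S" "e' \<in> S" "e \<noteq> e'" for e e'
    proof
      assume "u n e = u n e'"
      then have "\<phi> n (y n e) = \<phi> n (y n e')" using u e by simp
      then have "y n e = y n e'" using injD[OF bij_is_inj[OF bij]] by blast
      then show False using inj_onD[OF inj] e by blast
    qed
    moreover have "t1 \<noteq> t2" "t1 \<noteq> t3" "t2 \<noteq> t3" using t by auto
    ultimately show ?thesis using t by simp
  qed
  show mc: "mob_converges (\<lambda>n. \<theta> n \<circ> inv (\<phi> n))"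
    by (rule three_point_convergence[OF _ dist t(4) lu(1)[OF t(1)] lu(1)[OF t(2)] lu(1)[OF t(3)]
          A[OF t(1)] A[OF t(2)] A[OF t(3)] lu(2)[OF t(1)] lu(2)[OF t(2)] lu(2)[OF t(3)] t(5)])
      (use mobius_comp \<phi> mobius_inv in blast)
  obtain \<chi>0 where c: "mobius \<chi>0" "\<And>x l. x \<longlonglongrightarrow> l \<Longrightarrow> cs_tendsto (\<lambda>n. (\<theta> n \<circ> inv (\<phi> n)) (Some (x n))) (\<chi>0 (Some l))"
    using mob_converges_limit[OF mc] by blast
  have val: "\<chi>0 (Some (\<alpha> e)) = Some (\<beta> e)" if "e \<in> S" for e
  proof -
    have "cs_tendsto (\<lambda>n. Some (w n e)) (\<chi>0 (Some (\<alpha> e)))" using c(2)[OF lu(1)[OF that]] unfolding A[OF that] .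
    moreover have "cs_tendsto (\<lambda>n. Some (w n e)) (Some (\<beta> e))" using lu(2)[OF that] by (simp add: cs_tendsto_Some_iff)
    ultimately show ?thesis by (rule cs_tendsto_unique)
  qed
  have i: "inj \<chi>0" using mobius_bij[OF c(1)] bij_is_inj by blast
  show "\<alpha> e = \<alpha> e' \<longleftrightarrow> \<beta> e = \<beta> e'" if "e \<in> S" "e' \<in> S" for e e'
    using inj_eq[OF i, of "Some (\<alpha> e)" "Some (\<alpha> e')"] val that by simp
qed

section \<open>Triples, their labels and the tree they carry\<close>

definition triples :: "nat set \<Rightarrow> (nat \<times> nat \<times> nat) set" where
  "triples S = {(x, y, z). x \<in> S \<and> y \<in> S \<and> z \<in> S \<and> distinct [x, y, z]}"

lemma finite_triples: "finite S \<Longrightarrow> finite (triples S)"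
  by (rule finite_subset[of _ "S \<times> S \<times> S"]) (auto simp: triples_def)

text \<open>The shift by K keeps vertex names apart from leaf names; otherwise a name depends on the
  triple only, so the vertex of (0, 1, 2) is called the same in the source and in the target
  tree.\<close>

definition label :: "nat \<Rightarrow> nat \<times> nat \<times> nat \<Rightarrow> nat" where
  "label K = (\<lambda>(x, y, z). K + prod_encode (x, prod_encode (y, z)))"

definition unlabel :: "nat \<Rightarrow> nat \<Rightarrow> nat \<times> nat \<times> nat" where
  "unlabel K v = (let (x, u) = prod_decode (v - K) in (x, prod_decode u))"

lemma unlabel_label [simp]: "unlabel K (label K t) = t"
  by (cases t) (simp add: label_def unlabel_def)

abbreviation separated :: "(nat \<Rightarrow> complex) \<Rightarrow> nat \<times> nat \<times> nat \<Rightarrow> bool" where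
  "separated \<alpha> t \<equiv> distinct [\<alpha> (fst t), \<alpha> (fst (snd t)), \<alpha> (snd (snd t))]"

text \<open>Triples are equivalent when their charts induce the same partition of the marked points,
  and one triple per class becomes a vertex. By \<open>ker\<close>, a triple separated in the chart
  of another lies in its class, which gives uniqueness of the separating vertex.\<close>

lemma tree_from_triples:
  assumes S: "finite S" and K: "\<And>s. s \<in> S \<Longrightarrow> s < K" and t0: "t0 \<in> triples S"
    and own: "\<And>t. t \<in> triples S \<Longrightarrow> separated (\<alpha> t) t"
    and ker: "\<And>t t' e e'. t \<in> triples S \<Longrightarrow> t' \<in> triples S \<Longrightarrow> separated (\<alpha> t) t' \<Longrightarrow> e \<in> S \<Longrightarrow> e' \<in> S \<Longrightarrow>
      \<alpha> t e = \<alpha> t e' \<longleftrightarrow> \<alpha> t' e = \<alpha> t' e'"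
  shows "\<exists>I. I \<subseteq> label K ` triples S \<and> label K t0 \<in> I \<and> split_tree S I (\<lambda>v. \<alpha> (unlabel K v))"
proof -
  define k where "k t = {(e, e'). e \<in> S \<and> e' \<in> S \<and> \<alpha> t e = \<alpha> t e'}" for t
  have keq: "k t = k t'" if "t \<in> triples S" "t' \<in> triples S" "separated (\<alpha> t) t'" for t t'
    using ker[OF that] by (auto simp: k_def)
  have ksep: "\<alpha> t e = \<alpha> t e' \<longleftrightarrow> \<alpha> t' e = \<alpha> t' e'" if "k t = k t'" "e \<in> S" "e' \<in> S" for t t' e e'
    using that by (auto simp: k_def set_eq_iff)
  \<comment> \<open>The class of \<open>t0\<close> is represented by \<open>t0\<close> itself, so
    that its label is a vertex of both trees whatever the other choices are.\<close>
  define rep where "rep c = (if c = k t0 then t0 else SOME t. t \<in> triples S \<and> k t = c)" for c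
  have rep: "rep (k t) \<in> triples S \<and> k (rep (k t)) = k t" if "t \<in> triples S" for t
  proof (cases "k t = k t0")
    case False
    have "(SOME t'. t' \<in> triples S \<and> k t' = k t) \<in> triples S \<and> k (SOME t'. t' \<in> triples S \<and> k t' = k t) = k t"
      by (rule someI[of "\<lambda>t'. t' \<in> triples S \<and> k t' = k t" t]) (use that in simp)
    then show ?thesis using False by (simp add: rep_def)
  qed (use t0 in \<open>simp add: rep_def\<close>)
  define I where "I = label K ` rep ` k ` triples S"
  have I: "\<exists>t. v = label K t \<and> t \<in> triples S \<and> t = rep (k t)" if v: "v \<in> I" for v
  proof -
    obtain t where t: "t \<in> triples S" "v = label K (rep (k t))" using v by (auto simp: I_def)
    then show ?thesis using rep[OF t(1)] by (intro exI[of _ "rep (k t)"]) auto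
  qed
  have "split_tree S I (\<lambda>v. \<alpha> (unlabel K v))"
  proof
    show "finite S" by (rule S)
    show "finite I" unfolding I_def using finite_triples[OF S] by simp
    show "S \<inter> I = {}" using K by (force simp: I_def label_def split: prod.splits)
    have "card {fst t0, fst (snd t0), snd (snd t0)} = 3" using t0 by (auto simp: triples_def)
    moreover have "{fst t0, fst (snd t0), snd (snd t0)} \<subseteq> S" using t0 by (auto simp: triples_def)
    ultimately show "card S \<ge> 3" using card_mono[OF S] by metis
    fix v assume "v \<in> I"
    then obtain t where t: "v = label K t" "t \<in> triples S" using I by blast
    have "card {\<alpha> t (fst t), \<alpha> t (fst (snd t)), \<alpha> t (snd (snd t))} = 3" using own[OF t(2)] by auto
    moreover have "{\<alpha> t (fst t), \<alpha> t (fst (snd t)), \<alpha> t (snd (snd t))} \<subseteq> \<alpha> t ` S" using t(2) by (auto simp: triples_def)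
    ultimately show "card (\<alpha> (unlabel K v) ` S) \<ge> 3" using card_mono[OF finite_imageI[OF S]] t(1) by (metis unlabel_label)
  next
    fix x y z assume xyz: "x \<in> S" "y \<in> S" "z \<in> S" "distinct [x, y, z]"
    then have t: "(x, y, z) \<in> triples S" by (simp add: triples_def)
    define t' where "t' = rep (k (x, y, z))"
    have t': "t' \<in> triples S" "k t' = k (x, y, z)" using rep[OF t] by (auto simp: t'_def)
    have "distinct [\<alpha> t' x, \<alpha> t' y, \<alpha> t' z]" using own[OF t] ksep[OF t'(2)] xyz by simp
    moreover have "label K t' \<in> I" using t by (auto simp: I_def t'_def)
    ultimately show "\<exists>v\<in>I. distinct [\<alpha> (unlabel K v) x, \<alpha> (unlabel K v) y, \<alpha> (unlabel K v) z]"
      by (intro bexI[of _ "label K t'"]) simp_all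
  next
    fix v w x y z assume vw: "v \<in> I" "w \<in> I" and xyz: "x \<in> S" "y \<in> S" "z \<in> S"
      and d: "distinct [\<alpha> (unlabel K v) x, \<alpha> (unlabel K v) y, \<alpha> (unlabel K v) z]"
      "distinct [\<alpha> (unlabel K w) x, \<alpha> (unlabel K w) y, \<alpha> (unlabel K w) z]"
    have t: "(x, y, z) \<in> triples S" using xyz d(1) by (auto simp: triples_def)
    obtain t1 where t1: "v = label K t1" "t1 \<in> triples S" "t1 = rep (k t1)" using I[OF vw(1)] by blast
    obtain t2 where t2: "w = label K t2" "t2 \<in> triples S" "t2 = rep (k t2)" using I[OF vw(2)] by blast
    have "k t1 = k (x, y, z)" using keq[OF t1(2) t] d(1) t1(1) by simp
    moreover have "k t2 = k (x, y, z)" using keq[OF t2(2) t] d(2) t2(1) by simp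
    ultimately show "v = w" using t1 t2 by simp
  qed
  moreover have "I \<subseteq> label K ` triples S" using I by blast
  moreover have "label K t0 \<in> I"
  proof -
    have "rep (k t0) = t0" by (simp add: rep_def)
    then show ?thesis using t0 unfolding I_def by force
  qed
  ultimately show ?thesis by blast
qed

lemma vertex_limitI:
  assumes d: "d \<ge> 1" and port: "portrait d Y Z F deg" and Zne: "Z \<noteq> {}"
    and dm: "\<And>n. dyn_marked d Y Z F deg X (f n) (y n) (z n)"
    and mob: "\<And>n. mobius (\<phi> n)" "\<And>n. mobius (\<psi> n)" and c: "converges_to d f \<phi> \<psi> P Q"
    and ly: "\<And>a. a \<in> Y \<Longrightarrow> cs_tendsto (\<lambda>n. \<phi> n (y n a)) (Some (\<eta> a))" "\<And>a n. a \<in> Y \<Longrightarrow> \<phi> n (y n a) \<noteq> None"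
    and lz: "\<And>b. b \<in> Z \<Longrightarrow> cs_tendsto (\<lambda>n. \<psi> n (z n b)) (Some (\<zeta> b))" "\<And>b n. b \<in> Z \<Longrightarrow> \<psi> n (z n b) \<noteq> None"
  shows "\<exists>p q eta zeta. vertex_limit d Y Z F deg p q eta zeta P Q \<eta> \<zeta> \<and>
    (\<forall>n. \<psi> n \<circ> f n \<circ> inv (\<phi> n) = rat_fun (p n) (q n))"
proof -
  obtain p q where pq: "\<And>n. reduced d (p n) (q n)" "\<And>n. \<psi> n \<circ> f n \<circ> inv (\<phi> n) = rat_fun (p n) (q n)"
    "\<And>i. (\<lambda>n. coeff (p n) i) \<longlonglongrightarrow> coeff P i" "\<And>i. (\<lambda>n. coeff (q n) i) \<longlonglongrightarrow> coeff Q i"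
    and indep: "\<And>\<alpha> \<beta>. \<alpha> \<noteq> 0 \<or> \<beta> \<noteq> 0 \<Longrightarrow> smult \<beta> P - smult \<alpha> Q \<noteq> 0"
    using c unfolding converges_to_def by blast
  define eta where "eta n a = the (\<phi> n (y n a))" for n a
  define zeta where "zeta n b = the (\<psi> n (z n b))" for n b
  have e: "\<phi> n (y n a) = Some (eta n a)" if "a \<in> Y" for n a using ly(2)[OF that] by (auto simp: eta_def)
  have ze: "\<psi> n (z n b) = Some (zeta n b)" if "b \<in> Z" for n b using lz(2)[OF that] by (auto simp: zeta_def)
  have i: "inj (\<phi> n)" for n using mobius_bij[OF mob(1)] bij_is_inj by blast
  have ie: "inv (\<phi> n) (Some (eta n a)) = y n a" if "a \<in> Y" for n a
    using inv_f_f[OF i, of n "y n a"] e[OF that, of n] by simp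
  have FZ: "F a \<in> Z" if "a \<in> Y" for a using port that by (auto simp: portrait_def)
  have m: "rat_map d (f n)" "inj_on (y n) Y" "\<And>a. a \<in> Y \<Longrightarrow> f n (y n a) = z n (F a)"
    "\<And>a. a \<in> Y \<Longrightarrow> ldeg (f n) (y n a) = deg a" for n
    using dm[of n] by (auto simp: dyn_marked_def)
  have "vertex_limit d Y Z F deg p q eta zeta P Q \<eta> \<zeta>"
  proof
    show "rat_fun (p n) (q n) (Some (eta n a)) = Some (zeta n (F a))" if "a \<in> Y" for n a
      unfolding pq(2)[symmetric] using ie[OF that] m(3)[OF that] ze[OF FZ[OF that]] by simp
    show "ldeg (rat_fun (p n) (q n)) (Some (eta n a)) = deg a" if "a \<in> Y" for n a
      unfolding pq(2)[symmetric] using ldeg_mobius_conj(2)[OF m(1) d mobius_inv[OF mob(1)] mob(2)] ie[OF that] m(4)[OF that] by simp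
    show "inj_on (eta n) Y" for n
    proof (rule inj_onI)
      fix a a' assume a: "a \<in> Y" "a' \<in> Y" "eta n a = eta n a'"
      then have "y n a = y n a'" using ie by metis
      then show "a = a'" using inj_onD[OF m(2)] a by blast
    qed
    show "(\<lambda>n. eta n a) \<longlonglongrightarrow> \<eta> a" if "a \<in> Y" for a unfolding eta_def using cs_tendsto_the ly that by blast
    show "(\<lambda>n. zeta n b) \<longlonglongrightarrow> \<zeta> b" if "b \<in> Z" for b unfolding zeta_def using cs_tendsto_the lz that by blast
  qed (use d port Zne pq indep in auto)
  then show ?thesis using pq(2) by blast
qed

lemma cover_dataI:
  assumes "split_tree Y I a" "d \<ge> 1" "portrait d Y Z F deg" "card Z \<ge> 2"
    and vl: "\<And>v. v \<in> I \<Longrightarrow> vertex_limit d Y Z F deg (p v) (q v) (eta v) (zeta v) (P v) (Q v) (a v) (\<zeta> v)"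
  shows "cover_data Y I a d Z F deg (\<lambda>v h. order h (vertex_limit.H (P v) (Q v)))
    (\<lambda>v h. ldeg (vertex_limit.g (P v) (Q v)) (Some h)) (\<lambda>v h. vertex_limit.g (P v) (Q v) (Some h)) \<zeta>
    (\<lambda>v. vertex_limit.e (P v) (Q v))"
proof -
  interpret split_tree Y I a by fact
  show ?thesis
  proof
    fix v assume v: "v \<in> I"
    interpret V: vertex_limit d Y Z F deg "p v" "q v" "eta v" "zeta v" "P v" "Q v" "a v" "\<zeta> v" by (rule vl[OF v])
    show "1 \<le> V.e" by (rule V.e_pos)
    show "(\<Sum>h\<in>a v ` Y. ldeg V.g (Some h) - 1) = 2 * V.e - 2" by (rule V.sum_critical_limit)
    fix h
    show "1 \<le> ldeg V.g (Some h)" by (rule V.ldeg_g_pos)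
    show "(\<Sum>x | x \<in> Y \<and> a v x = h. deg x - 1) = 2 * order h V.H + (ldeg V.g (Some h) - 1)" by (rule V.count_critical)
  next
    fix v b assume v: "v \<in> I" and b: "b \<in> Z"
    interpret V: vertex_limit d Y Z F deg "p v" "q v" "eta v" "zeta v" "P v" "Q v" "a v" "\<zeta> v" by (rule vl[OF v])
    show "(\<Sum>h\<in>{h \<in> a v ` Y. V.g (Some h) = Some (\<zeta> v b)}. ldeg V.g (Some h)) = V.e" by (rule V.sum_fibre_limit[OF b])
    fix h
    show "(\<Sum>x | x \<in> Y \<and> a v x = h \<and> F x = b. deg x) = order h V.H + (if V.g (Some h) = Some (\<zeta> v b) then ldeg V.g (Some h) else 0)"
      by (rule V.count_fibre[OF b])
  qed (use assms in auto)
qed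

section \<open>The limit cover\<close>

lemma three_distinct_values:
  assumes "card (\<alpha> ` S) \<ge> 3" shows "\<exists>x\<in>S. \<exists>y\<in>S. \<exists>z\<in>S. distinct [\<alpha> x, \<alpha> y, \<alpha> z]"
proof -
  obtain B where B: "B \<subseteq> \<alpha> ` S" "card B = 3" using obtain_subset_with_card_n[OF assms] by metis
  then obtain p q r where "B = {p, q, r}" "distinct [p, q, r]" by (auto simp: card_3_iff)
  then show ?thesis using B(1) by auto
qed

text \<open>Source and target trees with their charts, before any image vertex is known.\<close>

locale marked_sequence = S: split_tree Y IY aY + T: split_tree Z IZ aZ
  for Y IY aY Z IZ aZ +
  fixes d :: nat and F deg :: "nat \<Rightarrow> nat" and X :: "nat set" and f :: "nat \<Rightarrow> cs \<Rightarrow> cs"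
    and y z :: "nat \<Rightarrow> nat \<Rightarrow> cs" and \<phi>Y \<phi>Z :: "nat \<Rightarrow> nat \<Rightarrow> cs \<Rightarrow> cs"
  assumes d: "d \<ge> 1" and port: "portrait d Y Z F deg"
    and dm: "\<And>n. dyn_marked d Y Z F deg X (f n) (y n) (z n)"
    and mobY: "\<And>n v. v \<in> IY \<Longrightarrow> mobius (\<phi>Y n v)" and mobZ: "\<And>n w. w \<in> IZ \<Longrightarrow> mobius (\<phi>Z n w)"
    and limY: "\<And>v a. v \<in> IY \<Longrightarrow> a \<in> Y \<Longrightarrow> cs_tendsto (\<lambda>n. \<phi>Y n v (y n a)) (Some (aY v a))"
      "\<And>v a n. v \<in> IY \<Longrightarrow> a \<in> Y \<Longrightarrow> \<phi>Y n v (y n a) \<noteq> None"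
    and limZ: "\<And>w b. w \<in> IZ \<Longrightarrow> b \<in> Z \<Longrightarrow> cs_tendsto (\<lambda>n. \<phi>Z n w (z n b)) (Some (aZ w b))"
      "\<And>w b n. w \<in> IZ \<Longrightarrow> b \<in> Z \<Longrightarrow> \<phi>Z n w (z n b) \<noteq> None"
begin

lemma Z_ne: "Z \<noteq> {}" using T.cardX by auto

lemma vertex_limits:
  assumes "\<And>n v. v \<in> IY \<Longrightarrow> mobius (\<psi> v n)" "\<And>v. v \<in> IY \<Longrightarrow> converges_to d f (\<lambda>n. \<phi>Y n v) (\<psi> v) (P v) (Q v)"
    "\<And>v b. v \<in> IY \<Longrightarrow> b \<in> Z \<Longrightarrow> cs_tendsto (\<lambda>n. \<psi> v n (z n b)) (Some (\<zeta> v b))"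
    "\<And>v b n. v \<in> IY \<Longrightarrow> b \<in> Z \<Longrightarrow> \<psi> v n (z n b) \<noteq> None"
  shows "\<exists>p q eta zeta. \<forall>v\<in>IY. vertex_limit d Y Z F deg (p v) (q v) (eta v) (zeta v) (P v) (Q v) (aY v) (\<zeta> v) \<and>
    (\<forall>n. \<psi> v n \<circ> f n \<circ> inv (\<phi>Y n v) = rat_fun (p v n) (q v n))"
proof -
  have "\<forall>v\<in>IY. \<exists>p q eta zeta. vertex_limit d Y Z F deg p q eta zeta (P v) (Q v) (aY v) (\<zeta> v) \<and>
    (\<forall>n. \<psi> v n \<circ> f n \<circ> inv (\<phi>Y n v) = rat_fun (p n) (q n))"
    by (intro ballI vertex_limitI[OF d port Z_ne dm mobY assms(1,2) limY assms(3,4)])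
  then show ?thesis by metis
qed

text \<open>The normalised target chart sees three distinct marked values by
  \<open>three_images\<close>; the chart of the target vertex separating these three differs from it
  by a convergent map.\<close>

lemma image_vertex:
  assumes \<psi>: "\<And>n v. v \<in> IY \<Longrightarrow> mobius (\<psi> v n)" "\<And>v. v \<in> IY \<Longrightarrow> converges_to d f (\<lambda>n. \<phi>Y n v) (\<psi> v) (P v) (Q v)"
    "\<And>v b. v \<in> IY \<Longrightarrow> b \<in> Z \<Longrightarrow> cs_tendsto (\<lambda>n. \<psi> v n (z n b)) (Some (\<zeta> v b))"
    "\<And>v b n. v \<in> IY \<Longrightarrow> b \<in> Z \<Longrightarrow> \<psi> v n (z n b) \<noteq> None"
    and v: "v \<in> IY"
  shows "\<exists>w\<in>IZ. \<exists>P' Q'. converges_to d f (\<lambda>n. \<phi>Y n v) (\<lambda>n. \<phi>Z n w) P' Q'"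
proof -
  obtain p q eta zeta where vl: "\<And>v. v \<in> IY \<Longrightarrow> vertex_limit d Y Z F deg (p v) (q v) (eta v) (zeta v) (P v) (Q v) (aY v) (\<zeta> v)"
    using vertex_limits[of \<psi> P Q \<zeta>, OF \<psi>] by blast
  have cZ: "card Z \<ge> 2" using T.cardX by simp
  interpret cover_data Y IY aY d Z F deg "\<lambda>v h. order h (vertex_limit.H (P v) (Q v))"
    "\<lambda>v h. ldeg (vertex_limit.g (P v) (Q v)) (Some h)" "\<lambda>v h. vertex_limit.g (P v) (Q v) (Some h)" \<zeta>
    "\<lambda>v. vertex_limit.e (P v) (Q v)"
    by (rule cover_dataI[OF S.split_tree_axioms d port cZ vl])
  obtain b1 b2 b3 where b: "b1 \<in> Z" "b2 \<in> Z" "b3 \<in> Z" "distinct [\<zeta> v b1, \<zeta> v b2, \<zeta> v b3]"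
    using three_distinct_values[OF three_images[OF v]] by blast
  then have "distinct [b1, b2, b3]" by auto
  then obtain w where w: "w \<in> IZ" "distinct [aZ w b1, aZ w b2, aZ w b3]" using T.sep b by blast
  have inj: "inj_on (z n) Z" for n using dm[of n] by (simp add: dyn_marked_def)
  have "mob_converges (\<lambda>n. \<phi>Z n w \<circ> inv (\<psi> v n))"
    by (rule common_triple_converges(1)[where S = Z, OF \<psi>(1)[OF v] mobZ[OF w(1)] inj \<psi>(3)[OF v] \<psi>(4)[OF v]
          limZ(1)[OF w(1)] limZ(2)[OF w(1)] b(1,2,3) b(4) w(2)])
  then show ?thesis using converges_to_post[OF \<psi>(2)[OF v] \<psi>(1)[OF v], of "\<lambda>n. \<phi>Z n w"] w(1) by blast
qed

end

locale limit_cover = marked_sequence +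
  fixes W :: "nat \<Rightarrow> nat" and P Q :: "nat \<Rightarrow> complex poly"
  assumes W: "\<And>v. v \<in> IY \<Longrightarrow> W v \<in> IZ"
    and conv: "\<And>v. v \<in> IY \<Longrightarrow> converges_to d f (\<lambda>n. \<phi>Y n v) (\<lambda>n. \<phi>Z n (W v)) (P v) (Q v)"
begin

definition fv :: "nat \<Rightarrow> cs \<Rightarrow> cs" where "fv v = vertex_limit.g (P v) (Q v)"
definition G :: "nat \<Rightarrow> nat" where "G u = (if u \<in> IY then W u else F u)"
text \<open>The direction at \<open>W v\<close> into which the direction of x is sent. It is
  nonempty by the count, hence a genuine block of the target tree.\<close>

definition Cs :: "nat \<Rightarrow> nat \<Rightarrow> nat set" where
  "Cs v x = {b \<in> Z. fv v (Some (aY v x)) = Some (aZ (W v) b)}"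

lemma limits_ex: "\<exists>p q eta zeta. \<forall>v\<in>IY.
    vertex_limit d Y Z F deg (p v) (q v) (eta v) (zeta v) (P v) (Q v) (aY v) (aZ (W v)) \<and>
    (\<forall>n. \<phi>Z n (W v) \<circ> f n \<circ> inv (\<phi>Y n v) = rat_fun (p v n) (q v n))"
  by (rule vertex_limits[of "\<lambda>v n. \<phi>Z n (W v)" P Q "\<lambda>v. aZ (W v)"])
    (use mobZ W conv limZ in auto)

lemma
  shows Cs_ne: "\<And>v x. v \<in> IY \<Longrightarrow> x \<in> Y \<Longrightarrow> Cs v x \<noteq> {}"
    and Cs_edge: "\<And>v v' x x'. v \<in> IY \<Longrightarrow> v' \<in> IY \<Longrightarrow> S.fib v x \<in> S.bl v \<Longrightarrow> Y - S.fib v x = S.fib v' x' \<Longrightarrow>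
      x \<in> Y \<Longrightarrow> x' \<in> Y \<Longrightarrow> Cs v' x' = Z - Cs v x \<and> ldeg (fv v) (Some (aY v x)) = ldeg (fv v') (Some (aY v' x'))"
    and Cs_leaf: "\<And>v x. v \<in> IY \<Longrightarrow> x \<in> Y \<Longrightarrow> S.fib v x = {x} \<Longrightarrow>
      Cs v x = {F x} \<and> ldeg (fv v) (Some (aY v x)) = deg x"
proof -
  obtain p q eta zeta where vl: "\<And>v. v \<in> IY \<Longrightarrow>
    vertex_limit d Y Z F deg (p v) (q v) (eta v) (zeta v) (P v) (Q v) (aY v) (aZ (W v))"
    using limits_ex by blast
  have cZ: "card Z \<ge> 2" using T.cardX by simp
  interpret cd: cover_data Y IY aY d Z F deg "\<lambda>v h. order h (vertex_limit.H (P v) (Q v))"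
    "\<lambda>v h. ldeg (vertex_limit.g (P v) (Q v)) (Some h)" "\<lambda>v h. vertex_limit.g (P v) (Q v) (Some h)" "\<lambda>v. aZ (W v)"
    "\<lambda>v. vertex_limit.e (P v) (Q v)"
    by (rule cover_dataI[OF S.split_tree_axioms d port cZ vl])
  have C: "cd.C v (aY v x) = Cs v x" for v x by (simp add: cd.C_def Cs_def fv_def)
  show "Cs v x \<noteq> {}" if "v \<in> IY" "x \<in> Y" for v x using cd.C_nonempty[OF that] by (simp add: C)
  show "Cs v' x' = Z - Cs v x \<and> ldeg (fv v) (Some (aY v x)) = ldeg (fv v') (Some (aY v' x'))"
    if "v \<in> IY" "v' \<in> IY" "S.fib v x \<in> S.bl v" "Y - S.fib v x = S.fib v' x'" "x \<in> Y" "x' \<in> Y" for v v' x x'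
    using cd.edge_counts[OF that] unfolding C by (auto simp: fv_def)
  show "Cs v x = {F x} \<and> ldeg (fv v) (Some (aY v x)) = deg x" if "v \<in> IY" "x \<in> Y" "S.fib v x = {x}" for v x
    using cd.leaf_counts[OF that] unfolding C by (simp add: fv_def)
qed

lemma F_Z: "x \<in> Y \<Longrightarrow> F x \<in> Z"
  using port by (auto simp: portrait_def)

lemma Y_IY: "x \<in> Y \<Longrightarrow> x \<notin> IY"
  using S.disj by auto

lemma Cs_block:
  assumes "v \<in> IY" "b \<in> Cs v x" shows "Cs v x = T.fib (W v) b" "Cs v x \<in> T.bl (W v)"
proof -
  have b: "b \<in> Z" "fv v (Some (aY v x)) = Some (aZ (W v) b)" using assms by (auto simp: Cs_def)
  show "Cs v x = T.fib (W v) b" using b by (auto simp: Cs_def T.fib_def)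
  then show "Cs v x \<in> T.bl (W v)" using b W[OF assms(1)] by (simp add: T.bl_I)
qed

lemma edge_form:
  assumes u: "u \<in> IY" and adj: "adj S.EE u u'"
  obtains x where "x \<in> Y" "S.fib u x \<in> S.bl u" "Y - S.fib u x \<in> S.bl u'"
    "(u' \<in> IY \<and> (\<exists>x'\<in>Y. Y - S.fib u x = S.fib u' x')) \<or> (u' \<in> Y \<and> u' = x \<and> S.fib u x = {x})"
proof -
  obtain B where B: "B \<in> S.bl u" "Y - B \<in> S.bl u'" and u'V: "u' \<in> S.VV" using adj by (auto simp: S.adj_iff)
  obtain x where x: "x \<in> Y" "B = S.fib u x" using B(1) u by (auto simp: S.bl_I)
  have "(u' \<in> IY \<and> (\<exists>x'\<in>Y. Y - B = S.fib u' x')) \<or> (u' \<in> Y \<and> u' = x \<and> B = {x})"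
  proof (cases "u' \<in> IY")
    case True
    then show ?thesis using B(2) by (auto simp: S.bl_I)
  next
    case False
    then have uY: "u' \<in> Y" using u'V by (auto simp: S.VV_def)
    then have "Y - B = Y - {u'}" using B(2) by (simp add: S.bl_X)
    then have "B = {u'}" using uY S.bl_sub[OF B(1)] by auto
    then show ?thesis using x uY by (auto simp: S.fib_def)
  qed
  then show thesis using that[of x] x B by simp
qed

text \<open>Complementary blocks have complementary images by \<open>Cs_edge\<close>, and the
  direction of a leaf x goes to that of the leaf F x by \<open>Cs_leaf\<close>; the images therefore
  span an edge.\<close>

lemma edge_image:
  assumes u: "u \<in> IY" and adj: "adj S.EE u u'" and x: "x \<in> Y" "S.fib u x \<in> S.bl u"
    "(u' \<in> IY \<and> (\<exists>x'\<in>Y. Y - S.fib u x = S.fib u' x')) \<or> (u' \<in> Y \<and> u' = x \<and> S.fib u x = {x})"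
  shows "Cs u x \<in> T.bl (W u)" "Z - Cs u x \<in> T.bl (G u')" "adj T.EE (W u) (G u')"
proof -
  show 1: "Cs u x \<in> T.bl (W u)" using Cs_ne[OF u x(1)] Cs_block(2)[OF u] by blast
  show 2: "Z - Cs u x \<in> T.bl (G u')"
    using x(3)
  proof
    assume a: "u' \<in> IY \<and> (\<exists>x'\<in>Y. Y - S.fib u x = S.fib u' x')"
    then obtain x' where x': "x' \<in> Y" "Y - S.fib u x = S.fib u' x'" by blast
    have "Cs u' x' = Z - Cs u x" using Cs_edge[OF u _ x(2) x'(2) x(1) x'(1)] a by blast
    moreover have "Cs u' x' \<in> T.bl (W u')" using Cs_ne[of u' x'] Cs_block(2)[of u'] a x' by blast
    ultimately show ?thesis using a by (simp add: G_def)
  next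
    assume a: "u' \<in> Y \<and> u' = x \<and> S.fib u x = {x}"
    then have "Cs u x = {F x}" using Cs_leaf[OF u x(1)] by blast
    then show ?thesis using a Y_IY F_Z[OF x(1)] by (auto simp: G_def T.bl_X)
  qed
  have "G u' \<in> T.VV" using x(3) W F_Z Y_IY by (auto simp: G_def T.VV_def)
  then show "adj T.EE (W u) (G u')" using 1 2 W[OF u] by (auto simp: T.adj_iff T.VV_def)
qed

text \<open>Two adjacent leaves would make up all of Y.\<close>

lemma no_leaf_edge: "adj S.EE u u' \<Longrightarrow> u \<in> Y \<Longrightarrow> u' \<in> IY"
proof (rule ccontr)
  assume a: "adj S.EE u u'" "u \<in> Y" "u' \<notin> IY"
  then have u': "u' \<in> Y" by (auto simp: S.adj_iff S.VV_def)
  have "Y - (Y - {u}) \<in> S.bl u'" using a by (auto simp: S.adj_iff S.bl_X)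
  then have "Y - (Y - {u}) = Y - {u'}" using u' by (simp add: S.bl_X)
  then have "Y \<subseteq> {u, u'}" using a(2) by auto
  then have "card Y \<le> card {u, u'}" by (intro card_mono) auto
  also have "\<dots> \<le> 2" by (simp add: card_insert_if)
  finally show False using S.cardX by simp
qed

lemma cover_TT: "cover Y S.TT Z T.TT G fv"
  unfolding cover_def
proof (intro conjI)
  have tE: "tE S.TT = S.EE" "tE T.TT = T.EE" by (simp_all add: S.TT_def T.TT_def)
  show "tree_of_spheres Y S.TT" "tree_of_spheres Z T.TT" using S.tree_of_spheres_TT T.tree_of_spheres_TT by auto
  show "G ` tV S.TT \<subseteq> tV T.TT" using W F_Z by (auto simp: S.tV_TT T.tV_TT G_def)
  show "G ` Y \<subseteq> Z" using F_Z Y_IY by (auto simp: G_def)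
  show "G ` IV S.TT \<subseteq> IV T.TT" using W by (auto simp: S.IV_TT T.IV_TT G_def)
  show "\<forall>v w. {v, w} \<in> tE S.TT \<longrightarrow> {G v, G w} \<in> tE T.TT"
  proof (intro allI impI)
    have int: "adj T.EE (G v) (G w)" if v: "v \<in> IY" and a: "adj S.EE v w" for v w
    proof -
      obtain x where x: "x \<in> Y" "S.fib v x \<in> S.bl v" "Y - S.fib v x \<in> S.bl w"
        "(w \<in> IY \<and> (\<exists>x'\<in>Y. Y - S.fib v x = S.fib w x')) \<or> (w \<in> Y \<and> w = x \<and> S.fib v x = {x})"
        using edge_form[OF v a] .
      then show ?thesis using edge_image(3)[OF v a x(1,2,4)] v by (simp add: G_def)
    qed
    fix v w assume "{v, w} \<in> tE S.TT"
    then have a: "adj S.EE v w" by (simp add: tE adj_def)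
    have "v \<in> IY \<or> w \<in> IY" using a no_leaf_edge[OF a] by (auto simp: S.adj_iff S.VV_def)
    then have "adj T.EE (G v) (G w)" using int[OF _ a] int[OF _ S.adj_sym[OF a]] T.adj_sym by blast
    then show "{G v, G w} \<in> tE T.TT" by (simp add: tE adj_def)
  qed
  obtain p q eta zeta where vl: "\<And>v. v \<in> IY \<Longrightarrow>
    vertex_limit d Y Z F deg (p v) (q v) (eta v) (zeta v) (P v) (Q v) (aY v) (aZ (W v))"
    using limits_ex by blast
  show "\<forall>v\<in>IV S.TT. (\<exists>e\<ge>1. rat_map e (fv v)) \<and>
      covering_space (stereo ` (UNIV - attach S.TT v)) (stereo \<circ> fv v \<circ> inv stereo) (stereo ` (UNIV - attach T.TT (G v))) \<and>
      (\<forall>e\<in>edges_at (tE S.TT) v. fv v (tI S.TT v e) = tI T.TT (G v) (G ` e))"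
  proof
    fix v assume "v \<in> IV S.TT"
    then have v: "v \<in> IY" by (simp add: S.IV_TT)
    interpret V: vertex_limit d Y Z F deg "p v" "q v" "eta v" "zeta v" "P v" "Q v" "aY v" "aZ (W v)" by (rule vl[OF v])
    have fv: "fv v = V.g" by (simp add: fv_def)
    have Gv: "G v = W v" using v by (simp add: G_def)
    have rm: "rat_map V.e (fv v)" unfolding fv by (rule V.rat_map_g)
    show "(\<exists>e\<ge>1. rat_map e (fv v)) \<and>
      covering_space (stereo ` (UNIV - attach S.TT v)) (stereo \<circ> fv v \<circ> inv stereo) (stereo ` (UNIV - attach T.TT (G v))) \<and>
      (\<forall>e\<in>edges_at (tE S.TT) v. fv v (tI S.TT v e) = tI T.TT (G v) (G ` e))"
    proof (intro conjI ballI)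
      show "\<exists>e\<ge>1. rat_map e (fv v)" using rm V.e_pos by blast
      show "covering_space (stereo ` (UNIV - attach S.TT v)) (stereo \<circ> fv v \<circ> inv stereo) (stereo ` (UNIV - attach T.TT (G v)))"
      proof (rule rat_map_covering[OF rm V.e_pos])
        \<comment> \<open>Every direction at v lies over a marked value, and conversely every
          preimage of a marked value is a limit of marked points: punctures correspond exactly to
          punctures.\<close>
        show "attach S.TT v = {x. fv v x \<in> attach T.TT (G v)}"
          unfolding S.attach_TT[OF v] Gv T.attach_TT[OF W[OF v]]
        proof (intro set_eqI iffI)
          fix s assume "s \<in> Some ` aY v ` Y"
          then obtain x where x: "x \<in> Y" "s = Some (aY v x)" by auto
          then show "s \<in> {x. fv v x \<in> Some ` aZ (W v) ` Z}" using Cs_ne[OF v x(1)] by (auto simp: Cs_def)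
        next
          fix s assume "s \<in> {x. fv v x \<in> Some ` aZ (W v) ` Z}"
          then show "s \<in> Some ` aY v ` Y" using V.fibre_in_limit unfolding fv by auto
        qed
        show "ldeg (fv v) x = 1" if "x \<notin> attach S.TT v" for x
          using V.critical_in_limit that unfolding S.attach_TT[OF v] fv by blast
      qed
      fix e assume "e \<in> edges_at (tE S.TT) v"
      then obtain u where u: "e = {v, u}" "adj S.EE v u" by (auto simp: tE S.edges_at_iff)
      obtain x where x: "x \<in> Y" "S.fib v x \<in> S.bl v" "Y - S.fib v x \<in> S.bl u"
        "(u \<in> IY \<and> (\<exists>x'\<in>Y. Y - S.fib v x = S.fib u x')) \<or> (u \<in> Y \<and> u = x \<and> S.fib v x = {x})"
        using edge_form[OF v u(2)] .
      have 1: "tI S.TT v e = Some (aY v x)" unfolding u(1)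
        by (rule S.tI_TT[OF v u(2) x(2,3)]) (use x(1) in \<open>simp add: S.fib_def\<close>)
      obtain b where b: "b \<in> Cs v x" using Cs_ne[OF v x(1)] by blast
      have "tI T.TT (W v) {W v, G u} = Some (aZ (W v) b)"
        using T.tI_TT[OF W[OF v] edge_image(3,1,2)[OF v u(2) x(1,2,4)] b] .
      moreover have "fv v (Some (aY v x)) = Some (aZ (W v) b)" using b by (simp add: Cs_def)
      ultimately show "fv v (tI S.TT v e) = tI T.TT (G v) (G ` e)" unfolding 1 by (simp add: u(1) Gv)
    qed
  qed
  show "\<forall>v\<in>IV S.TT. \<forall>w\<in>IV S.TT. {v, w} \<in> tE S.TT \<longrightarrow> ldeg (fv v) (tI S.TT v {v, w}) = ldeg (fv w) (tI S.TT w {v, w})"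
  proof (intro ballI impI)
    fix v w assume "v \<in> IV S.TT" "w \<in> IV S.TT" "{v, w} \<in> tE S.TT"
    then have v: "v \<in> IY" "w \<in> IY" "adj S.EE v w" unfolding S.IV_TT by (simp_all add: tE adj_def)
    obtain x where x: "x \<in> Y" "S.fib v x \<in> S.bl v" "Y - S.fib v x \<in> S.bl w"
      "(w \<in> IY \<and> (\<exists>x'\<in>Y. Y - S.fib v x = S.fib w x')) \<or> (w \<in> Y \<and> w = x \<and> S.fib v x = {x})"
      using edge_form[OF v(1,3)] .
    obtain x' where x': "x' \<in> Y" "Y - S.fib v x = S.fib w x'" using x(4) Y_IY v(2) by blast
    have 1: "tI S.TT v {v, w} = Some (aY v x)"
      by (rule S.tI_TT[OF v(1,3) x(2,3)]) (use x(1) in \<open>simp add: S.fib_def\<close>)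
    have "Y - (Y - S.fib v x) = S.fib v x" by (auto simp: S.fib_def)
    then have 2: "tI S.TT w {w, v} = Some (aY w x')"
      by (intro S.tI_TT[OF v(2) S.adj_sym[OF v(3)] x(3)]) (use x' x(2) in \<open>auto simp: S.fib_def\<close>)
    show "ldeg (fv v) (tI S.TT v {v, w}) = ldeg (fv w) (tI S.TT w {v, w})"
      using Cs_edge[OF v(1,2) x(2) x'(2) x(1) x'(1)] 1 2 by (simp add: insert_commute)
  qed
qed

text \<open>The neighbour of a leaf sees it as a block of its own, where the count identifies the
  local degree with that of the portrait.\<close>

lemma leaf_deg_TT:
  assumes a: "a \<in> Y" shows "leaf_deg S.TT fv a = deg a"
proof -
  have aV: "a \<in> S.VV" using a by (simp add: S.VV_def)
  obtain u where u: "u \<in> S.VV" "Y - (Y - {a}) \<in> S.bl u" using S.bl_next[OF aV, of "Y - {a}"] a by (auto simp: S.bl_X)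
  have au: "adj S.EE a u" using u aV a by (auto simp: S.adj_iff S.bl_X)
  have uI: "u \<in> IY" using no_leaf_edge[OF au a] .
  have yy: "Y - (Y - {a}) = {a}" using a by auto
  have bl: "{a} \<in> S.bl u" using u(2) by (simp only: yy)
  have the: "(THE u. {a, u} \<in> tE S.TT) = u"
  proof (rule the_equality)
    show "{a, u} \<in> tE S.TT" using au by (simp add: S.TT_def adj_def)
    fix w assume "{a, w} \<in> tE S.TT"
    then have "adj S.EE a w" by (simp add: S.TT_def adj_def)
    then have "w \<in> S.VV" "Y - (Y - {a}) \<in> S.bl w" using a by (auto simp: S.adj_iff S.bl_X)
    then show "w = u" using S.bl_unique u by blast
  qed
  have fib: "S.fib u a = {a}"
  proof -
    obtain x where x: "x \<in> Y" "{a} = S.fib u x" using bl uI by (auto simp: S.bl_I)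
    have "a \<in> S.fib u x" unfolding x(2)[symmetric] by simp
    then have "S.fib u a = S.fib u x" by (simp add: S.fib_def)
    then show ?thesis by (simp only: x(2))
  qed
  have "tI S.TT u {u, a} = Some (aY u a)"
    by (rule S.tI_TT[OF uI S.adj_sym[OF au] bl]) (use a in \<open>auto simp: S.bl_X\<close>)
  then show ?thesis unfolding leaf_deg_def the Let_def using Cs_leaf[OF uI a fib] by (simp add: insert_commute)
qed

lemma dyn_converges_TT:
  assumes TX: "\<And>v n. v \<in> IV TX \<Longrightarrow> \<phi>Y n v = \<phi>Z n v"
  shows "dyn_converges f y z F deg X TX Y S.TT Z T.TT G fv \<phi>Y \<phi>Z"
  unfolding dyn_converges_def
proof (intro conjI)
  show "\<forall>a\<in>Y. G a = F a \<and> leaf_deg S.TT fv a = deg a" using leaf_deg_TT Y_IY by (auto simp: G_def)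
  show "\<forall>v\<in>IV TX. \<forall>n. \<phi>Y n v = \<phi>Z n v" using TX by blast
  obtain p q eta zeta where vl: "\<And>v. v \<in> IY \<Longrightarrow>
    vertex_limit d Y Z F deg (p v) (q v) (eta v) (zeta v) (P v) (Q v) (aY v) (aZ (W v))"
    "\<And>v n. v \<in> IY \<Longrightarrow> \<phi>Z n (W v) \<circ> f n \<circ> inv (\<phi>Y n v) = rat_fun (p v n) (q v n)"
    using limits_ex by blast
  show "\<forall>v\<in>IV S.TT. (\<forall>n. mobius (\<phi>Y n v) \<and> mobius (\<phi>Z n (G v))) \<and>
     (\<forall>a\<in>Y. cs_tendsto (\<lambda>n. \<phi>Y n v (y n a)) (amark S.TT v a)) \<and>
     (\<forall>b\<in>Z. cs_tendsto (\<lambda>n. \<phi>Z n (G v) (z n b)) (amark T.TT (G v) b)) \<and>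
     locunif_conv (\<lambda>n. \<phi>Z n (G v) \<circ> f n \<circ> inv (\<phi>Y n v)) (fv v) (attach S.TT v)"
  proof
    fix v assume "v \<in> IV S.TT"
    then have v: "v \<in> IY" by (simp add: S.IV_TT)
    have Gv: "G v = W v" using v by (simp add: G_def)
    interpret V: vertex_limit d Y Z F deg "p v" "q v" "eta v" "zeta v" "P v" "Q v" "aY v" "aZ (W v)" by (rule vl[OF v])
    have "locunif_conv (\<lambda>n. rat_fun (p v n) (q v n)) (fv v) (attach S.TT v)"
      unfolding S.attach_TT[OF v] fv_def
      by (rule locunif_conv_rat[OF V.red V.lim_p V.lim_q V.hom_limit])
    then show "(\<forall>n. mobius (\<phi>Y n v) \<and> mobius (\<phi>Z n (G v))) \<and>
     (\<forall>a\<in>Y. cs_tendsto (\<lambda>n. \<phi>Y n v (y n a)) (amark S.TT v a)) \<and>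
     (\<forall>b\<in>Z. cs_tendsto (\<lambda>n. \<phi>Z n (G v) (z n b)) (amark T.TT (G v) b)) \<and>
     locunif_conv (\<lambda>n. \<phi>Z n (G v) \<circ> f n \<circ> inv (\<phi>Y n v)) (fv v) (attach S.TT v)"
      unfolding Gv vl(2)[OF v] using mobY[OF v] mobZ[OF W[OF v]] limY(1)[OF v] limZ(1)[OF W[OF v]]
        S.amark_TT[OF v] T.amark_TT[OF W[OF v]] by simp
  qed
qed

end

text \<open>Leaves separate nothing in either tree; at \<open>v0\<close>, separation of leaves is
  distinctness of the same positions; and a triple containing \<open>v0\<close> is separated by
  \<open>v0\<close> in neither tree.\<close>

lemma sub_tos_tripod:
  assumes T: "split_tree Y I a" and X: "split_tree X {v0} c" "X \<subseteq> Y" and v0: "v0 \<in> I"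
    and eq: "\<And>x. x \<in> X \<Longrightarrow> c v0 x = a v0 x"
  shows "sub_tos X (split_tree.TT X {v0} c) Y (split_tree.TT Y I a)"
proof -
  interpret T: split_tree Y I a by (rule T)
  interpret X: split_tree X "{v0}" c by (rule X(1))
  show ?thesis unfolding sub_tos_def compatible_def
  proof (intro conjI ballI)
    show "X \<subseteq> Y" by (rule X(2))
    show "IV X.TT \<subseteq> IV T.TT" using v0 by (simp add: X.IV_TT T.IV_TT)
    show "amark X.TT v x = amark T.TT v x" if "v \<in> IV X.TT" "x \<in> X" for v x
      using that X(2) v0 eq X.amark_TT[of v x] T.amark_TT[of v x] by (auto simp: X.IV_TT)
    fix v v1 v2 v3 assume V: "v \<in> tV X.TT" "v1 \<in> tV X.TT" "v2 \<in> tV X.TT" "v3 \<in> tV X.TT"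
    have tt: "tV X.TT = X.VV" "tE X.TT = X.EE" "tV T.TT = T.VV" "tE T.TT = T.EE" by (simp_all add: X.TT_def T.TT_def)
    show "separates (tV X.TT) (tE X.TT) v v1 v2 v3 = separates (tV T.TT) (tE T.TT) v v1 v2 v3"
    proof (cases "v \<in> X")
      case True
      then show ?thesis unfolding tt using X.not_separates_leaf T.not_separates_leaf X(2) by blast
    next
      case False
      then have v: "v = v0" using V(1) by (simp add: X.tV_TT)
      show ?thesis
      proof (cases "v1 \<in> X \<and> v2 \<in> X \<and> v3 \<in> X")
        case True
        then show ?thesis unfolding tt v
          using X.separates_internal[of v0 v1 v2 v3] T.separates_internal[OF v0, of v1 v2 v3] X(2) eq by auto
      next
        case f: False
        then have "v1 = v0 \<or> v2 = v0 \<or> v3 = v0" using V by (auto simp: X.tV_TT)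
        then show ?thesis unfolding v separates_def by auto
      qed
    qed
  qed
qed

section \<open>The limit dynamical system\<close>

lemma split_tree_tripod:
  assumes "card X = 3" "v0 \<notin> X" "inj_on (c v0) X"
  shows "split_tree X {v0} c"
proof
  show "finite X" using assms(1) by (simp add: card_ge_0_finite)
  show "card (c v ` X) \<ge> 3" if "v \<in> {v0}" for v using that assms card_image[OF assms(3)] by simp
  show "\<exists>v\<in>{v0}. distinct [c v x, c v y, c v z]" if "x \<in> X" "y \<in> X" "z \<in> X" "distinct [x, y, z]" for x y z
    using that inj_onD[OF assms(3)] by auto
qed (use assms in auto)

text \<open>Chosen by \<open>SOME\<close> and not given by a formula, since any of the three points
  may be infinity; three values determine the map anyway.\<close>

definition nrm :: "cs \<Rightarrow> cs \<Rightarrow> cs \<Rightarrow> cs \<Rightarrow> cs" where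
  "nrm x y z = (SOME \<phi>. mobius \<phi> \<and> \<phi> x = Some 0 \<and> \<phi> y = Some 1 \<and> \<phi> z = None)"

lemma nrm:
  assumes "distinct [x, y, z]"
  shows "mobius (nrm x y z)" "nrm x y z x = Some 0" "nrm x y z y = Some 1" "nrm x y z z = None"
  using someI_ex[OF mobius_three_ex[OF assms]] unfolding nrm_def by blast+

abbreviation nrm3 :: "(nat \<Rightarrow> cs) \<Rightarrow> nat \<times> nat \<times> nat \<Rightarrow> cs \<Rightarrow> cs" where
  "nrm3 y t \<equiv> nrm (y (fst t)) (y (fst (snd t))) (y (snd (snd t)))"

text \<open>In the chart of t the points of t sit at the images under A of 0, 1 and infinity for
  every n, so they remain distinct in the limit; the rest is
  \<open>common_triple_converges\<close>.\<close>

lemma triple_charts: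
  assumes inj: "\<And>n. inj_on (y n) S" and A: "mobius A"
    and lim: "\<And>t e. t \<in> triples S \<Longrightarrow> e \<in> S \<Longrightarrow> cs_tendsto (\<lambda>n. A (nrm3 (y n) t (y n e))) (Some (\<alpha> t e))"
      "\<And>t e n. t \<in> triples S \<Longrightarrow> e \<in> S \<Longrightarrow> A (nrm3 (y n) t (y n e)) \<noteq> None"
  shows "\<And>n t. t \<in> triples S \<Longrightarrow> mobius (A \<circ> nrm3 (y n) t)"
    and "\<And>t. t \<in> triples S \<Longrightarrow> separated (\<alpha> t) t"
    and "\<And>t t' e e'. t \<in> triples S \<Longrightarrow> t' \<in> triples S \<Longrightarrow> separated (\<alpha> t) t' \<Longrightarrow> e \<in> S \<Longrightarrow> e' \<in> S \<Longrightarrow>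
      \<alpha> t e = \<alpha> t e' \<longleftrightarrow> \<alpha> t' e = \<alpha> t' e'"
proof -
  have S: "fst t \<in> S" "fst (snd t) \<in> S" "snd (snd t) \<in> S" if "t \<in> triples S" for t
    using that by (auto simp: triples_def)
  have dist: "distinct [y n (fst t), y n (fst (snd t)), y n (snd (snd t))]" if "t \<in> triples S" for n t
    using that inj_onD[OF inj] by (auto simp: triples_def)
  show mob: "mobius (A \<circ> nrm3 (y n) t)" if "t \<in> triples S" for n t
    using mobius_comp[OF A nrm(1)[OF dist[OF that]]] .
  show own: "separated (\<alpha> t) t" if t: "t \<in> triples S" for t
  proof -
    have "Some (\<alpha> t (fst t)) = A (Some 0)" "Some (\<alpha> t (fst (snd t))) = A (Some 1)" "Some (\<alpha> t (snd (snd t))) = A None"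
      using lim(1)[OF t S(1)[OF t]] lim(1)[OF t S(2)[OF t]] lim(1)[OF t S(3)[OF t]]
      unfolding nrm(2-4)[OF dist[OF t]] by (auto intro: cs_tendsto_unique)
    moreover have "inj A" using mobius_bij[OF A] bij_is_inj by blast
    then have "A (Some 0) \<noteq> A (Some 1)" "A (Some 0) \<noteq> A None" "A (Some 1) \<noteq> A None" by (auto simp: inj_eq)
    ultimately show ?thesis by auto
  qed
  show "\<alpha> t e = \<alpha> t e' \<longleftrightarrow> \<alpha> t' e = \<alpha> t' e'"
    if t: "t \<in> triples S" "t' \<in> triples S" "separated (\<alpha> t) t'" and e: "e \<in> S" "e' \<in> S" for t t' e e'
    by (rule common_triple_converges(2)[where S = S and y = y and \<phi> = "\<lambda>n. A \<circ> nrm3 (y n) t" and \<theta> = "\<lambda>n. A \<circ> nrm3 (y n) t'",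
          OF mob[OF t(1)] mob[OF t(2)] inj _ _ _ _ S(1)[OF t(2)] S(2)[OF t(2)] S(3)[OF t(2)] t(3) own[OF t(2)] e])
      (use lim t in auto)
qed

theorem theorem5p5:
  fixes d p :: nat and f :: "nat \<Rightarrow> cs \<Rightarrow> cs" and M :: "nat \<Rightarrow> nat \<Rightarrow> cs \<Rightarrow> cs"
  assumes "d \<ge> 2"
    and "\<forall>n. rat_map d (f n)"
    and "p \<ge> 1"
    and "\<forall>i\<in>{1..p}. rescaling f (M i)"
  shows "\<exists>\<sigma>. strict_mono \<sigma> \<and>
    (\<exists>X Y Z Fp deg y z TX TY TZ F fv \<phi>Y \<phi>Z.
       finite X \<and> X \<subseteq> Y \<inter> Z \<and>
       portrait d Y Z Fp deg \<and>
       (\<forall>n. dyn_marked d Y Z Fp deg X (f (\<sigma> n)) (y n) (z n)) \<and>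
       dyn_system X TX Y TY Z TZ F fv \<and>
       dyn_converges (\<lambda>n. f (\<sigma> n)) y z Fp deg X TX Y TY Z TZ F fv \<phi>Y \<phi>Z \<and>
       (\<forall>i\<in>{1..p}. \<exists>v\<in>IV TY. resc_equiv (\<lambda>n. M i (\<sigma> n)) (\<lambda>n. \<phi>Y n v)))"
proof -
  have d: "d \<ge> 1" and f: "\<And>n. rat_map d (f n)" using assms by auto
  define X where "X = {0, 1, 2 :: nat}"
  \<comment> \<open>Any three distinct finite numbers would do; finite ones, because the three-point
    criterion is stated in finite coordinates.\<close>
  define pt :: "nat \<Rightarrow> complex" where "pt k = (if k = 0 then 0 else if k = 1 then 1 else -1)" for k
  define \<rho> where "\<rho> n = (\<lambda>(i, k). inv (M i n) (Some (pt k)))" for n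
  define J where "J = {1..p} \<times> {..<3::nat}"
  have finJ: "finite J" by (simp add: J_def)
  obtain \<sigma>1 Y Z F deg y z mk where \<sigma>1: "strict_mono (\<sigma>1 :: nat \<Rightarrow> nat)" and XYZ: "X \<subseteq> Y \<inter> Z"
    and port: "portrait d Y Z F deg"
    and dm: "\<forall>n. dyn_marked d Y Z F deg X (f (\<sigma>1 n)) (y n) (z n)"
    and mk: "\<forall>j\<in>J. mk j \<in> Y \<and> (\<forall>n. y n (mk j) = \<rho> (\<sigma>1 n) j)"
    using marked_points[of d f J \<rho>, OF f d finJ] unfolding X_def[symmetric] by blast
  have finYZ: "finite Y" "finite Z" using port by (auto simp: portrait_def)
  have inj: "inj_on (y n) Y" "inj_on (z n) Z" and yz: "\<And>x. x \<in> X \<Longrightarrow> y n x = z n x" for n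
    using dm by (auto simp: dyn_marked_def)
  \<comment> \<open>Source and target positions form one finite family, so that a single A serves
    both and the two charts at the common vertex coincide.\<close>
  define s where "s = case_sum (\<lambda>(t, e) n. nrm3 (y n) t (y n e)) (\<lambda>(t, e) n. nrm3 (z n) t (z n e))"
  define D where "D = (triples Y \<times> Y) <+> (triples Z \<times> Z)"
  have "finite D" unfolding D_def using finYZ finite_triples by simp
  then obtain r A l where r: "strict_mono (r :: nat \<Rightarrow> nat)" and A: "mobius A"
    and lim: "\<forall>i\<in>D. cs_tendsto (\<lambda>n. A (s i (r n))) (Some (l i)) \<and> (\<forall>n. A (s i (r n)) \<noteq> None)"
    using finite_charts[of D s] by blast
  define y2 z2 where "y2 n = y (r n)" and "z2 n = z (r n)" for n
  define \<alpha>Y \<alpha>Z where "\<alpha>Y t e = l (Inl (t, e))" and "\<alpha>Z t e = l (Inr (t, e))" for t :: "nat \<times> nat \<times> nat" and e :: nat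
  have limY: "cs_tendsto (\<lambda>n. A (nrm3 (y2 n) t (y2 n e))) (Some (\<alpha>Y t e))" "A (nrm3 (y2 n) t (y2 n e)) \<noteq> None"
    if "t \<in> triples Y" "e \<in> Y" for t e n
    using bspec[OF lim, of "Inl (t, e)"] that by (auto simp: D_def s_def y2_def \<alpha>Y_def)
  have limZ: "cs_tendsto (\<lambda>n. A (nrm3 (z2 n) t (z2 n e))) (Some (\<alpha>Z t e))" "A (nrm3 (z2 n) t (z2 n e)) \<noteq> None"
    if "t \<in> triples Z" "e \<in> Z" for t e n
    using bspec[OF lim, of "Inr (t, e)"] that by (auto simp: D_def s_def z2_def \<alpha>Z_def)
  have inj2: "inj_on (y2 n) Y" "inj_on (z2 n) Z" for n using inj by (auto simp: y2_def z2_def)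
  have mobY0: "mobius (A \<circ> nrm3 (y2 n) t)" if "t \<in> triples Y" for n t
    by (rule triple_charts(1)[of y2 Y A \<alpha>Y, OF inj2(1) A limY]) (use that in simp_all)
  have ownY: "separated (\<alpha>Y t) t" if "t \<in> triples Y" for t
    by (rule triple_charts(2)[of y2 Y A \<alpha>Y, OF inj2(1) A limY]) (use that in simp_all)
  have kerY: "\<alpha>Y t e = \<alpha>Y t e' \<longleftrightarrow> \<alpha>Y t' e = \<alpha>Y t' e'"
    if "t \<in> triples Y" "t' \<in> triples Y" "separated (\<alpha>Y t) t'" "e \<in> Y" "e' \<in> Y" for t t' e e'
    by (rule triple_charts(3)[of y2 Y A \<alpha>Y, OF inj2(1) A limY]) (use that in simp_all)
  have mobZ0: "mobius (A \<circ> nrm3 (z2 n) t)" if "t \<in> triples Z" for n t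
    by (rule triple_charts(1)[of z2 Z A \<alpha>Z, OF inj2(2) A limZ]) (use that in simp_all)
  have ownZ: "separated (\<alpha>Z t) t" if "t \<in> triples Z" for t
    by (rule triple_charts(2)[of z2 Z A \<alpha>Z, OF inj2(2) A limZ]) (use that in simp_all)
  have kerZ: "\<alpha>Z t e = \<alpha>Z t e' \<longleftrightarrow> \<alpha>Z t' e = \<alpha>Z t' e'"
    if "t \<in> triples Z" "t' \<in> triples Z" "separated (\<alpha>Z t) t'" "e \<in> Z" "e' \<in> Z" for t t' e e'
    by (rule triple_charts(3)[of z2 Z A \<alpha>Z, OF inj2(2) A limZ]) (use that in simp_all)
  define K where "K = Suc (Max (Y \<union> Z))"
  have K: "s < K" if "s \<in> Y \<union> Z" for s
    unfolding K_def using that finYZ by (simp add: less_Suc_eq_le)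
  define t0 :: "nat \<times> nat \<times> nat" where "t0 = (0, 1, 2)"
  have t0: "t0 \<in> triples Y" "t0 \<in> triples Z" using XYZ by (auto simp: t0_def triples_def X_def)
  define v0 where "v0 = label K t0"
  define aY aZ where "aY v = \<alpha>Y (unlabel K v)" and "aZ v = \<alpha>Z (unlabel K v)" for v
  obtain IY where IY: "IY \<subseteq> label K ` triples Y" "v0 \<in> IY" "split_tree Y IY aY"
    using tree_from_triples[of Y K t0 \<alpha>Y, OF finYZ(1) K t0(1) ownY kerY] unfolding v0_def aY_def by blast
  obtain IZ where IZ: "IZ \<subseteq> label K ` triples Z" "v0 \<in> IZ" "split_tree Z IZ aZ"
    using tree_from_triples[of Z K t0 \<alpha>Z, OF finYZ(2) K t0(2) ownZ kerZ] unfolding v0_def aZ_def by blast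
  define \<phi>Y where "\<phi>Y n v = A \<circ> nrm3 (y2 n) (unlabel K v)" for n v
  define \<phi>Z where "\<phi>Z n v = A \<circ> nrm3 (z2 n) (unlabel K v)" for n v
  have uY: "unlabel K v \<in> triples Y" if "v \<in> IY" for v using that IY(1) by auto
  have uZ: "unlabel K v \<in> triples Z" if "v \<in> IZ" for v using that IZ(1) by auto
  have mobY: "mobius (\<phi>Y n v)" if "v \<in> IY" for n v unfolding \<phi>Y_def using mobY0[OF uY[OF that]] .
  have mobZ: "mobius (\<phi>Z n v)" if "v \<in> IZ" for n v unfolding \<phi>Z_def using mobZ0[OF uZ[OF that]] .
  have lY: "cs_tendsto (\<lambda>n. \<phi>Y n v (y2 n a)) (Some (aY v a))" "\<phi>Y n v (y2 n a) \<noteq> None" if "v \<in> IY" "a \<in> Y" for v a n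
    unfolding \<phi>Y_def aY_def o_apply using limY uY that by auto
  have lZ: "cs_tendsto (\<lambda>n. \<phi>Z n v (z2 n a)) (Some (aZ v a))" "\<phi>Z n v (z2 n a) \<noteq> None" if "v \<in> IZ" "a \<in> Z" for v a n
    unfolding \<phi>Z_def aZ_def o_apply using limZ uZ that by auto
  define f2 where "f2 n = f (\<sigma>1 (r n))" for n
  \<comment> \<open>Only the existence of a target chart is recorded, since this passes to further
    subsequences as \<open>finite_common_subseq\<close> requires.\<close>
  define C where "C v \<tau> \<longleftrightarrow> (\<exists>\<psi> P Q \<zeta>. (\<forall>n. mobius (\<psi> n)) \<and> converges_to d (\<lambda>n. f2 (\<tau> n)) (\<lambda>n. \<phi>Y (\<tau> n) v) \<psi> P Q \<and>
    (\<forall>b\<in>Z. cs_tendsto (\<lambda>n. \<psi> n (z2 (\<tau> n) b)) (Some (\<zeta> b)) \<and> (\<forall>n. \<psi> n (z2 (\<tau> n) b) \<noteq> None)))" for v and \<tau> :: "nat \<Rightarrow> nat"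
  have "\<exists>\<tau>. strict_mono \<tau> \<and> (\<forall>v\<in>IY. C v \<tau>)"
  proof (rule finite_common_subseq)
    show "finite IY" using split_tree.finI[OF IY(3)] .
    show "\<exists>s. strict_mono s \<and> C v (\<lambda>n. \<tau> (s n))" if "v \<in> IY" "strict_mono \<tau>" for v and \<tau> :: "nat \<Rightarrow> nat"
    proof -
      have "\<exists>s \<psi> P Q \<zeta>. strict_mono (s :: nat \<Rightarrow> nat) \<and> (\<forall>n. mobius (\<psi> n)) \<and>
        converges_to d (\<lambda>n. f2 (\<tau> (s n))) (\<lambda>n. \<phi>Y (\<tau> (s n)) v) \<psi> P Q \<and>
        (\<forall>b\<in>Z. cs_tendsto (\<lambda>n. \<psi> n (z2 (\<tau> (s n)) b)) (Some (\<zeta> b)) \<and> (\<forall>n. \<psi> n (z2 (\<tau> (s n)) b) \<noteq> None))"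
        by (rule converges_to_exists[of d "\<lambda>n. f2 (\<tau> n)" "\<lambda>n. \<phi>Y (\<tau> n) v" Z "\<lambda>n. z2 (\<tau> n)"])
          (use f d mobY[OF that(1)] finYZ in \<open>auto simp: f2_def\<close>)
      then show ?thesis unfolding C_def by blast
    qed
    show "C v (\<lambda>n. \<tau> (s n))" if h: "v \<in> IY" "C v \<tau>" "strict_mono s" for v and \<tau> s :: "nat \<Rightarrow> nat"
    proof -
      obtain \<psi> P Q \<zeta> where c: "\<forall>n. mobius (\<psi> n)" "converges_to d (\<lambda>n. f2 (\<tau> n)) (\<lambda>n. \<phi>Y (\<tau> n) v) \<psi> P Q"
        "\<forall>b\<in>Z. cs_tendsto (\<lambda>n. \<psi> n (z2 (\<tau> n) b)) (Some (\<zeta> b)) \<and> (\<forall>n. \<psi> n (z2 (\<tau> n) b) \<noteq> None)"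
        using h(2) unfolding C_def by blast
      have "cs_tendsto (\<lambda>n. \<psi> (s n) (z2 (\<tau> (s n)) b)) (Some (\<zeta> b))" if "b \<in> Z" for b
        using cs_tendsto_subseq[OF _ h(3), of "\<lambda>n. \<psi> n (z2 (\<tau> n) b)"] c(3) that by blast
      then show ?thesis unfolding C_def using c converges_to_subseq[OF c(2) h(3)]
        by (intro exI[of _ "\<lambda>n. \<psi> (s n)"] exI[of _ P] exI[of _ Q] exI[of _ \<zeta>]) simp
    qed
  qed
  then obtain \<tau> where \<tau>: "strict_mono \<tau>" "\<forall>v\<in>IY. C v \<tau>" by blast
  define R where "R v \<psi> P Q \<zeta> \<longleftrightarrow> (\<forall>n. mobius (\<psi> n)) \<and> converges_to d (\<lambda>n. f2 (\<tau> n)) (\<lambda>n. \<phi>Y (\<tau> n) v) \<psi> P Q \<and>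
    (\<forall>b\<in>Z. cs_tendsto (\<lambda>n. \<psi> n (z2 (\<tau> n) b)) (Some (\<zeta> b)) \<and> (\<forall>n. \<psi> n (z2 (\<tau> n) b) \<noteq> None))" for v \<psi> P Q \<zeta>
  have "\<forall>v\<in>IY. \<exists>\<psi> P Q \<zeta>. R v \<psi> P Q \<zeta>" using \<tau>(2) unfolding C_def R_def .
  from bchoice[OF this] obtain \<psi> where "\<forall>v\<in>IY. \<exists>P Q \<zeta>. R v (\<psi> v) P Q \<zeta>" ..
  from bchoice[OF this] obtain P where "\<forall>v\<in>IY. \<exists>Q \<zeta>. R v (\<psi> v) (P v) Q \<zeta>" ..
  from bchoice[OF this] obtain Q where "\<forall>v\<in>IY. \<exists>\<zeta>. R v (\<psi> v) (P v) (Q v) \<zeta>" ..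
  from bchoice[OF this] obtain \<zeta> where \<psi>: "\<forall>v\<in>IY. R v (\<psi> v) (P v) (Q v) (\<zeta> v)" ..
  define \<sigma> where "\<sigma> n = \<sigma>1 (r (\<tau> n))" for n
  have \<sigma>: "strict_mono \<sigma>" unfolding \<sigma>_def using strict_mono_compose[OF \<sigma>1 strict_mono_compose[OF r \<tau>(1)]] .
  have dm': "dyn_marked d Y Z F deg X (f (\<sigma> n)) (y2 (\<tau> n)) (z2 (\<tau> n))" for n
    using dm by (simp add: \<sigma>_def y2_def z2_def)
  have f2: "f2 (\<tau> n) = f (\<sigma> n)" for n by (simp add: f2_def \<sigma>_def)
  interpret SY: split_tree Y IY aY by (rule IY(3))
  interpret SZ: split_tree Z IZ aZ by (rule IZ(3))
  interpret MS: marked_sequence Y IY aY Z IZ aZ d F deg X "\<lambda>n. f (\<sigma> n)" "\<lambda>n. y2 (\<tau> n)" "\<lambda>n. z2 (\<tau> n)" "\<lambda>n. \<phi>Y (\<tau> n)" "\<lambda>n. \<phi>Z (\<tau> n)"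
    by unfold_locales (use d port dm' mobY mobZ lY(2) lZ(2) cs_tendsto_subseq[OF lY(1) \<tau>(1)] cs_tendsto_subseq[OF lZ(1) \<tau>(1)] in auto)
  have \<psi>': "mobius (\<psi> v n)" "converges_to d (\<lambda>n. f (\<sigma> n)) (\<lambda>n. \<phi>Y (\<tau> n) v) (\<psi> v) (P v) (Q v)"
    if "v \<in> IY" for v n using bspec[OF \<psi> that] unfolding R_def f2 by auto
  have \<psi>'': "cs_tendsto (\<lambda>n. \<psi> v n (z2 (\<tau> n) b)) (Some (\<zeta> v b))" "\<psi> v n (z2 (\<tau> n) b) \<noteq> None"
    if "v \<in> IY" "b \<in> Z" for v b n using bspec[OF \<psi> that(1)] that(2) unfolding R_def by auto
  have "\<forall>v\<in>IY. \<exists>w. \<exists>P' Q'. w \<in> IZ \<and> converges_to d (\<lambda>n. f (\<sigma> n)) (\<lambda>n. \<phi>Y (\<tau> n) v) (\<lambda>n. \<phi>Z (\<tau> n) w) P' Q'"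
  proof
    fix v assume v: "v \<in> IY"
    have "\<exists>w\<in>IZ. \<exists>P' Q'. converges_to d (\<lambda>n. f (\<sigma> n)) (\<lambda>n. \<phi>Y (\<tau> n) v) (\<lambda>n. \<phi>Z (\<tau> n) w) P' Q'"
      by (rule MS.image_vertex[of \<psi> P Q \<zeta>]) (use \<psi>' \<psi>'' v in auto)
    then show "\<exists>w. \<exists>P' Q'. w \<in> IZ \<and> converges_to d (\<lambda>n. f (\<sigma> n)) (\<lambda>n. \<phi>Y (\<tau> n) v) (\<lambda>n. \<phi>Z (\<tau> n) w) P' Q'" by blast
  qed
  from bchoice[OF this] obtain W where "\<forall>v\<in>IY. \<exists>P' Q'. W v \<in> IZ \<and>
      converges_to d (\<lambda>n. f (\<sigma> n)) (\<lambda>n. \<phi>Y (\<tau> n) v) (\<lambda>n. \<phi>Z (\<tau> n) (W v)) P' Q'" ..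
  from bchoice[OF this] obtain P' where "\<forall>v\<in>IY. \<exists>Q'. W v \<in> IZ \<and>
      converges_to d (\<lambda>n. f (\<sigma> n)) (\<lambda>n. \<phi>Y (\<tau> n) v) (\<lambda>n. \<phi>Z (\<tau> n) (W v)) (P' v) Q'" ..
  from bchoice[OF this] obtain Q' where W: "\<forall>v\<in>IY. W v \<in> IZ \<and>
      converges_to d (\<lambda>n. f (\<sigma> n)) (\<lambda>n. \<phi>Y (\<tau> n) v) (\<lambda>n. \<phi>Z (\<tau> n) (W v)) (P' v) (Q' v)" ..
  interpret LC: limit_cover Y IY aY Z IZ aZ d F deg X "\<lambda>n. f (\<sigma> n)" "\<lambda>n. y2 (\<tau> n)" "\<lambda>n. z2 (\<tau> n)" "\<lambda>n. \<phi>Y (\<tau> n)" "\<lambda>n. \<phi>Z (\<tau> n)" W P' Q'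
    by unfold_locales (use W in auto)
  have v0X: "v0 \<notin> X" using XYZ IY(2) SY.disj by auto
  have y2z2: "y2 n x = z2 n x" if "x \<in> X" for n x using yz that by (simp add: y2_def z2_def)
  \<comment> \<open>The same A, the same triple (0, 1, 2) and the same marked points on both
    sides.\<close>
  have phi0: "\<phi>Y n v0 = \<phi>Z n v0" for n
    unfolding \<phi>Y_def \<phi>Z_def v0_def using y2z2 by (simp add: t0_def X_def)
  have a0: "aY v0 x = aZ v0 x" if "x \<in> X" for x
  proof -
    have "cs_tendsto (\<lambda>n. \<phi>Y n v0 (y2 n x)) (Some (aY v0 x))" "cs_tendsto (\<lambda>n. \<phi>Y n v0 (y2 n x)) (Some (aZ v0 x))"
      using lY(1)[OF IY(2), of x] lZ(1)[OF IZ(2), of x] that XYZ unfolding phi0 y2z2[OF that] by auto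
    then show ?thesis using cs_tendsto_unique by blast
  qed
  have "separated (aY v0) t0" using ownY[OF t0(1)] by (simp add: aY_def v0_def)
  then have injX: "inj_on (aY v0) X" by (auto simp: t0_def X_def inj_on_def)
  have triX: "split_tree X {v0} aY" by (rule split_tree_tripod[of X v0 aY, OF _ v0X injX]) (simp add: X_def)
  define TX where "TX = split_tree.TT X {v0} aY"
  have IVX: "IV TX = {v0}" unfolding TX_def using split_tree.IV_TT[OF triX] .
  have dyn: "dyn_system X TX Y SY.TT Z SZ.TT LC.G LC.fv"
    unfolding dyn_system_def
  proof (intro conjI)
    show "cover Y SY.TT Z SZ.TT LC.G LC.fv" by (rule LC.cover_TT)
    show "tree_of_spheres X TX" unfolding TX_def by (rule split_tree.tree_of_spheres_TT[OF triX])
    show "X \<subseteq> Y \<inter> Z" by (rule XYZ)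
    show "sub_tos X TX Y SY.TT" unfolding TX_def
      by (rule sub_tos_tripod[OF IY(3) triX _ IY(2)]) (use XYZ in auto)
    show "sub_tos X TX Z SZ.TT" unfolding TX_def
      by (rule sub_tos_tripod[OF IZ(3) triX _ IZ(2) a0]) (use XYZ in auto)
  qed
  have conv: "dyn_converges (\<lambda>n. f (\<sigma> n)) (\<lambda>n. y2 (\<tau> n)) (\<lambda>n. z2 (\<tau> n)) F deg X TX Y SY.TT Z SZ.TT LC.G LC.fv (\<lambda>n. \<phi>Y (\<tau> n)) (\<lambda>n. \<phi>Z (\<tau> n))"
    by (rule LC.dyn_converges_TT) (simp add: IVX phi0)
  have resc: "\<exists>v\<in>IV SY.TT. resc_equiv (\<lambda>n. M i (\<sigma> n)) (\<lambda>n. \<phi>Y (\<tau> n) v)" if i: "i \<in> {1..p}" for i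
  proof -
    have mobM: "mobius (M i n)" for n using assms(4) i by (auto simp: rescaling_def)
    define e where "e k = mk (i, k)" for k :: nat
    have e: "e k \<in> Y" "y2 (\<tau> n) (e k) = inv (M i (\<sigma> n)) (Some (pt k))" if "k < 3" for k n
      using bspec[OF mk, of "(i, k)"] i that by (auto simp: J_def e_def y2_def \<rho>_def \<sigma>_def)
    have ne: "e k \<noteq> e k'" if k: "k < 3" "k' < 3" "k \<noteq> k'" for k k'
    proof
      assume "e k = e k'"
      then have "inv (M i (\<sigma> 0)) (Some (pt k)) = inv (M i (\<sigma> 0)) (Some (pt k'))" using e(2) k by metis
      moreover have "inj (inv (M i (\<sigma> 0)))" using mobius_bij[OF mobius_inv[OF mobM]] bij_is_inj by blast
      ultimately have "pt k = pt k'" by (auto dest: injD)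
      then show False using k by (auto simp: pt_def split: if_splits)
    qed
    \<comment> \<open>Some vertex separates the three points marked for this class. The map from the
      rescaled coordinate to its chart then sends three fixed points to sequences with distinct
      limits, and hence converges.\<close>
    have "distinct [e 0, e 1, e 2]" using ne[of 0 1] ne[of 0 2] ne[of 1 2] by simp
    then obtain v where v: "v \<in> IY" "distinct [aY v (e 0), aY v (e 1), aY v (e 2)]"
      using SY.sep[of "e 0" "e 1" "e 2"] e(1) by auto
    define u where "u k n = the (\<phi>Y (\<tau> n) v (y2 (\<tau> n) (e k)))" for k n
    have uk: "(\<phi>Y (\<tau> n) v \<circ> inv (M i (\<sigma> n))) (Some (pt k)) = Some (u k n)" "(\<lambda>n. u k n) \<longlonglongrightarrow> aY v (e k)"
      if "k < 3" for k n
    proof -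
      show "(\<phi>Y (\<tau> n) v \<circ> inv (M i (\<sigma> n))) (Some (pt k)) = Some (u k n)"
        using e(2)[OF that, of n] lY(2)[OF v(1) e(1)[OF that], of "\<tau> n"] by (auto simp: u_def)
      show "(\<lambda>n. u k n) \<longlonglongrightarrow> aY v (e k)" unfolding u_def
        by (rule cs_tendsto_the[OF cs_tendsto_subseq[OF lY(1)[OF v(1) e(1)[OF that]] \<tau>(1)] lY(2)[OF v(1) e(1)[OF that]]])
    qed
    have mobA: "mobius (\<phi>Y (\<tau> n) v \<circ> inv (M i (\<sigma> n)))" for n
      by (rule mobius_comp[OF mobY[OF v(1)] mobius_inv[OF mobM]])
    have dpt: "distinct [pt 0, pt 1, pt 2]" by (simp add: pt_def)
    have "mob_converges (\<lambda>n. \<phi>Y (\<tau> n) v \<circ> inv (M i (\<sigma> n)))"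
      by (rule three_point_convergence[OF mobA dpt dpt tendsto_const tendsto_const tendsto_const
            uk(1)[of 0] uk(1)[of 1] uk(1)[of 2] uk(2)[of 0] uk(2)[of 1] uk(2)[of 2] v(2)])
        simp_all
    then show ?thesis unfolding resc_equiv_def using v(1) by (auto simp: SY.IV_TT)
  qed
  show ?thesis
  proof (intro exI conjI allI ballI)
    show "strict_mono \<sigma>" by (rule \<sigma>)
    show "finite X" by (simp add: X_def)
    show "X \<subseteq> Y \<inter> Z" by (rule XYZ)
    show "portrait d Y Z F deg" by (rule port)
    show "dyn_marked d Y Z F deg X (f (\<sigma> n)) (y2 (\<tau> n)) (z2 (\<tau> n))" for n by (rule dm')
    show "dyn_system X TX Y SY.TT Z SZ.TT LC.G LC.fv" by (rule dyn)
    show "dyn_converges (\<lambda>n. f (\<sigma> n)) (\<lambda>n. y2 (\<tau> n)) (\<lambda>n. z2 (\<tau> n)) F deg X TX Y SY.TT Z SZ.TT LC.G LC.fv (\<lambda>n. \<phi>Y (\<tau> n)) (\<lambda>n. \<phi>Z (\<tau> n))"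
      by (rule conv)
    show "\<exists>v\<in>IV SY.TT. resc_equiv (\<lambda>n. M i (\<sigma> n)) (\<lambda>n. \<phi>Y (\<tau> n) v)" if "i \<in> {1..p}" for i by (rule resc[OF that])
  qed
qed

end
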